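(* Let $N\ge2$ and let $\mathcal L=(K,S,\{f_s\}_{s\in S})$ be a subsystem of $2$-dimensional cubic tiling that is non-degenerate, locally symmetric and strongly connected. Assume one of the following two conditions: (RS) $\Theta_{\pi/2}\in\mathcal G_{(K,T)}$, where $\Theta_{\pi/2}$ is the rotation by $\pi/2$ around $(0,0)$; (NS) for each $i,j\in\{1,\dots,N\}$ there exist $i_1,j_1\in\{1,\dots,N-1\}$ such that $\{(i_1,j),(i_1+1,j),(i,j_1),(i,j_1+1)\}\cap S=\emptyset$. Then $K$ is $p$-conductively homogeneous for every $p>\dim_{AR}(K,d_* )$, where $d_*$ is the restriction of the Euclidean metric to $K$.
   Context: Cubic tiling (with $L=2$). $C_*=[-1,1]^2$; $\mathbb B_2=\{g\in O(2):g(C_* )=C_*\}$; $B_{j,i}=\{x\in C_*:x_j=i\}$ for $j\in\{1,2\}$, $i\in\{1,-1\}$. For $s\in\{1,\dots,N\}^2$, $C_s=\prod_{i=1}^2[\frac{2s_i-2-N}N,\frac{2s_i-N}N]$ and $c_s=(\frac{2s_1-1-N}N,\frac{2s_2-1-N}N)$. A subsystem of $2$-dimensional cubic tiling is a triple $(K,S,\{f_s\}_{s\in S})$ with $S\subseteq\{1,\dots,N\}^2$, $f_s(x)=\frac1N\Phi_sx+c_s$ with $\Phi_s\in\mathbb B_2$ for $s\in S$, and $K\subseteq C_*$ the non-empty compact set with $K=\bigcup_{s\in S}f_s(K)$. Set $T_n=S^n$ (words of length $n$), $T=\bigcup_{n\ge0}T_n$, $f_w=f_{w_1}\circ\cdots\circ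 f_{w_n}$, $K_w=f_w(K)$. It is non-degenerate if $K\cap B_{j,i}\ne\emptyset$ for all $j\in\{1,2\}$, $i\in\{1,-1\}$. Let $E_n^\ell$ be the set of $(w,v)\in T_n^2$, $w\ne v$, such that $f_w(C_* )\cap f_v(C_* )=f_w(B_{j,i})$ for some $j\in\{1,2\}$, $i\in\{1,-1\}$. It is strongly connected if the graph $(T_n,E_n^\ell)$ is connected for all $n\ge1$; it is locally symmetric if for all $n\ge1$, $(w,v)\in E_n^\ell$, the set $K_w\cup K_v$ is invariant under the reflection in the line containing $f_w(C_* )\cap f_v(C_* )$. $\mathcal G_{(K,T)}$ is the set of homeomorphisms $g:K\to K$ for which there is $g^*:T\to T$ with $|g^*(w)|=|w|$ and $g(K_w)=K_{g^*(w)}$ for all $w\in T$ ($|w|$ is the word length); an isometry of $\mathbb R^2$ is said to belong to $\mathcal G_{(K,T)}$ if its restriction to $K$ does. Conductive homogeneity. For $w\in T$, $S^m(w)\subseteq T_{|w|+m}$ is the set of words of length $|w|+m$ with prefix $w$. $E_n^*=\{(w,v)\in T_n^2:w\neq v,K_w\cap K_v\ne\emptyset\}$, $\Gamma_1(w)=\{v\in T_{|w|}:K_v\cap K_w\ne\emptyset\}$. For $A\subseteq T_n$, $f:A\to\mathbb R$, $\mathcal E^n_{p,A}(f)=\frac12\sum_{u,v\in A,(u,v)\in E_n^*}|f(u)-f(v)|^p$. $\mathcal E_{1,p,m}=\sup_{w\in T,|w|\ge1}\inf\{\mathcal E^{|w|+m}_{p,T_{|w|+m}}(f): f=1\text{ on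 }S^m(w),\ f=0\text{ on }S^m(v)\text{ for all }v\in T_{|w|}\setminus\Gamma_1(w)\}$. $(f)_A$ is the arithmetic mean of $f$ over $A\subseteq T_n$ (the reference measure being the self-similar measure with $\mu(K_w)=(\#S)^{-|w|}$). $\sigma_{p,m}=\sup_{n\ge1}\sup_{(w,v)\in E_n^*}\sup_f|(f)_{S^m(w)}-(f)_{S^m(v)}|^p/\mathcal E^{n+m}_{p,S^m(w)\cup S^m(v)}(f)$, the last supremum over non-constant $f:S^m(w)\cup S^m(v)\to\mathbb R$. $K$ is $p$-conductively homogeneous if $\sup_{m\ge0}\sigma_{p,m}\mathcal E_{1,p,m}<\infty$. $\dim_{AR}(K,d)$ is the infimum of all $\alpha$ for which there exist a metric $\rho$ on $K$ quasisymmetric to $d$ and a Borel regular measure that is $\alpha$-Ahlfors regular with respect to $\rho$. *)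

theory Defs
  imports "HOL-Analysis.Analysis" "HOL-Library.Sublist"
begin

section \<open>Subsystems of the planar cubic tiling\<close>

definition square :: "(real^2) set" where
  "square = cbox (\<chi> i. -1) (\<chi> i. 1)"

definition square_side :: "2 \<Rightarrow> real \<Rightarrow> (real^2) set" where
  "square_side j i = {x \<in> square. x $ j = i}"

definition square_symmetries :: "(real^2 \<Rightarrow> real^2) set" where
  "square_symmetries = {g. orthogonal_transformation g \<and> g ` square = square}"

definition centre :: "nat \<Rightarrow> nat \<times> nat \<Rightarrow> real^2" where
  "centre N s = vector [(2 * real (fst s) - 1 - real N) / real N,
                        (2 * real (snd s) - 1 - real N) / real N]"

definition cubic_subsystem ::
    "nat \<Rightarrow> (real^2) set \<Rightarrow> (nat \<times> nat) set \<Rightarrow> (nat \<times> nat \<Rightarrow> real^2 \<Rightarrow> real^2) \<Rightarrow> bool" where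
  "cubic_subsystem N K S f \<longleftrightarrow>
     S \<subseteq> {1..N} \<times> {1..N} \<and>
     (\<forall>s\<in>S. \<exists>\<Phi>\<in>square_symmetries. f s = (\<lambda>x. (1 / real N) *\<^sub>R \<Phi> x + centre N s)) \<and>
     K \<subseteq> square \<and> compact K \<and> K \<noteq> {} \<and> K = (\<Union>s\<in>S. f s ` K)"

definition words :: "'s set \<Rightarrow> nat \<Rightarrow> 's list set" where
  "words S n = {w \<in> lists S. length w = n}"

text \<open>\<open>word_map f [s\<^sub>1, \<dots>, s\<^sub>n]\<close> is the composition with \<open>f s\<^sub>1\<close> outermost.\<close>

definition word_map :: "('s \<Rightarrow> 'a \<Rightarrow> 'a) \<Rightarrow> 's list \<Rightarrow> 'a \<Rightarrow> 'a" where
  "word_map f w = foldr (\<lambda>s g. f s \<circ> g) w id"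

definition cell :: "'a set \<Rightarrow> ('s \<Rightarrow> 'a \<Rightarrow> 'a) \<Rightarrow> 's list \<Rightarrow> 'a set" where
  "cell K f w = word_map f w ` K"

definition non_degenerate :: "(real^2) set \<Rightarrow> bool" where
  "non_degenerate K \<longleftrightarrow> (\<forall>j. \<forall>i\<in>{1, -1}. K \<inter> square_side j i \<noteq> {})"

definition side_edges ::
    "'s set \<Rightarrow> ('s \<Rightarrow> real^2 \<Rightarrow> real^2) \<Rightarrow> nat \<Rightarrow> ('s list \<times> 's list) set" where
  "side_edges S f n = {(w, v). w \<in> words S n \<and> v \<in> words S n \<and> w \<noteq> v \<and>
     (\<exists>j. \<exists>i\<in>{1, -1}. word_map f w ` square \<inter> word_map f v ` square
                        = word_map f w ` square_side j i)}"

text \<open>Graphs are undirected, whence the symmetric closure of the edge relation.\<close>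

definition graph_connected :: "'v set \<Rightarrow> ('v \<times> 'v) set \<Rightarrow> bool" where
  "graph_connected V E \<longleftrightarrow> (\<forall>u\<in>V. \<forall>v\<in>V. (u, v) \<in> (E \<union> E\<inverse>)\<^sup>*)"

definition strongly_connected :: "'s set \<Rightarrow> ('s \<Rightarrow> real^2 \<Rightarrow> real^2) \<Rightarrow> bool" where
  "strongly_connected S f \<longleftrightarrow> (\<forall>n\<ge>1. graph_connected (words S n) (side_edges S f n))"

text \<open>For a nonempty affine subspace \<open>L\<close>, \<open>closest_point L\<close> is the orthogonal projection
  onto \<open>L\<close>.\<close>

definition reflection_in :: "'a::euclidean_space set \<Rightarrow> 'a \<Rightarrow> 'a" where
  "reflection_in L x = 2 *\<^sub>R closest_point L x - x"

text \<open>For \<open>(w, v)\<close> in \<^const>\<open>side_edges\<close> the intersection of the two squares is a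
  nondegenerate segment, so its affine hull is the line containing it.\<close>

definition locally_symmetric ::
    "(real^2) set \<Rightarrow> 's set \<Rightarrow> ('s \<Rightarrow> real^2 \<Rightarrow> real^2) \<Rightarrow> bool" where
  "locally_symmetric K S f \<longleftrightarrow> (\<forall>n\<ge>1. \<forall>(w, v) \<in> side_edges S f n.
     reflection_in (affine hull (word_map f w ` square \<inter> word_map f v ` square))
       ` (cell K f w \<union> cell K f v) = cell K f w \<union> cell K f v)"

text \<open>Homeomorphisms of \<open>K\<close> are represented by maps on the ambient type; membership
  depends only on the restriction to \<open>K\<close>.\<close>

definition cell_homeos :: "'a::topological_space set \<Rightarrow> 's set \<Rightarrow> ('s \<Rightarrow> 'a \<Rightarrow> 'a) \<Rightarrow> ('a \<Rightarrow> 'a) set" where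
  "cell_homeos K S f = {g. (\<exists>h. homeomorphism K K g h) \<and>
     (\<exists>g' \<in> lists S \<rightarrow> lists S. \<forall>w \<in> lists S.
        length (g' w) = length w \<and> g ` cell K f w = cell K f (g' w))}"

definition rotation :: "real \<Rightarrow> real^2 \<Rightarrow> real^2" where
  "rotation t x = vector [cos t * x $ 1 - sin t * x $ 2, sin t * x $ 1 + cos t * x $ 2]"


section \<open>Conductive homogeneity\<close>

definition descendants :: "'s set \<Rightarrow> nat \<Rightarrow> 's list \<Rightarrow> 's list set" where
  "descendants S m w = {v \<in> words S (length w + m). prefix w v}"

definition meet_edges ::
    "'a set \<Rightarrow> 's set \<Rightarrow> ('s \<Rightarrow> 'a \<Rightarrow> 'a) \<Rightarrow> nat \<Rightarrow> ('s list \<times> 's list) set" where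
  "meet_edges K S f n = {(w, v). w \<in> words S n \<and> v \<in> words S n \<and> w \<noteq> v \<and>
     cell K f w \<inter> cell K f v \<noteq> {}}"

definition neighbours ::
    "'a set \<Rightarrow> 's set \<Rightarrow> ('s \<Rightarrow> 'a \<Rightarrow> 'a) \<Rightarrow> 's list \<Rightarrow> 's list set" where
  "neighbours K S f w = {v \<in> words S (length w). cell K f v \<inter> cell K f w \<noteq> {}}"

definition energy ::
    "'a set \<Rightarrow> 's set \<Rightarrow> ('s \<Rightarrow> 'a \<Rightarrow> 'a) \<Rightarrow> real \<Rightarrow> nat \<Rightarrow> 's list set \<Rightarrow> ('s list \<Rightarrow> real) \<Rightarrow> real" where
  "energy K S f p n A h =
     1 / 2 * (\<Sum>(u, v) \<in> meet_edges K S f n \<inter> A \<times> A. \<bar>h u - h v\<bar> powr p)"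

definition conductance ::
    "'a set \<Rightarrow> 's set \<Rightarrow> ('s \<Rightarrow> 'a \<Rightarrow> 'a) \<Rightarrow> real \<Rightarrow> nat \<Rightarrow> ennreal" where
  "conductance K S f p m = (SUP w \<in> {w \<in> lists S. length w \<ge> 1}.
     INF h \<in> {h. (\<forall>u \<in> descendants S m w. h u = 1) \<and>
                 (\<forall>v \<in> words S (length w) - neighbours K S f w. \<forall>u \<in> descendants S m v. h u = 0)}.
       ennreal (energy K S f p (length w + m) (words S (length w + m)) h))"

definition mean :: "'v set \<Rightarrow> ('v \<Rightarrow> real) \<Rightarrow> real" where
  "mean A h = (\<Sum>u\<in>A. h u) / real (card A)"

definition neighbour_disparity ::
    "'a set \<Rightarrow> 's set \<Rightarrow> ('s \<Rightarrow> 'a \<Rightarrow> 'a) \<Rightarrow> real \<Rightarrow> nat \<Rightarrow> ennreal" where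
  "neighbour_disparity K S f p m = (SUP n \<in> {1..}. SUP (w, v) \<in> meet_edges K S f n.
     SUP h \<in> {h. \<not> h constant_on (descendants S m w \<union> descendants S m v)}.
       ennreal (\<bar>mean (descendants S m w) h - mean (descendants S m v) h\<bar> powr p) /
       ennreal (energy K S f p (n + m) (descendants S m w \<union> descendants S m v) h))"

definition conductively_homogeneous ::
    "'a set \<Rightarrow> 's set \<Rightarrow> ('s \<Rightarrow> 'a \<Rightarrow> 'a) \<Rightarrow> real \<Rightarrow> bool" where
  "conductively_homogeneous K S f p \<longleftrightarrow>
     (SUP m. neighbour_disparity K S f p m * conductance K S f p m) < \<infinity>"


section \<open>Ahlfors regular conformal dimension\<close>

definition quasisymmetric_metrics :: "'a set \<Rightarrow> ('a \<Rightarrow> 'a \<Rightarrow> real) \<Rightarrow> ('a \<Rightarrow> 'a \<Rightarrow> real) \<Rightarrow> bool" where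
  "quasisymmetric_metrics X d \<rho> \<longleftrightarrow> (\<exists>\<eta> \<eta>'. homeomorphism {0..} {0..} \<eta> \<eta>' \<and>
     (\<forall>x\<in>X. \<forall>y\<in>X. \<forall>z\<in>X. x \<noteq> z \<longrightarrow> \<rho> x y / \<rho> x z \<le> \<eta> (d x y / d x z)))"

definition borel_sets_of :: "'a topology \<Rightarrow> 'a set set" where
  "borel_sets_of T = sigma_sets (topspace T) {U. openin T U}"

text \<open>The \<open>\<sigma>\<close>-algebra may be larger than the Borel one, but every measurable set has a
  Borel hull of the same measure.\<close>

definition borel_regular_measure :: "'a topology \<Rightarrow> 'a measure \<Rightarrow> bool" where
  "borel_regular_measure T M \<longleftrightarrow> space M = topspace T \<and> borel_sets_of T \<subseteq> sets M \<and>
     (\<forall>A \<in> sets M. \<exists>B \<in> borel_sets_of T. A \<subseteq> B \<and> emeasure M A = emeasure M B)"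

definition ahlfors_regular :: "'a set \<Rightarrow> ('a \<Rightarrow> 'a \<Rightarrow> real) \<Rightarrow> real \<Rightarrow> 'a measure \<Rightarrow> bool" where
  "ahlfors_regular X \<rho> \<alpha> M \<longleftrightarrow> (\<exists>c C. 0 < c \<and> 0 < C \<and>
     (\<forall>x\<in>X. \<forall>r. 0 < r \<and> ereal r \<le> (SUP (y, z) \<in> X \<times> X. ereal (\<rho> y z)) \<longrightarrow>
        ennreal (c * r powr \<alpha>) \<le> emeasure M (Metric_space.mball X \<rho> x r) \<and>
        emeasure M (Metric_space.mball X \<rho> x r) \<le> ennreal (C * r powr \<alpha>)))"

definition dim_AR :: "'a set \<Rightarrow> ('a \<Rightarrow> 'a \<Rightarrow> real) \<Rightarrow> ereal" where
  "dim_AR X d = Inf (ereal ` {\<alpha>. 0 < \<alpha> \<and> (\<exists>\<rho> M. Metric_space X \<rho> \<and>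
     quasisymmetric_metrics X d \<rho> \<and>
     borel_regular_measure (Metric_space.mtopology X \<rho>) M \<and> ahlfors_regular X \<rho> \<alpha> M)})"

end

theory Submission
  imports Defs "HOL-Library.Transitive_Closure_Table"
begin

text \<open>Reflections in grid lines fold the cells of one generation consistently onto each other, so all
  of them carry the same graph up to a symmetry of the square. A connected set of cells that leaves
  the neighbourhood of a cell runs through a whole row or column of the grid and hence folds to a
  crossing of a single cell. Therefore the conductances are comparable to the modulus \<open>M\<^sub>m\<close> of the
  crossings of the unit cell by cells of generation \<open>m\<close>. These moduli are submultiplicative up to a
  constant, and for \<open>p\<close> above the conformal dimension the weights \<open>w \<mapsto> diam\<^sub>\<rho> K\<^sub>w\<close>, with \<open>\<rho>\<close> a suitable
  Ahlfors regular metric, show that they come arbitrarily close to 0; so they decay geometrically.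
  Horizontal and vertical moduli are comparable, either by the rotation or because a vertical crossing
  cannot stay in two adjacent columns of generation two without being stopped by a gap.

  Conversely, for a function of small energy there are a horizontal and a vertical crossing along which it
  varies little; their copies in the children of a cell form a connected net. Nets of consecutive
  generations intersect by planarity, so the oscillation of the function is at most its energy to the
  power \<open>1/p\<close> times the sum of \<open>M\<^sub>j\<close> to the power \<open>-1/p\<close> over the generations \<open>j\<close> below the cell. This sum
  is geometric and dominated by its last term, which bounds the neighbour disparity by a constant
  over the conductance.\<close>

section \<open>Symmetries of the square\<close>

text \<open>The maps \<open>f s\<close> may carry arbitrary symmetries of the square, so a fold onto
  a cell can interchange the axes, and the direction of a folded crossing is lost. Estimates from
  above therefore involve the larger of the two moduli, while short crossings in both directions
  require a bound from below for the smaller one. The alternative between rotation and gaps closes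
  this gap at the price of two generations, whence the shifts \<open>2 + j\<close>. Cells may also
  meet only at a vertex, where local symmetry says nothing. The fold is therefore defined on the
  whole square, by triangle waves in grid coordinates, and strong connectivity shows that all cells
  of one generation have the same folded image; contact at vertices is then handled like contact
  along sides. Planarity is applied to broken lines made of chords of cells, not to arcs in
  \<open>K\<close>. Finally, folding controls squares with neighbouring indices, whereas the
  conductance is defined by contact of cells; a fixed number of extra generations reconciles the
  two.\<close>

lemma mem_square: "x \<in> square \<longleftrightarrow> (\<forall>i. -1 \<le> x $ i \<and> x $ i \<le> 1)"
  by (simp add: square_def mem_box_cart)

definition open_square :: "(real^2) set" where
  "open_square = {x. \<forall>i. -1 < x $ i \<and> x $ i < 1}"

lemma zero_in_open_square: "0 \<in> open_square"
  by (simp add: open_square_def)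

definition other :: "2 \<Rightarrow> 2" where "other i = (if i = 1 then 2 else 1)"

lemma other_neq: "other i \<noteq> i" by (simp add: other_def)

lemma other_cases: "k = i \<or> k = other i" for i k :: 2
  using exhaust_2[of i] exhaust_2[of k] by (auto simp: other_def)

lemma other_other [simp]: "other (other i) = i"
  using exhaust_2[of i] by (auto simp: other_def)

lemma all2_other: "(\<forall>k. P k) \<longleftrightarrow> P i \<and> P (other i)" for i :: 2
  using other_cases by metis

text \<open>The columns \<open>a\<close> and \<open>b\<close> of \<open>g\<close> are orthonormal,
  and the corners force \<open>a + b\<close> and \<open>a - b\<close> into the square. Both have
  norm \<open>sqrt 2\<close>, so all their coordinates are 1 or -1; comparing the squares of these
  coordinates gives \<open>a $ i * b $ i = 0\<close>, and each row has a single nonzero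
  entry.\<close>

lemma square_symmetry_signed_permutation:
  assumes "g \<in> square_symmetries"
  obtains \<pi> :: "2 \<Rightarrow> 2" and e :: "2 \<Rightarrow> real"
  where "bij \<pi>" "\<And>i. e i \<in> {1, -1}" "\<And>x i. g x $ i = e i * x $ \<pi> i"
proof -
  have orth: "orthogonal_transformation g" and sq: "g ` square = square"
    using assms by (auto simp: square_symmetries_def)
  then have lin: "linear g" by (simp add: orthogonal_transformation_linear)
  define a where "a = g (axis 1 1)"
  define b where "b = g (axis 2 1)"
  have gx: "g x = x $ 1 *\<^sub>R a + x $ 2 *\<^sub>R b" for x
  proof -
    have "x = x $ 1 *\<^sub>R axis 1 1 + x $ 2 *\<^sub>R axis 2 1"
      by (simp add: vec_eq_iff forall_2 axis_def)
    then have "g x = g (x $ 1 *\<^sub>R axis 1 1 + x $ 2 *\<^sub>R axis 2 1)" by simp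
    also have "\<dots> = x $ 1 *\<^sub>R a + x $ 2 *\<^sub>R b"
      using lin by (simp add: linear_add linear_scale a_def b_def)
    finally show ?thesis .
  qed
  have "a \<bullet> a = 1" "b \<bullet> b = 1" "a \<bullet> b = 0"
    using orth unfolding orthogonal_transformation_def a_def b_def
    by (auto simp: inner_axis_axis)
  then have n: "a$1 * a$1 + a$2 * a$2 = 1" "b$1 * b$1 + b$2 * b$2 = 1" "a$1 * b$1 + a$2 * b$2 = 0"
    by (simp_all add: inner_vec_def sum_2)
  have "a + b \<in> square" "a - b \<in> square"
  proof -
    have "vector [1,1] \<in> square" "vector [1,-1] \<in> square"
      by (auto simp: mem_square forall_2)
    then have "g (vector [1,1]) \<in> square" "g (vector [1,-1]) \<in> square" using sq by blast+
    then show "a + b \<in> square" "a - b \<in> square" by (simp_all add: gx)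
  qed
  then have bd: "\<bar>a$1 + b$1\<bar> \<le> 1" "\<bar>a$2 + b$2\<bar> \<le> 1" "\<bar>a$1 - b$1\<bar> \<le> 1" "\<bar>a$2 - b$2\<bar> \<le> 1"
    by (auto simp: mem_square forall_2 abs_le_iff)
  have sq1: "t * t \<le> 1" if "\<bar>t\<bar> \<le> 1" for t :: real
    using that by (metis abs_le_square_iff abs_one power2_eq_square one_power2)
  have s: "(a$1 + b$1) * (a$1 + b$1) \<le> 1" "(a$2 + b$2) * (a$2 + b$2) \<le> 1"
    "(a$1 - b$1) * (a$1 - b$1) \<le> 1" "(a$2 - b$2) * (a$2 - b$2) \<le> 1"
    using bd sq1 by blast+
  have ex: "(u + v) * (u + v) = u * u + 2 * (u * v) + v * v"
    "(u - v) * (u - v) = u * u - 2 * (u * v) + v * v" for u v :: real by algebra+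
  have p1: "a$1 * b$1 = 0"
    using s n unfolding ex by linarith
  have p2: "a$2 * b$2 = 0"
    using p1 n(3) by linarith
  show thesis
  proof (cases "a$1 = 0")
    case True
    then have "a$2 * a$2 = 1" using n by simp
    then have a2: "a$2 \<in> {1,-1}" using square_eq_1_iff by auto
    then have b2: "b$2 = 0" using p2 by auto
    then have "b$1 * b$1 = 1" using n by simp
    then have b1: "b$1 \<in> {1,-1}" using square_eq_1_iff by auto
    show thesis
    proof (rule that[of other "\<lambda>i. if i = 1 then b$1 else a$2"])
      show "bij other" by (metis bij_betw_def inj_def other_other surjI)
      show "(if i = 1 then b$1 else a$2) \<in> {1,-1}" for i :: 2 using a2 b1 by auto
      show "g x $ i = (if i = 1 then b$1 else a$2) * x $ other i" for x i
        using exhaust_2[of i] True b2 by (auto simp: gx other_def)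
    qed
  next
    case False
    then have b1: "b$1 = 0" using p1 by simp
    then have "b$2 * b$2 = 1" using n by simp
    then have b2: "b$2 \<in> {1,-1}" using square_eq_1_iff by auto
    then have a2: "a$2 = 0" using p2 by auto
    then have "a$1 * a$1 = 1" using n by simp
    then have a1: "a$1 \<in> {1,-1}" using square_eq_1_iff by auto
    show thesis
    proof (rule that[of id "\<lambda>i. if i = 1 then a$1 else b$2"])
      show "bij (id::2\<Rightarrow>2)" by simp
      show "(if i = 1 then a$1 else b$2) \<in> {1,-1}" for i :: 2 using a1 b2 by auto
      show "g x $ i = (if i = 1 then a$1 else b$2) * x $ id i" for x i
        using exhaust_2[of i] a2 b1 by (auto simp: gx)
    qed
  qed
qed

lemma signed_permutation_square_symmetry:
  fixes \<pi> :: "2 \<Rightarrow> 2" and e :: "2 \<Rightarrow> real"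
  assumes "bij \<pi>" and e: "\<And>i. e i \<in> {1, -1}" and g: "\<And>x i. g x $ i = e i * x $ \<pi> i"
  shows "g \<in> square_symmetries"
proof -
  have lin: "linear g"
    by (rule linearI) (auto simp: vec_eq_iff g algebra_simps)
  have ee: "e i * e i = 1" for i using e[of i] by auto
  have dist: "\<pi> 1 \<noteq> \<pi> 2" using \<open>bij \<pi>\<close> by (simp add: bij_def inj_eq)
  have pi: "\<pi> 2 = other (\<pi> 1)" using dist other_cases[of "\<pi> 2" "\<pi> 1"] by auto
  have "g x \<bullet> g y = x \<bullet> y" for x y
  proof -
    have "g x \<bullet> g y = (e 1 * e 1) * (x $ \<pi> 1 * y $ \<pi> 1) + (e 2 * e 2) * (x $ \<pi> 2 * y $ \<pi> 2)"
      by (simp add: inner_vec_def sum_2 g algebra_simps)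
    also have "\<dots> = x \<bullet> y"
      using exhaust_2[of "\<pi> 1"] by (auto simp: ee pi other_def inner_vec_def sum_2)
    finally show ?thesis .
  qed
  then have orth: "orthogonal_transformation g"
    using lin by (simp add: orthogonal_transformation_def)
  have sub: "g x \<in> square" if "x \<in> square" for x
    unfolding mem_square g
  proof
    fix i
    show "- 1 \<le> e i * x $ \<pi> i \<and> e i * x $ \<pi> i \<le> 1"
      using that e[of i] unfolding mem_square by (metis (no_types, opaque_lifting) empty_iff insert_iff minus_le_iff mult_1 mult_minus1 neg_le_iff_le)
  qed
  have sup: "y \<in> g ` square" if "y \<in> square" for y
  proof
    define x where "x = (\<chi> k. e (inv \<pi> k) * y $ inv \<pi> k)"
    show "y = g x"
      using \<open>bij \<pi>\<close> by (simp add: vec_eq_iff g x_def bij_is_inj ee flip: mult.assoc)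
    show "x \<in> square" unfolding mem_square x_def
    proof
      fix i
      show "- 1 \<le> (\<chi> k. e (inv \<pi> k) * y $ inv \<pi> k) $ i \<and> (\<chi> k. e (inv \<pi> k) * y $ inv \<pi> k) $ i \<le> 1"
        using that e[of "inv \<pi> i"] unfolding mem_square
        by (simp, metis minus_le_iff mult_1 mult_minus1 neg_le_iff_le)
    qed
  qed
  have "g ` square = square" using sub sup by blast
  then show ?thesis using orth by (simp add: square_symmetries_def)
qed

lemma square_symmetries_comp:
  "g \<in> square_symmetries \<Longrightarrow> h \<in> square_symmetries \<Longrightarrow> g \<circ> h \<in> square_symmetries"
  unfolding square_symmetries_def mem_Collect_eq image_comp[symmetric]
  by (elim conjE, intro conjI orthogonal_transformation_compose) (assumption | simp only:)+

lemma square_symmetries_bij: "g \<in> square_symmetries \<Longrightarrow> bij g"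
  by (simp add: square_symmetries_def orthogonal_transformation_bij)

lemma square_symmetries_inv:
  assumes "g \<in> square_symmetries" shows "inv g \<in> square_symmetries"
proof -
  have "orthogonal_transformation (inv g)"
    using assms by (simp add: square_symmetries_def orthogonal_transformation_inv)
  moreover have "inv g ` square = square"
    using assms square_symmetries_bij[OF assms]
    by (metis (mono_tags, lifting) bij_is_inj image_inv_f_f mem_Collect_eq square_symmetries_def)
  ultimately show ?thesis by (simp add: square_symmetries_def)
qed

lemma square_symmetries_id: "id \<in> square_symmetries"
  by (simp add: square_symmetries_def id_def orthogonal_transformation_id)

lemma square_symmetries_linear: "g \<in> square_symmetries \<Longrightarrow> linear g"
  by (simp add: square_symmetries_def orthogonal_transformation_linear)

lemma square_symmetries_continuous: "g \<in> square_symmetries \<Longrightarrow> continuous_on A g"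
  using linear_continuous_on linear_linear square_symmetries_linear by blast

lemma square_symmetries_square: "g \<in> square_symmetries \<Longrightarrow> x \<in> square \<Longrightarrow> g x \<in> square"
  by (auto simp: square_symmetries_def)

lemma square_symmetries_open_square:
  assumes "g \<in> square_symmetries" "x \<in> open_square" shows "g x \<in> open_square"
proof -
  obtain \<pi> :: "2 \<Rightarrow> 2" and e :: "2 \<Rightarrow> real" where "bij \<pi>" and e: "\<And>i. e i \<in> {1, -1}"
    and g: "\<And>x i. g x $ i = e i * x $ \<pi> i"
    using square_symmetry_signed_permutation assms(1) by metis
  have "- 1 < g x $ i \<and> g x $ i < 1" for i
  proof -
    have "- 1 < x $ \<pi> i" "x $ \<pi> i < 1" using assms(2) by (auto simp: open_square_def)
    then show ?thesis using e[of i] by (auto simp: g)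
  qed
  then show ?thesis by (simp add: open_square_def)
qed

text \<open>Finiteness is what makes the compactness argument in \<open>untouched_separation\<close>
  uniform over all generations.\<close>

lemma finite_square_symmetries: "finite square_symmetries"
proof -
  have "square_symmetries \<subseteq> (\<lambda>(\<pi>, e). \<lambda>x. \<chi> i. e i * x $ \<pi> i) `
    (UNIV \<times> (UNIV \<rightarrow>\<^sub>E {1,-1::real}))" (is "_ \<subseteq> ?R")
  proof
    fix g assume "g \<in> square_symmetries"
    then obtain \<pi> :: "2 \<Rightarrow> 2" and e :: "2 \<Rightarrow> real" where "bij \<pi>" and e: "\<And>i. e i \<in> {1, -1}"
      and g: "\<And>x i. g x $ i = e i * x $ \<pi> i"
      using square_symmetry_signed_permutation by metis
    have "g = (\<lambda>x. \<chi> i. e i * x $ \<pi> i)" by (auto simp: vec_eq_iff g)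
    then show "g \<in> ?R" using e by (auto intro!: image_eqI[of _ _ "(\<pi>, e)"])
  qed
  then show ?thesis
    by (rule finite_subset) (auto intro!: finite_imageI finite_PiE)
qed

section \<open>Cells and the grid\<close>

lemma words_0 [simp]: "words S 0 = {[]}"
  by (auto simp: words_def)

lemma words_append_iff: "w \<in> words S n \<Longrightarrow> w @ u \<in> words S (n + m) \<longleftrightarrow> u \<in> words S m"
  by (auto simp: words_def)

lemma words_take: "a \<in> words S (n + m) \<Longrightarrow> take n a \<in> words S n"
  by (auto simp: words_def dest: in_set_takeD)

lemma words_drop: "a \<in> words S (n + m) \<Longrightarrow> drop n a \<in> words S m"
  by (auto simp: words_def dest: in_set_dropD)

lemma words_Cons_iff: "s # u \<in> words S (Suc n) \<longleftrightarrow> s \<in> S \<and> u \<in> words S n"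
  by (auto simp: words_def)

lemma words_SucE:
  assumes "w \<in> words S (Suc n)"
  obtains s u where "w = s # u" "s \<in> S" "u \<in> words S n"
  using assms by (cases w) (auto simp: words_def)

lemma finite_words: "finite S \<Longrightarrow> finite (words S n)"
  by (simp add: words_def finite_lists_length_eq lists_eq_set)

lemma card_words: "finite S \<Longrightarrow> card (words S n) = card S ^ n"
  by (simp add: words_def card_lists_length_eq lists_eq_set)

lemma word_map_Nil [simp]: "word_map f [] = id"
  by (simp add: word_map_def)

lemma word_map_Cons [simp]: "word_map f (s # w) = f s \<circ> word_map f w"
  by (simp add: word_map_def)

lemma word_map_append: "word_map f (u @ w) = word_map f u \<circ> word_map f w"
  by (induction u) auto

lemma cell_append: "cell K f (u @ w) = word_map f u ` cell K f w"
  by (simp add: cell_def word_map_append image_comp)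

lemma descendants_eq: "w \<in> words S n \<Longrightarrow> descendants S m w = (@) w ` words S m"
  by (auto simp: descendants_def words_def prefix_def)

text \<open>Coordinates in which the squares of generation \<open>n\<close> are the unit squares with
  integer vertices.\<close>

definition grid_coord :: "nat \<Rightarrow> nat \<Rightarrow> real^2 \<Rightarrow> 2 \<Rightarrow> real" where
  "grid_coord N n y i = (y $ i + 1) * real N ^ n / 2"

locale tiling =
  fixes N :: nat and K :: "(real^2) set" and S :: "(nat \<times> nat) set"
    and f :: "nat \<times> nat \<Rightarrow> real^2 \<Rightarrow> real^2"
  assumes N2: "N \<ge> 2" and subsystem: "cubic_subsystem N K S f"
    and nondeg: "non_degenerate K"
    and loc_sym: "locally_symmetric K S f"
    and strong_conn: "strongly_connected S f"
begin

abbreviation "T \<equiv> words S"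
abbreviation "W \<equiv> word_map f"
abbreviation "Kc \<equiv> cell K f"
abbreviation "co \<equiv> grid_coord N"

text \<open>Rescaling the displacement from the centre recovers the linear part of
  \<open>W w\<close> without choosing symmetries for the letters.\<close>

definition lin :: "(nat \<times> nat) list \<Rightarrow> real^2 \<Rightarrow> real^2" where
  "lin w x = real N ^ length w *\<^sub>R (W w x - W w 0)"

text \<open>The centre of a square has half-integral grid coordinates, so the floor picks its lower
  left vertex. This integer pair serves as the name of the square; see
  \<open>idx_inj\<close>.\<close>

definition idx :: "(nat \<times> nat) list \<Rightarrow> 2 \<Rightarrow> int" where
  "idx w i = \<lfloor>co (length w) (W w 0) i\<rfloor>"

lemma N_pos: "real N > 0" using N2 by auto

lemma Npow_pos: "real N ^ n > 0" using N_pos by simp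

lemma finite_S: "finite S"
  using subsystem unfolding cubic_subsystem_def by (meson finite_SigmaI finite_atLeastAtMost finite_subset)

lemma finite_T: "finite (T n)" by (simp add: finite_words finite_S)

lemma K_square: "K \<subseteq> square" and K_compact: "compact K" and K_nonempty: "K \<noteq> {}"
  and K_eq: "K = (\<Union>s\<in>S. f s ` K)"
  using subsystem unfolding cubic_subsystem_def by blast+

lemma S_nonempty: "S \<noteq> {}" using K_eq K_nonempty by auto

lemma f_form:
  assumes "s \<in> S"
  obtains \<Phi> where "\<Phi> \<in> square_symmetries" "\<And>x. f s x = (1 / real N) *\<^sub>R \<Phi> x + centre N s"
    "fst s \<in> {1..N}" "snd s \<in> {1..N}"
  using subsystem assms unfolding cubic_subsystem_def by fastforce

lemma centre_nth: "centre N s $ i = (2 * real (if i = 1 then fst s else snd s) - 1 - real N) / real N"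
  using exhaust_2[of i] by (auto simp: centre_def)

lemma word_map_form:
  assumes "w \<in> T n"
  shows "\<exists>g\<in>square_symmetries. \<exists>z::2\<Rightarrow>int. (\<forall>i. 0 \<le> z i \<and> z i < int N ^ n) \<and>
     (\<forall>x i. W w x $ i = (g x $ i + 2 * z i + 1) / real N ^ n - 1)"
  using assms
proof (induction n arbitrary: w)
  case 0
  then show ?case using square_symmetries_id by (auto intro!: bexI[of _ id] exI[of _ "\<lambda>i. 0"])
next
  case (Suc n)
  obtain s u where w: "w = s # u" "s \<in> S" "u \<in> T n" using Suc.prems by (rule words_SucE)
  from Suc.IH[OF w(3)] obtain g z where g: "g \<in> square_symmetries"
    and z: "\<And>i. 0 \<le> z i \<and> z i < int N ^ n"
    and u: "\<And>x i. W u x $ i = (g x $ i + 2 * z i + 1) / real N ^ n - 1" by blast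
  obtain \<Phi> where \<Phi>: "\<Phi> \<in> square_symmetries" and fs: "\<And>x. f s x = (1 / real N) *\<^sub>R \<Phi> x + centre N s"
    and s: "fst s \<in> {1..N}" "snd s \<in> {1..N}"
    using f_form[OF w(2)] by metis
  obtain \<pi> :: "2 \<Rightarrow> 2" and e :: "2 \<Rightarrow> real" where "bij \<pi>" and e: "\<And>i. e i \<in> {1, -1}"
    and p: "\<And>x i. \<Phi> x $ i = e i * x $ \<pi> i"
    using square_symmetry_signed_permutation[OF \<Phi>] by metis
  define c where "c = (\<lambda>i::2. int (if i = 1 then fst s else snd s))"
  have c: "1 \<le> c i" "c i \<le> int N" for i using s by (auto simp: c_def)
  \<comment> \<open>If the outer symmetry reverses axis \<open>i\<close>, positions inside the
    square of \<open>s\<close> are counted from the opposite end, whence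
    \<open>int N ^ n - 1 - z (\<pi> i)\<close>.\<close>
  define z' where "z' = (\<lambda>i. (c i - 1) * int N ^ n + (if e i = 1 then z (\<pi> i) else int N ^ n - 1 - z (\<pi> i)))"
  have "\<Phi> \<circ> g \<in> square_symmetries" using \<Phi> g by (rule square_symmetries_comp)
  moreover have "0 \<le> z' i \<and> z' i < int N ^ Suc n" for i
  proof -
    let ?r = "if e i = 1 then z (\<pi> i) else int N ^ n - 1 - z (\<pi> i)"
    have r: "0 \<le> ?r" "?r \<le> int N ^ n - 1" using z[of "\<pi> i"] by auto
    have "0 \<le> (c i - 1) * int N ^ n" using c(1)[of i] by simp
    moreover have "(c i - 1) * int N ^ n \<le> (int N - 1) * int N ^ n"
      using c(2)[of i] by (intro mult_right_mono) auto
    ultimately show ?thesis using r unfolding z'_def by (simp add: algebra_simps)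
  qed
  moreover have "W w x $ i = ((\<Phi> \<circ> g) x $ i + 2 * z' i + 1) / real N ^ Suc n - 1" for x i
  proof -
    have "W w x $ i = \<Phi> (W u x) $ i / real N + centre N s $ i"
      by (simp add: w fs)
    also have "\<dots> = e i * ((g x $ \<pi> i + 2 * z (\<pi> i) + 1) / real N ^ n - 1) / real N + (2 * real_of_int (c i) - 1 - real N) / real N"
      by (simp add: p u centre_nth c_def)
    also have "\<dots> = ((\<Phi> \<circ> g) x $ i + 2 * z' i + 1) / real N ^ Suc n - 1"
    proof -
      define M where "M = real N ^ n"
      have M: "M > 0" "real_of_int (int N ^ n) = M" using Npow_pos by (auto simp: M_def)
      have z'r: "real_of_int (z' i) = (c i - 1) * M + (if e i = 1 then z (\<pi> i) else M - 1 - z (\<pi> i))"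
        unfolding M(2)[symmetric] by (simp add: z'_def)
      consider "e i = 1" | "e i = -1" using e[of i] by blast
      then show ?thesis
        using M(1) N_pos unfolding power_Suc M_def[symmetric] by cases (simp_all add: p z'r field_simps)
    qed
    finally show ?thesis .
  qed
  ultimately show ?case by blast
qed

lemma
  assumes "w \<in> T n"
  shows lin_sym: "lin w \<in> square_symmetries"
    and idx_range: "0 \<le> idx w i" "idx w i < int N ^ n"
    and W_nth: "W w x $ i = (lin w x $ i + 2 * idx w i + 1) / real N ^ n - 1"
proof -
  from word_map_form[OF assms] obtain g z where g: "g \<in> square_symmetries"
    and z: "\<And>i. 0 \<le> z i \<and> z i < int N ^ n"
    and u: "\<And>x i. W w x $ i = (g x $ i + 2 * z i + 1) / real N ^ n - 1" by blast
  have len: "length w = n" using assms by (simp add: words_def)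
  have g0: "g 0 = 0" using square_symmetries_linear[OF g] linear_0 by blast
  have "lin w x $ i = g x $ i" for x i
    using Npow_pos[of n] by (simp add: lin_def len u g0 field_simps)
  then have lg: "lin w = g" by (auto simp: vec_eq_iff)
  have "co n (W w 0) i = z i + 1/2" for i
    using Npow_pos[of n] by (simp add: grid_coord_def u g0 field_simps)
  then have iz: "idx w i = z i" for i by (simp add: idx_def len floor_eq_iff)
  show "lin w \<in> square_symmetries" "0 \<le> idx w i" "idx w i < int N ^ n"
    "W w x $ i = (lin w x $ i + 2 * idx w i + 1) / real N ^ n - 1"
    using g lg iz z u by auto
qed

lemma co_W: "w \<in> T n \<Longrightarrow> co n (W w x) i = idx w i + (lin w x $ i + 1) / 2"
  using Npow_pos[of n] by (simp add: grid_coord_def W_nth field_simps)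

lemma co_eq_iff: "x = y \<longleftrightarrow> (\<forall>i. co n x i = co n y i)"
  using Npow_pos[of n] by (auto simp: grid_coord_def vec_eq_iff)

lemma co_bounds_iff:
  "0 < co n y i \<longleftrightarrow> -1 < y $ i" "co n y i < real N ^ n \<longleftrightarrow> y $ i < 1"
  "0 \<le> co n y i \<longleftrightarrow> -1 \<le> y $ i" "co n y i \<le> real N ^ n \<longleftrightarrow> y $ i \<le> 1"
proof -
  define M where "M = real N ^ n"
  have M: "M > 0" using Npow_pos by (auto simp: M_def)
  have c: "co n y i = (y $ i + 1) / 2 * M" by (simp add: grid_coord_def M_def)
  show "0 < co n y i \<longleftrightarrow> -1 < y $ i" "0 \<le> co n y i \<longleftrightarrow> -1 \<le> y $ i"
    using M unfolding c by (auto simp: zero_less_mult_iff zero_le_mult_iff)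
  have "(y $ i + 1) / 2 * M < 1 * M \<longleftrightarrow> (y $ i + 1) / 2 < 1"
    using M mult_less_cancel_right_pos by blast
  then show "co n y i < real N ^ n \<longleftrightarrow> y $ i < 1" unfolding c M_def by simp
  have "(y $ i + 1) / 2 * M \<le> 1 * M \<longleftrightarrow> (y $ i + 1) / 2 \<le> 1"
    using M mult_le_cancel_right_pos by blast
  then show "co n y i \<le> real N ^ n \<longleftrightarrow> y $ i \<le> 1" unfolding c M_def by simp
qed

lemma co_square_bounds:
  assumes "w \<in> T n" "x \<in> square"
  shows "idx w i \<le> co n (W w x) i" "co n (W w x) i \<le> idx w i + 1"
proof -
  have "lin w x \<in> square" using assms lin_sym square_symmetries_square by blast
  then have "-1 \<le> lin w x $ i" "lin w x $ i \<le> 1" by (auto simp: mem_square)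
  then show "idx w i \<le> co n (W w x) i" "co n (W w x) i \<le> idx w i + 1"
    using assms by (auto simp: co_W)
qed

lemma floor_co_open:
  assumes "w \<in> T n" "x \<in> open_square"
  shows "idx w i < co n (W w x) i" "co n (W w x) i < idx w i + 1"
proof -
  have "lin w x \<in> open_square" using assms lin_sym square_symmetries_open_square by blast
  then have "-1 < lin w x $ i" "lin w x $ i < 1" by (auto simp: open_square_def)
  then show "idx w i < co n (W w x) i" "co n (W w x) i < idx w i + 1"
    using assms by (auto simp: co_W)
qed

lemma W_square_eq:
  assumes "w \<in> T n"
  shows "W w ` square = {y. \<forall>i. idx w i \<le> co n y i \<and> co n y i \<le> idx w i + 1}"
proof (intro equalityI subsetI)
  fix y assume "y \<in> W w ` square"
  then show "y \<in> {y. \<forall>i. idx w i \<le> co n y i \<and> co n y i \<le> idx w i + 1}"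
    using co_square_bounds[OF assms] by auto
next
  fix y assume y: "y \<in> {y. \<forall>i. idx w i \<le> co n y i \<and> co n y i \<le> idx w i + 1}"
  define x' :: "real^2" where "x' = (\<chi> i. 2 * (co n y i - idx w i) - 1)"
  have "-1 \<le> x' $ i \<and> x' $ i \<le> 1" for i
    using y[unfolded mem_Collect_eq, rule_format, of i] by (auto simp: x'_def)
  then have "x' \<in> square" by (simp add: mem_square)
  moreover have "lin w ` square = square" using lin_sym[OF assms] by (simp add: square_symmetries_def)
  ultimately obtain x where x: "x \<in> square" "x' = lin w x" by blast
  have "co n (W w x) i = co n y i" for i
    by (simp add: co_W[OF assms] x(2)[symmetric] x'_def field_simps)
  then have "y = W w x" using co_eq_iff by metis
  then show "y \<in> W w ` square" using x by blast
qed

lemma W_inj: "w \<in> T n \<Longrightarrow> W w x = W w y \<Longrightarrow> x = y"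
proof -
  assume w: "w \<in> T n" and e: "W w x = W w y"
  have "lin w x $ i = lin w y $ i" for i
    using co_W[OF w, of x i] co_W[OF w, of y i] e by simp
  then have "lin w x = lin w y" by (simp add: vec_eq_iff)
  then show "x = y" using square_symmetries_bij[OF lin_sym[OF w]] by (metis bij_pointE)
qed

lemma W_continuous: "w \<in> T n \<Longrightarrow> continuous_on A (W w)"
proof -
  assume w: "w \<in> T n"
  have "W w = (\<lambda>x. \<chi> i. (lin w x $ i + 2 * idx w i + 1) / real N ^ n - 1)"
    by (auto simp: vec_eq_iff W_nth[OF w])
  moreover have "continuous_on A \<dots>"
    by (intro continuous_intros square_symmetries_continuous lin_sym[OF w]) (use Npow_pos[of n] in auto)
  ultimately show ?thesis by simp
qed

lemma W_open_square: "w \<in> T n \<Longrightarrow> x \<in> open_square \<Longrightarrow> W w x \<in> open_square"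
proof -
  assume w: "w \<in> T n" and x: "x \<in> open_square"
  have "-1 < W w x $ i \<and> W w x $ i < 1" for i
  proof -
    have "0 < co n (W w x) i" "co n (W w x) i < real_of_int (int N ^ n)"
      using floor_co_open[OF w x, of i] idx_range[OF w, of i] by linarith+
    then show ?thesis by (simp add: co_bounds_iff)
  qed
  then show ?thesis by (simp add: open_square_def)
qed

lemma W_square: "w \<in> T n \<Longrightarrow> x \<in> square \<Longrightarrow> W w x \<in> square"
proof -
  assume w: "w \<in> T n" and x: "x \<in> square"
  have "-1 \<le> W w x $ i \<and> W w x $ i \<le> 1" for i
  proof -
    have "0 \<le> co n (W w x) i" "co n (W w x) i \<le> real_of_int (int N ^ n)"
      using co_square_bounds[OF w x, of i] idx_range[OF w, of i] by linarith+
    then show ?thesis by (simp add: co_bounds_iff)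
  qed
  then show ?thesis by (simp add: mem_square)
qed

lemma word_singleton: "s \<in> S \<Longrightarrow> [s] \<in> T 1" by (simp add: words_def)

lemma idx_singleton: "s \<in> S \<Longrightarrow> idx [s] i = int (if i = 1 then fst s else snd s) - 1"
proof -
  assume s: "s \<in> S"
  obtain \<Phi> where \<Phi>: "\<Phi> \<in> square_symmetries" and fs: "\<And>x. f s x = (1 / real N) *\<^sub>R \<Phi> x + centre N s"
    using f_form[OF s] by metis
  have "\<Phi> 0 = 0" using square_symmetries_linear[OF \<Phi>] linear_0 by blast
  then have "co 1 (W [s] 0) i = real_of_int (int (if i = 1 then fst s else snd s) - 1) + 1/2"
    using N_pos by (simp add: grid_coord_def fs centre_nth field_simps)
  then show ?thesis by (simp add: idx_def floor_eq_iff)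
qed

text \<open>Interior points avoid the grid lines, so the generation-one index reveals the first
  letter; injectivity of its map passes the equation on to the tails.\<close>

lemma open_squares_disjoint:
  assumes "w \<in> T n" "v \<in> T n" "x \<in> open_square" "y \<in> open_square" "W w x = W v y"
  shows "w = v"
  using assms
proof (induction n arbitrary: w v)
  case 0
  then show ?case by simp
next
  case (Suc n)
  obtain s u where w: "w = s # u" "s \<in> S" "u \<in> T n" using Suc.prems(1) by (rule words_SucE)
  obtain s' u' where v: "v = s' # u'" "s' \<in> S" "u' \<in> T n" using Suc.prems(2) by (rule words_SucE)
  have o: "W u x \<in> open_square" "W u' y \<in> open_square" using w v Suc.prems W_open_square by auto
  have e: "W [s] (W u x) = W [s'] (W u' y)" using Suc.prems(5) by (simp add: w v)
  have "idx [s] i = idx [s'] i" for i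
    using floor_co_open[OF word_singleton[OF w(2)] o(1), of i]
      floor_co_open[OF word_singleton[OF v(2)] o(2), of i] unfolding e by linarith
  from this[of 1] this[of 2] have "s = s'" using w v by (simp add: idx_singleton prod_eq_iff)
  then have "W u x = W u' y" using W_inj[OF word_singleton[OF w(2)]] e by blast
  then show ?case using Suc.IH[OF w(3) v(3)] Suc.prems \<open>s = s'\<close> w v by simp
qed

lemma idx_inj: "w \<in> T n \<Longrightarrow> v \<in> T n \<Longrightarrow> (\<And>i. idx w i = idx v i) \<Longrightarrow> w = v"
proof -
  assume w: "w \<in> T n" and v: "v \<in> T n" and e: "\<And>i. idx w i = idx v i"
  have "lin w 0 = 0" "lin v 0 = 0" using w v lin_sym square_symmetries_linear linear_0 by blast+
  then have "co n (W w 0) i = co n (W v 0) i" for i using co_W[OF w] co_W[OF v] e by simp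
  then have "W w 0 = W v 0" using co_eq_iff by metis
  then show ?thesis using open_squares_disjoint[OF w v zero_in_open_square zero_in_open_square] by blast
qed

text \<open>Images of interior points lie on no grid line, so a single square of generation
  \<open>n\<close> contains them. Equalities of cells are tested at such points below.\<close>

lemma open_point_word:
  assumes "w \<in> T n" "x \<in> open_square" "v \<in> T n" "W w x \<in> W v ` square"
  shows "v = w"
proof (rule idx_inj[OF assms(3,1)])
  fix i
  obtain y where y: "y \<in> square" "W w x = W v y" using assms by blast
  show "idx v i = idx w i"
    using floor_co_open[OF assms(1,2), of i] co_square_bounds[OF assms(3) y(1), of i] unfolding y(2) by linarith
qed

lemma cell_square: "w \<in> T n \<Longrightarrow> Kc w \<subseteq> W w ` square"
  using K_square by (auto simp: cell_def)

lemma cell_compact: "w \<in> T n \<Longrightarrow> compact (Kc w)"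
  by (simp add: cell_def compact_continuous_image K_compact W_continuous)

lemma cell_nonempty: "Kc w \<noteq> {}" by (simp add: cell_def K_nonempty)

lemma K_eq_cells: "K = (\<Union>w\<in>T n. Kc w)"
proof (induction n)
  case 0
  then show ?case by (simp add: cell_def)
next
  case (Suc n)
  have "(\<Union>w\<in>T (Suc n). Kc w) = (\<Union>s\<in>S. f s ` (\<Union>u\<in>T n. Kc u))"
  proof (intro equalityI subsetI)
    fix x assume "x \<in> (\<Union>w\<in>T (Suc n). Kc w)"
    then obtain w where "w \<in> T (Suc n)" "x \<in> Kc w" by blast
    then show "x \<in> (\<Union>s\<in>S. f s ` (\<Union>u\<in>T n. Kc u))"
      by (elim words_SucE) (auto simp: cell_def)
  next
    fix x assume "x \<in> (\<Union>s\<in>S. f s ` (\<Union>u\<in>T n. Kc u))"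
    then obtain s u where "s \<in> S" "u \<in> T n" "x \<in> f s ` Kc u" by blast
    then show "x \<in> (\<Union>w\<in>T (Suc n). Kc w)"
      by (intro UN_I[of "s # u"]) (auto simp: words_Cons_iff cell_def)
  qed
  then show ?case using Suc K_eq by metis
qed

lemma cell_children: "Kc w = (\<Union>u\<in>T m. Kc (w @ u))"
proof -
  have "Kc w = W w ` (\<Union>u\<in>T m. Kc u)" using K_eq_cells[of m] by (simp add: cell_def)
  then show ?thesis by (simp add: cell_append image_UN)
qed

lemma cell_sub_take: "a \<in> T (n + m) \<Longrightarrow> Kc a \<subseteq> Kc (take n a)"
proof -
  assume a: "a \<in> T (n + m)"
  have "Kc (take n a @ drop n a) \<subseteq> Kc (take n a)"
    using cell_children[of "take n a" m] words_drop[OF a] by blast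
  then show ?thesis by simp
qed

lemma T_nonempty: "T n \<noteq> {}" using K_eq_cells[of n] K_nonempty by auto

lemma cell_K: "w \<in> T n \<Longrightarrow> Kc w \<subseteq> K" using K_eq_cells by blast

lemma dist_W:
  assumes "w \<in> T n" shows "dist (W w x) (W w y) = dist x y / real N ^ n"
proof -
  have orth: "orthogonal_transformation (lin w)" using lin_sym[OF assms] by (simp add: square_symmetries_def)
  have "W w x - W w y = (1 / real N ^ n) *\<^sub>R (lin w x - lin w y)"
    unfolding vec_eq_iff by (simp add: W_nth[OF assms] diff_divide_distrib[symmetric])
  also have "lin w x - lin w y = lin w (x - y)"
    using orth by (simp add: linear_diff orthogonal_transformation_linear)
  finally show ?thesis using orth Npow_pos[of n]
    by (simp add: dist_norm orthogonal_transformation_norm)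
qed

lemma dist_square_le:
  assumes "x \<in> square" "y \<in> square" shows "dist x y \<le> 4"
proof -
  have "norm (x - y) \<le> \<bar>(x - y) $ 1\<bar> + \<bar>(x - y) $ 2\<bar>"
    using norm_le_l1_cart[of "x - y"] by (simp add: sum_2)
  also have "\<dots> \<le> 4" using assms by (auto simp: mem_square forall_2 abs_le_iff intro!: add_mono[of _ 2 _ 2, simplified])
  finally show ?thesis by (simp add: dist_norm)
qed

end

section \<open>Folding\<close>

lemma affine_hull_line:
  fixes A :: "(real^2) set"
  assumes "A \<subseteq> {y. y $ j = c}" "a \<in> A" "b \<in> A" "a $ other j \<noteq> b $ other j"
  shows "affine hull A = {y. y $ j = c}"
proof
  have "affine {y :: real^2. y $ j = c}"
    by (auto simp: affine_def distrib_right[symmetric])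
  then show "affine hull A \<subseteq> {y. y $ j = c}" using assms(1) by (rule hull_minimal[rotated])
next
  show "{y. y $ j = c} \<subseteq> affine hull A"
  proof
    fix y assume y: "y \<in> {y. y $ j = c}"
    define u where "u = (y $ other j - a $ other j) / (b $ other j - a $ other j)"
    have "(1 - u) *\<^sub>R a + u *\<^sub>R b \<in> affine hull A"
      using mem_affine[OF affine_affine_hull, of a A b "1 - u" u] assms(2,3) by (simp add: hull_inc)
    moreover have "y = (1 - u) *\<^sub>R a + u *\<^sub>R b"
    proof -
      have "u * (b $ other j - a $ other j) = y $ other j - a $ other j"
        using assms(4) by (simp add: u_def)
      moreover have "a $ j = c" "b $ j = c" "y $ j = c" using assms y by auto
      ultimately show ?thesis unfolding vec_eq_iff all2_other[of _ j]
        by (simp add: algebra_simps)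
    qed
    ultimately show "y \<in> affine hull A" by simp
  qed
qed

lemma reflection_in_line:
  "reflection_in {y :: real^2. y $ j = c} x = (\<chi> i. if i = j then 2 * c - x $ j else x $ i)"
proof -
  define p :: "real^2" where "p = (\<chi> i. if i = j then c else x $ i)"
  have eq: "{y :: real^2. y $ j = c} = {y. axis j 1 \<bullet> y = c}"
    by (simp add: inner_axis' )
  have "p = closest_point {y. y $ j = c} x"
  proof (rule closest_point_unique)
    show "convex {y :: real^2. y $ j = c}" "closed {y :: real^2. y $ j = c}"
      unfolding eq by (rule convex_hyperplane, rule closed_hyperplane)
    show "p \<in> {y. y $ j = c}" by (simp add: p_def)
    have "x - p = axis j (x $ j - c)" by (simp add: p_def vec_eq_iff axis_def)
    then have "dist x p = \<bar>x $ j - c\<bar>" by (simp add: dist_norm norm_eq_sqrt_inner inner_axis_axis)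
    moreover have "\<bar>x $ j - c\<bar> \<le> dist x z" if "z $ j = c" for z
      using component_le_norm_cart[of "x - z" j] that by (simp add: dist_norm)
    ultimately show "\<forall>z\<in>{y. y $ j = c}. dist x p \<le> dist x z" by auto
  qed
  then have "closest_point {y. y $ j = c} x = p" by simp
  then show ?thesis by (auto simp: reflection_in_def p_def vec_eq_iff)
qed

text \<open>The triangle wave folds the line onto \<open>[-1, 1]\<close>; its creases are the integers.\<close>

definition triangle_wave :: "real \<Rightarrow> real" where
  "triangle_wave s = - (2 / pi) * arcsin (cos (pi * s))"

lemma triangle_wave_reflect: "triangle_wave (2 * of_int t - s) = triangle_wave s"
proof -
  have "cos (pi * (2 * of_int t - s)) = cos (pi * s - 2 * pi * of_int t)"
    by (subst cos_minus[symmetric]) (simp add: algebra_simps)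
  also have "\<dots> = cos (pi * s)"
    by (simp add: cos_diff)
  finally show ?thesis by (simp add: triangle_wave_def)
qed

lemma triangle_wave_unit: "0 \<le> r \<Longrightarrow> r \<le> 1 \<Longrightarrow> triangle_wave r = 2 * r - 1"
proof -
  assume r: "0 \<le> r" "r \<le> 1"
  have "cos (pi * r) = sin (pi / 2 - pi * r)" by (simp add: cos_sin_eq)
  moreover have "arcsin (sin (pi / 2 - pi * r)) = pi / 2 - pi * r"
    using r by (intro arcsin_sin) (auto simp: mult_left_le)
  ultimately show ?thesis by (simp add: triangle_wave_def field_simps)
qed

lemma triangle_wave_shift:
  assumes "0 \<le> r" "r \<le> 1"
  shows "triangle_wave (of_int k + r) = (if even k then 1 else -1) * (2 * r - 1)"
proof (cases "even k")
  case True
  then obtain m where "k = 2 * m" by blast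
  then have "triangle_wave (of_int k + r) = triangle_wave (2 * of_int 0 - (of_int k + r - 2 * of_int m))"
    using triangle_wave_reflect[of m "- r"] triangle_wave_reflect[of 0 r] by simp
  also have "\<dots> = triangle_wave r" using triangle_wave_reflect[of 0 r] \<open>k = 2 * m\<close> by simp
  finally show ?thesis using True triangle_wave_unit[OF assms] by simp
next
  case False
  then obtain m where k: "k = 2 * m + 1" by (elim oddE)
  then have "triangle_wave (of_int k + r) = triangle_wave (2 * of_int (m + 1) - (1 - r))"
    by (simp add: algebra_simps)
  also have "\<dots> = triangle_wave (1 - r)" by (rule triangle_wave_reflect)
  finally show ?thesis using False triangle_wave_unit[of "1 - r"] assms by simp
qed

context tiling
begin

section \<open>Sides of squares and interior points of the attractor\<close>

definition coord_point :: "nat \<Rightarrow> (2 \<Rightarrow> real) \<Rightarrow> real^2" where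
  "coord_point n c = (\<chi> i. 2 * c i / real N ^ n - 1)"

lemma co_coord_point [simp]: "co n (coord_point n c) i = c i"
  using Npow_pos[of n] by (simp add: grid_coord_def coord_point_def)

lemma W_side:
  fixes \<delta> :: real
  assumes w: "w \<in> T n"
    and \<pi>: "\<And>i. e i \<in> {1, -1::real}" "\<And>x i. lin w x $ i = e i * x $ \<pi> i"
  shows "W w ` square_side (\<pi> k) (e k * (2 * \<delta> - 1)) = {y \<in> W w ` square. co n y k = idx w k + \<delta>}"
proof -
  have "x $ \<pi> k = e k * (2 * \<delta> - 1) \<longleftrightarrow> co n (W w x) k = idx w k + \<delta>" for x
    using \<pi>(1)[of k] by (auto simp: co_W[OF w] \<pi>(2) field_simps)
  then show ?thesis by (auto simp: square_side_def)
qed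

lemma cell_meets_side:
  fixes \<delta> :: real
  assumes w: "w \<in> T n" and \<delta>: "\<delta> \<in> {0, 1}"
  shows "\<exists>y\<in>Kc w. co n y k = idx w k + \<delta>"
proof -
  obtain \<pi> :: "2 \<Rightarrow> 2" and e :: "2 \<Rightarrow> real" where "bij \<pi>" and e: "\<And>i. e i \<in> {1, -1}"
    and g: "\<And>x i. lin w x $ i = e i * x $ \<pi> i"
    using square_symmetry_signed_permutation[OF lin_sym[OF w]] by metis
  have "e k * (2 * \<delta> - 1) \<in> {1, -1}" using e[of k] \<delta> by auto
  then obtain x where "x \<in> K" "x \<in> square_side (\<pi> k) (e k * (2 * \<delta> - 1))"
    using nondeg unfolding non_degenerate_def by blast
  then have "W w x \<in> Kc w" "co n (W w x) k = idx w k + \<delta>"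
    using W_side[OF w e g, of k \<delta>] by (auto simp: cell_def)
  then show ?thesis by blast
qed

text \<open>The intersection contains both end points of the common side; testing these two vertices
  against the bounds of the square of \<open>v\<close> pins its indices down.\<close>

lemma side_edge_idx:
  assumes "(w, v) \<in> side_edges S f n"
  obtains j d where "d \<in> {1, -1}" "idx v j = idx w j + d" "idx v (other j) = idx w (other j)"
proof -
  from assms obtain j0 i0 where w: "w \<in> T n" and v: "v \<in> T n" and "w \<noteq> v" and i0: "i0 \<in> {1, -1::real}"
    and eq: "W w ` square \<inter> W v ` square = W w ` square_side j0 i0"
    unfolding side_edges_def by blast
  obtain \<pi> :: "2 \<Rightarrow> 2" and e :: "2 \<Rightarrow> real" where bij: "bij \<pi>" and e: "\<And>i. e i \<in> {1, -1}"
    and g: "\<And>x i. lin w x $ i = e i * x $ \<pi> i"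
    using square_symmetry_signed_permutation[OF lin_sym[OF w]] by metis
  obtain j where j: "\<pi> j = j0" using bij by (metis bij_pointE)
  define \<delta> :: int where "\<delta> = (if e j * i0 = 1 then 1 else 0)"
  have "e j * (2 * \<delta> - 1) = i0" using e[of j] i0 by (auto simp: \<delta>_def)
  then have side: "W w ` square \<inter> W v ` square = {y \<in> W w ` square. co n y j = idx w j + \<delta>}"
    using W_side[OF w e g, of j \<delta>] by (simp add: eq j)
  have dd: "\<delta> = 0 \<or> \<delta> = 1" by (simp add: \<delta>_def)
  have pt: "idx v k \<le> c k \<and> c k \<le> idx v k + 1"
    if "c j = idx w j + \<delta>" "c (other j) \<in> {real_of_int (idx w (other j)), idx w (other j) + 1}" for c :: "2 \<Rightarrow> real" and k
  proof -
    have "coord_point n c \<in> {y \<in> W w ` square. co n y j = idx w j + \<delta>}"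
      using that dd unfolding W_square_eq[OF w] mem_Collect_eq all2_other[of _ j] by auto
    then have "coord_point n c \<in> W v ` square" using side by blast
    then show ?thesis unfolding W_square_eq[OF v] by auto
  qed
  have 1: "idx v (other j) \<le> idx w (other j)"
    using pt[of "\<lambda>k. if k = j then idx w j + \<delta> else idx w (other j)" "other j"] by (simp add: other_neq)
  have 2: "idx w (other j) \<le> idx v (other j)"
    using pt[of "\<lambda>k. if k = j then idx w j + \<delta> else idx w (other j) + 1" "other j"] by (simp add: other_neq)
  have 3: "idx v j \<le> idx w j + \<delta>" "idx w j + \<delta> \<le> idx v j + 1"
    using pt[of "\<lambda>k. if k = j then idx w j + \<delta> else idx w (other j)" j] by (auto simp: other_neq)
  have "idx v j \<noteq> idx w j"
  proof
    assume "idx v j = idx w j"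
    then have "\<forall>k. idx w k = idx v k" using 1 2 all2_other[of "\<lambda>k. idx w k = idx v k" j] by auto
    then show False using idx_inj[OF w v] \<open>w \<noteq> v\<close> by blast
  qed
  then have "idx v j - idx w j \<in> {1, -1}" using 3 dd by auto
  then show thesis using that[of "idx v j - idx w j" j] 1 2 by auto
qed

text \<open>A cell meets all four sides of its square. If \<open>K\<close> lay on the boundary, a
  square of generation two with a non-extreme index would have a side running through the interior,
  a contradiction; so all indices are extreme. Extreme indices differ by at least three, hence no
  two squares are adjacent and connectivity leaves a single word, whose square is too small to reach
  both sides. Generation two is used because for \<open>N = 2\<close> the extreme indices of
  generation one are adjacent.\<close>

lemma K_meets_open_square: "K \<inter> open_square \<noteq> {}"
proof
  assume E: "K \<inter> open_square = {}"
  have M4: "int N ^ 2 \<ge> 4" using N2 power_mono[of 2 "int N" 2] by simp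
  have corner: "idx w k \<in> {0, int N ^ 2 - 1}" if w: "w \<in> T 2" for w k
  proof (rule ccontr)
    assume "idx w k \<notin> {0, int N ^ 2 - 1}"
    then have k: "0 < idx w k" "idx w k < int N ^ 2 - 1" using idx_range[OF w, of k] by auto
    have o: "0 \<le> idx w (other k)" "idx w (other k) < int N ^ 2" using idx_range[OF w, of "other k"] by auto
    define \<delta> :: int where "\<delta> = (if 0 < idx w (other k) then 0 else 1)"
    have od: "0 < idx w (other k) + \<delta>" "idx w (other k) + \<delta> < int N ^ 2" using o M4 by (auto simp: \<delta>_def)
    have "real_of_int \<delta> \<in> {0, 1}" by (simp add: \<delta>_def)
    from cell_meets_side[OF w this, of "other k"]
    obtain y where y: "y \<in> Kc w" "co 2 y (other k) = idx w (other k) + \<delta>" by auto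
    have "idx w k \<le> co 2 y k" "co 2 y k \<le> idx w k + 1"
      using y(1) cell_square[OF w] W_square_eq[OF w] by auto
    then have "0 < co 2 y k" "co 2 y k < real_of_int (int N ^ 2)" using k by linarith+
    moreover have "0 < co 2 y (other k)" "co 2 y (other k) < real_of_int (int N ^ 2)" using y(2) od by linarith+
    ultimately have "y \<in> open_square"
      unfolding open_square_def mem_Collect_eq all2_other[of _ k]
      using co_bounds_iff(1,2)[of 2 y k] co_bounds_iff(1,2)[of 2 y "other k"] by simp
    then show False using y(1) cell_K[OF w] E by blast
  qed
  have "side_edges S f 2 = {}"
  proof (rule ccontr)
    assume "side_edges S f 2 \<noteq> {}"
    then obtain w v where wv: "(w, v) \<in> side_edges S f 2" by auto
    then obtain j d where d: "d \<in> {1, -1}" "idx v j = idx w j + d" by (rule side_edge_idx)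
    have "w \<in> T 2" "v \<in> T 2" using wv by (auto simp: side_edges_def)
    then show False using d corner[of w j] corner[of v j] M4 by auto
  qed
  then have "\<forall>u\<in>T 2. \<forall>v\<in>T 2. u = v"
    using strong_conn unfolding strongly_connected_def graph_connected_def by (metis Un_empty converse_empty
        one_le_numeral rtrancl_empty pair_in_Id_conv)
  then obtain w where w: "T 2 = {w}" using T_nonempty[of 2] by blast
  then have Kw: "K = Kc w" using K_eq_cells[of 2] by simp
  have "w \<in> T 2" using w by simp
  note sq = W_square_eq[OF this] and cs = cell_square[OF this]
  have "[] \<in> T 0" by simp
  obtain y0 y1 where "y0 \<in> K" "co 0 y0 1 = 0" "y1 \<in> K" "co 0 y1 1 = 1"
    using cell_meets_side[of "[]" 0 0 1] cell_meets_side[of "[]" 0 1 1] idx_range[of "[]" 0 1]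
    by (auto simp: cell_def)
  then have "co 2 y0 1 = 0" "co 2 y1 1 = real_of_int (int N ^ 2)" by (auto simp: grid_coord_def)
  moreover have "idx w 1 \<le> co 2 y0 1" "co 2 y1 1 \<le> idx w 1 + 1"
  proof -
    have "y0 \<in> W w ` square" "y1 \<in> W w ` square" using \<open>y0 \<in> K\<close> \<open>y1 \<in> K\<close> cs Kw by blast+
    then show "idx w 1 \<le> co 2 y0 1" "co 2 y1 1 \<le> idx w 1 + 1" unfolding sq by auto
  qed
  ultimately have "int N ^ 2 \<le> 1" by linarith
  then show False using M4 by simp
qed

text \<open>Every small cell contains a copy of one fixed interior point.\<close>

lemma K_dense: "K \<subseteq> closure (K \<inter> open_square)"
proof
  fix x assume x: "x \<in> K"
  obtain k where k: "k \<in> K" "k \<in> open_square" using K_meets_open_square by blast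
  show "x \<in> closure (K \<inter> open_square)" unfolding closure_approachable
  proof (intro allI impI)
    fix \<epsilon> :: real assume "\<epsilon> > 0"
    have "(\<lambda>n. 4 * (1 / real N) ^ n) \<longlonglongrightarrow> 4 * 0"
      using N2 by (intro tendsto_mult tendsto_const LIMSEQ_power_zero) auto
    then have "\<forall>\<^sub>F n in sequentially. 4 * (1 / real N) ^ n < \<epsilon>"
      using \<open>\<epsilon> > 0\<close> order_tendstoD(2) by fastforce
    then obtain n where n: "4 * (1 / real N) ^ n < \<epsilon>" by (metis eventually_sequentially order_refl)
    obtain w where w: "w \<in> T n" "x \<in> Kc w" using x K_eq_cells[of n] by blast
    then obtain z where z: "z \<in> K" "x = W w z" by (auto simp: cell_def)
    have "dist (W w k) x \<le> 4 / real N ^ n"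
    proof -
      have "dist k z \<le> 4" using dist_square_le[of k z] k z K_square by auto
      then show ?thesis unfolding z(2) dist_W[OF w(1)] by (intro divide_right_mono) auto
    qed
    then have "dist (W w k) x < \<epsilon>" using n by (simp add: power_one_over)
    moreover have "W w k \<in> K \<inter> open_square"
      using k W_open_square[OF w(1)] cell_K[OF w(1)] by (auto simp: cell_def)
    ultimately show "\<exists>y\<in>K \<inter> open_square. dist y x < \<epsilon>" by blast
  qed
qed

text \<open>Reduces inclusions between cells to interior points, for which the containing cell can
  be identified by its index.\<close>

lemma image_subset_closed:
  assumes "continuous_on UNIV h" "closed Z" "\<And>k. k \<in> K \<Longrightarrow> k \<in> open_square \<Longrightarrow> h k \<in> Z"
  shows "h ` K \<subseteq> Z"
proof -
  have "h ` closure (K \<inter> open_square) \<subseteq> closure Z"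
    by (rule image_closure_subset) (use assms closure_subset[of Z] in \<open>auto intro: continuous_on_subset\<close>)
  then show ?thesis using K_dense assms(2) by auto
qed

lemma cell_subset_imp_eq:
  assumes "u \<in> T m" "v \<in> T m" "Kc u \<subseteq> Kc v" shows "u = v"
proof -
  obtain k where k: "k \<in> K" "k \<in> open_square" using K_meets_open_square by blast
  then have "W u k \<in> Kc v" using assms(3) by (auto simp: cell_def)
  then show ?thesis using open_point_word[OF assms(1) k(2) assms(2)] cell_square[OF assms(2)] by blast
qed

section \<open>Symmetries of the attractor acting on words\<close>

definition cell_syms :: "(real^2 \<Rightarrow> real^2) set" where
  "cell_syms = {g \<in> square_symmetries. g ` K = K}"

lemma cell_syms_inv: "g \<in> cell_syms \<Longrightarrow> inv g \<in> cell_syms"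
  unfolding cell_syms_def
  by (simp add: square_symmetries_inv)
    (metis bij_is_inj image_inv_f_f square_symmetries_bij)

text \<open>A symmetry of the large square permutes the grid, and \<open>z\<close> is the index of
  the image square. The image of every interior point lies in a cell with this index, hence always
  in the same cell.\<close>

lemma sym_cell_subset:
  assumes g: "g \<in> cell_syms" and u: "u \<in> T m"
  shows "\<exists>u'\<in>T m. g ` Kc u \<subseteq> Kc u'"
proof -
  have gs: "g \<in> square_symmetries" and gK: "g ` K = K" using g by (auto simp: cell_syms_def)
  obtain \<pi> :: "2 \<Rightarrow> 2" and e :: "2 \<Rightarrow> real" where bij: "bij \<pi>" and e: "\<And>i. e i \<in> {1, -1}"
    and p: "\<And>x i. g x $ i = e i * x $ \<pi> i"
    using square_symmetry_signed_permutation[OF gs] by metis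
  define z where "z = (\<lambda>i. if e i = 1 then idx u (\<pi> i) else int N ^ m - 1 - idx u (\<pi> i))"
  have pos: "z i < co m (g (W u k)) i" "co m (g (W u k)) i < z i + 1" if "k \<in> open_square" for k i
  proof -
    have b: "idx u (\<pi> i) < co m (W u k) (\<pi> i)" "co m (W u k) (\<pi> i) < idx u (\<pi> i) + 1"
      using floor_co_open[OF u that] by auto
    consider "e i = 1" | "e i = -1" using e[of i] by auto
    then have "z i < co m (g (W u k)) i \<and> co m (g (W u k)) i < z i + 1"
    proof cases
      case 1
      then have "co m (g (W u k)) i = co m (W u k) (\<pi> i)" by (simp add: grid_coord_def p)
      then show ?thesis using b 1 by (simp add: z_def)
    next
      case 2
      then have "co m (g (W u k)) i = real N ^ m - co m (W u k) (\<pi> i)"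
        by (simp add: grid_coord_def p field_simps)
      then show ?thesis using b 2 by (simp add: z_def)
    qed
    then show "z i < co m (g (W u k)) i" "co m (g (W u k)) i < z i + 1" by auto
  qed
  have ex: "\<exists>u'\<in>T m. g (W u k) \<in> Kc u' \<and> (\<forall>i. idx u' i = z i)" if k: "k \<in> K" "k \<in> open_square" for k
  proof -
    have "g (W u k) \<in> K" using k(1) cell_K[OF u] gK by (auto simp: cell_def)
    then obtain u' where u': "u' \<in> T m" "g (W u k) \<in> Kc u'" using K_eq_cells[of m] by blast
    have "idx u' i = z i" for i
    proof -
      have "idx u' i \<le> co m (g (W u k)) i" "co m (g (W u k)) i \<le> idx u' i + 1"
        using u' cell_square W_square_eq by auto
      then show ?thesis using pos[OF k(2), of i] by linarith
    qed
    then show ?thesis using u' by blast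
  qed
  obtain k where k: "k \<in> K" "k \<in> open_square" using K_meets_open_square by blast
  from ex[OF this] obtain u' where u': "u' \<in> T m" "\<And>i. idx u' i = z i" by blast
  have "(g \<circ> W u) ` K \<subseteq> Kc u'"
  proof (rule image_subset_closed)
    show "continuous_on UNIV (g \<circ> W u)"
      using W_continuous[OF u] square_symmetries_continuous[OF gs] by (rule continuous_on_compose)
    show "closed (Kc u')" using cell_compact[OF u'(1)] compact_imp_closed by blast
    show "(g \<circ> W u) k \<in> Kc u'" if k: "k \<in> K" "k \<in> open_square" for k
    proof -
      from ex[OF k] obtain u'' where u'': "u'' \<in> T m" "g (W u k) \<in> Kc u''" "\<And>i. idx u'' i = z i" by blast
      then have "u'' = u'" using idx_inj u' by metis
      then show ?thesis using u'' by simp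
    qed
  qed
  then show ?thesis using u'(1) by (auto simp: cell_def)
qed

text \<open>The inverse symmetry sends the receiving cell into a cell again. As no cell lies
  properly inside another of its generation, the round trip is the identity and the inclusion is an
  equality.\<close>

lemma sym_cell:
  assumes g: "g \<in> cell_syms" and u: "u \<in> T m"
  shows "\<exists>u'\<in>T m. Kc u' = g ` Kc u"
proof -
  from sym_cell_subset[OF assms] obtain u' where u': "u' \<in> T m" "g ` Kc u \<subseteq> Kc u'" by blast
  from sym_cell_subset[OF cell_syms_inv[OF g] u'(1)] obtain u'' where
    u'': "u'' \<in> T m" "inv g ` Kc u' \<subseteq> Kc u''" by blast
  have bij: "bij g" using g square_symmetries_bij by (auto simp: cell_syms_def)
  have "inv g ` (g ` Kc u) = Kc u" using bij by (simp add: bij_is_inj image_inv_f_f)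
  then have "Kc u \<subseteq> Kc u''" using u'(2) u''(2) by blast
  then have "u'' = u" using cell_subset_imp_eq u u''(1) by blast
  then have "g ` (inv g ` Kc u') \<subseteq> g ` Kc u" using u''(2) by blast
  moreover have "g ` (inv g ` Kc u') = Kc u'" using bij by (simp add: bij_is_surj image_f_inv_f)
  ultimately show ?thesis using u' by blast
qed

text \<open>The choice is unique because distinct words of one length have distinct cells, by
  \<open>cell_subset_imp_eq\<close>.\<close>

definition sym_word :: "(real^2 \<Rightarrow> real^2) \<Rightarrow> (nat \<times> nat) list \<Rightarrow> (nat \<times> nat) list" where
  "sym_word g u = (SOME u'. u' \<in> T (length u) \<and> Kc u' = g ` Kc u)"

lemma
  assumes g: "g \<in> cell_syms" and u: "u \<in> T m"
  shows sym_word_T: "sym_word g u \<in> T m" and cell_sym_word: "Kc (sym_word g u) = g ` Kc u"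
proof -
  have "length u = m" using u by (simp add: words_def)
  then have "\<exists>u'. u' \<in> T (length u) \<and> Kc u' = g ` Kc u" using sym_cell[OF assms] by auto
  from someI_ex[OF this] show "sym_word g u \<in> T m" "Kc (sym_word g u) = g ` Kc u"
    using \<open>length u = m\<close> by (auto simp: sym_word_def)
qed

lemma sym_word_inj:
  assumes g: "g \<in> cell_syms" shows "inj_on (sym_word g) (T m)"
proof (rule inj_onI)
  fix u v assume u: "u \<in> T m" and v: "v \<in> T m" and e: "sym_word g u = sym_word g v"
  have "inj g" using g square_symmetries_bij bij_is_inj by (auto simp: cell_syms_def)
  moreover have "g ` Kc u = g ` Kc v" using e cell_sym_word[OF g u] cell_sym_word[OF g v] by simp
  ultimately have "Kc u = Kc v" by (simp add: inj_image_eq_iff)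
  then show "u = v" using cell_subset_imp_eq[OF u v] by simp
qed

lemma sym_word_bij: "g \<in> cell_syms \<Longrightarrow> bij_betw (sym_word g) (T m) (T m)"
  using sym_word_inj sym_word_T finite_T endo_inj_surj[of "T m" "sym_word g"]
  by (metis bij_betw_def image_subsetI)

section \<open>The fold of the whole square\<close>

definition fold_square :: "nat \<Rightarrow> real^2 \<Rightarrow> real^2" where
  "fold_square n y = (\<chi> i. triangle_wave (co n y i))"

text \<open>The fold as seen from the unit cell of \<open>w\<close>. The triangle wave decreases
  over unit intervals with odd left end, whence the signs.\<close>

definition sig :: "(nat \<times> nat) list \<Rightarrow> real^2 \<Rightarrow> real^2" where
  "sig w x = (\<chi> i. (if even (idx w i) then 1 else -1) * lin w x $ i)"

lemma sig_sym: "w \<in> T n \<Longrightarrow> sig w \<in> square_symmetries"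
proof -
  assume w: "w \<in> T n"
  obtain \<pi> :: "2 \<Rightarrow> 2" and e :: "2 \<Rightarrow> real" where bij: "bij \<pi>" and e: "\<And>i. e i \<in> {1, -1}"
    and g: "\<And>x i. lin w x $ i = e i * x $ \<pi> i"
    using square_symmetry_signed_permutation[OF lin_sym[OF w]] by metis
  show ?thesis
  proof (rule signed_permutation_square_symmetry[OF bij])
    show "(if even (idx w i) then 1 else -1) * e i \<in> {1, -1}" for i using e[of i] by auto
    show "sig w x $ i = (if even (idx w i) then 1 else -1) * e i * x $ \<pi> i" for x i
      by (simp add: sig_def g)
  qed
qed

lemma fold_square_W: "w \<in> T n \<Longrightarrow> x \<in> square \<Longrightarrow> fold_square n (W w x) = sig w x"
proof -
  assume w: "w \<in> T n" and x: "x \<in> square"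
  have "lin w x \<in> square" using square_symmetries_square[OF lin_sym[OF w] x] .
  then have b: "-1 \<le> lin w x $ i \<and> lin w x $ i \<le> 1" for i by (auto simp: mem_square)
  have "0 \<le> (lin w x $ i + 1) / 2" "(lin w x $ i + 1) / 2 \<le> 1" for i
    using b[of i] by auto
  with b have "triangle_wave (co n (W w x) i) = sig w x $ i" for i
    unfolding co_W[OF w] by (subst triangle_wave_shift) (auto simp: sig_def field_simps)
  then show ?thesis by (simp add: fold_square_def vec_eq_iff)
qed

lemma fold_square_cell: "w \<in> T n \<Longrightarrow> fold_square n ` Kc w = sig w ` K"
  using fold_square_W K_square by (force simp: cell_def image_image intro!: image_cong)

text \<open>The reflection in the common line exchanges the two open squares, so an interior point
  of one cell has its mirror image in the other cell; by density the two cells are mirror images.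
  The fold is invariant under reflections in grid lines and therefore sends both to the same
  set.\<close>

lemma side_edge_sig:
  assumes n: "n \<ge> 1" and wv: "(w, v) \<in> side_edges S f n"
  shows "sig w ` K = sig v ` K"
proof -
  have w: "w \<in> T n" and v: "v \<in> T n" using wv by (auto simp: side_edges_def)
  obtain j d where d: "d \<in> {1, -1}" "idx v j = idx w j + d" and o: "idx v (other j) = idx w (other j)"
    using wv by (rule side_edge_idx)
  define t where "t = max (idx w j) (idx v j)"
  define c where "c = 2 * t / real N ^ n - 1"
  have line: "y $ j = c \<longleftrightarrow> co n y j = t" for y :: "real^2"
    using Npow_pos[of n] by (auto simp: c_def grid_coord_def field_simps)
  have Q: "W w ` square \<inter> W v ` square = {y. co n y j = t \<and> idx w (other j) \<le> co n y (other j) \<and> co n y (other j) \<le> idx w (other j) + 1}"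
    unfolding W_square_eq[OF w] W_square_eq[OF v] all2_other[of _ j] t_def using d o by auto
  define a where "a = coord_point n (\<lambda>k. if k = j then t else idx w (other j))"
  define b where "b = coord_point n (\<lambda>k. if k = j then t else idx w (other j) + 1)"
  have aff: "affine hull (W w ` square \<inter> W v ` square) = {y. y $ j = c}"
  proof (rule affine_hull_line)
    show "W w ` square \<inter> W v ` square \<subseteq> {y. y $ j = c}" using line Q by auto
    show "a \<in> W w ` square \<inter> W v ` square" "b \<in> W w ` square \<inter> W v ` square"
      unfolding Q by (auto simp: a_def b_def other_neq)
    have "co n a (other j) \<noteq> co n b (other j)" by (simp add: a_def b_def other_neq)
    then show "a $ other j \<noteq> b $ other j" by (auto simp: grid_coord_def)
  qed
  define R where "R = reflection_in {y :: real^2. y $ j = c}"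
  have R: "R x = (\<chi> i. if i = j then 2 * c - x $ j else x $ i)" for x
    by (simp add: R_def reflection_in_line)
  have inv: "R ` (Kc w \<union> Kc v) = Kc w \<union> Kc v"
    using loc_sym n wv unfolding locally_symmetric_def R_def aff[symmetric] by blast
  have coR: "co n (R x) j = 2 * t - co n x j" "co n (R x) (other j) = co n x (other j)" for x
    using Npow_pos[of n] by (auto simp: grid_coord_def R c_def other_neq field_simps)
  have RR: "R (R x) = x" for x by (simp add: R vec_eq_iff)
  have Rcont: "continuous_on UNIV R"
  proof -
    have "continuous_on UNIV (\<lambda>x :: real^2. if i = j then 2 * c - x $ j else x $ i)" for i
      by (cases "i = j") (auto intro!: continuous_intros)
    then show ?thesis unfolding R by (rule continuous_on_vec_lambda)
  qed
  have sub: "R ` Kc u \<subseteq> Kc u'"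
    if u: "u \<in> T n" and u': "u' \<in> T n" and un: "R ` (Kc u \<union> Kc u') = Kc u \<union> Kc u'"
      and i: "2 * t - idx u j - 1 = idx u' j" "idx u j \<noteq> idx u' j" for u u'
  proof -
    have "(R \<circ> W u) ` K \<subseteq> Kc u'"
    proof (rule image_subset_closed)
      show "continuous_on UNIV (R \<circ> W u)"
        using W_continuous[OF u] Rcont by (intro continuous_on_compose) (auto intro: continuous_on_subset)
      show "closed (Kc u')" using cell_compact[OF u'] compact_imp_closed by blast
      show "(R \<circ> W u) k \<in> Kc u'" if k: "k \<in> K" "k \<in> open_square" for k
      proof -
        have "R (W u k) \<in> Kc u \<union> Kc u'" using k un by (auto simp: cell_def)
        moreover have "R (W u k) \<notin> Kc u"
        proof
          assume "R (W u k) \<in> Kc u"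
          then have "idx u j \<le> co n (R (W u k)) j" "co n (R (W u k)) j \<le> idx u j + 1"
            using cell_square[OF u] W_square_eq[OF u] by auto
          moreover have "idx u j < co n (W u k) j" "co n (W u k) j < idx u j + 1"
            using floor_co_open[OF u k(2)] by auto
          ultimately have "2 * t - idx u j - 1 < idx u j + 1" "idx u j < 2 * t - idx u j"
            unfolding coR by linarith+
          then show False using i by linarith
        qed
        ultimately show ?thesis by simp
      qed
    qed
    then show ?thesis by (simp add: cell_def image_comp)
  qed
  have i: "2 * t - idx w j - 1 = idx v j" "idx w j \<noteq> idx v j"
    "2 * t - idx v j - 1 = idx w j" "idx v j \<noteq> idx w j"
    using d by (auto simp: t_def)
  have "R ` Kc w \<subseteq> Kc v" by (rule sub[OF w v inv i(1,2)])
  moreover have "R ` Kc v \<subseteq> Kc w" by (rule sub[OF v w _ i(3,4)]) (use inv in \<open>simp add: Un_commute\<close>)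
  then have "R ` (R ` Kc v) \<subseteq> R ` Kc w" by blast
  then have "Kc v \<subseteq> R ` Kc w" by (simp add: image_image RR)
  ultimately have "Kc v = R ` Kc w" by blast
  moreover have "fold_square n (R x) = fold_square n x" for x
  proof -
    have "\<forall>i. triangle_wave (co n (R x) i) = triangle_wave (co n x i)"
      unfolding all2_other[of _ j] coR by (simp add: triangle_wave_reflect)
    then show ?thesis by (simp add: fold_square_def vec_eq_iff)
  qed
  ultimately have "fold_square n ` Kc v = fold_square n ` Kc w" by (simp add: image_image)
  then show ?thesis by (simp add: fold_square_cell[OF w] fold_square_cell[OF v])
qed

lemma sig_K_eq:
  assumes w: "w \<in> T n" and v: "v \<in> T n" shows "sig w ` K = sig v ` K"
proof (cases "n = 0")
  case True
  then show ?thesis using assms by simp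
next
  case False
  then have n: "n \<ge> 1" by simp
  have "(w, v) \<in> (side_edges S f n \<union> (side_edges S f n)\<inverse>)\<^sup>*"
    using strong_conn n w v by (auto simp: strongly_connected_def graph_connected_def)
  then show ?thesis
    by induction (use side_edge_sig[OF n] in blast)+
qed

text \<open>The fold of the whole square onto the square of \<open>w\<close>, rescaled to the unit cell.\<close>

definition fold_on :: "(nat \<times> nat) list \<Rightarrow> real^2 \<Rightarrow> real^2" where
  "fold_on w y = inv (sig w) (fold_square (length w) y)"

text \<open>The fold from the square of \<open>v\<close> to that of \<open>w\<close>, with both
  squares read as the unit square. It preserves \<open>K\<close> because all folded copies
  coincide.\<close>

definition rel_sym :: "(nat \<times> nat) list \<Rightarrow> (nat \<times> nat) list \<Rightarrow> real^2 \<Rightarrow> real^2" where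
  "rel_sym w v = inv (sig w) \<circ> sig v"

lemma rel_sym_in: assumes "w \<in> T n" "v \<in> T n" shows "rel_sym w v \<in> cell_syms"
proof -
  have "rel_sym w v ` K = inv (sig w) ` (sig w ` K)"
    using sig_K_eq[OF assms] by (simp add: rel_sym_def image_comp[symmetric] del: comp_apply)
  also have "\<dots> = K" using square_symmetries_bij[OF sig_sym[OF assms(1)]] by (simp add: bij_is_inj image_inv_f_f)
  finally show ?thesis
    using assms by (simp add: cell_syms_def rel_sym_def square_symmetries_comp square_symmetries_inv sig_sym)
qed

lemma fold_on_W:
  assumes "w \<in> T n" "v \<in> T n" "x \<in> square" shows "fold_on w (W v x) = rel_sym w v x"
proof -
  have "length w = n" using assms by (simp add: words_def)
  then show ?thesis using assms by (simp add: fold_on_def rel_sym_def fold_square_W)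
qed

text \<open>The prefix selects the symmetry which the fold applies to the remaining letters; it is
  then dropped, so the result is shorter by \<open>length w\<close> letters.\<close>

definition fold_word :: "(nat \<times> nat) list \<Rightarrow> (nat \<times> nat) list \<Rightarrow> (nat \<times> nat) list" where
  "fold_word w a = sym_word (rel_sym w (take (length w) a)) (drop (length w) a)"

lemma fold_word_append: "w \<in> T n \<Longrightarrow> v \<in> T n \<Longrightarrow> fold_word w (v @ u) = sym_word (rel_sym w v) u"
  by (auto simp: fold_word_def words_def)

lemma fold_word_T: "w \<in> T n \<Longrightarrow> a \<in> T (n + m) \<Longrightarrow> fold_word w a \<in> T m"
  using words_take[of a S n m] words_drop[of a S n m]
  by (auto simp: fold_word_def words_def intro!: sym_word_T[unfolded words_def mem_Collect_eq] rel_sym_in[unfolded words_def mem_Collect_eq])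

lemma cell_fold_word:
  assumes w: "w \<in> T n" and a: "a \<in> T (n + m)" shows "Kc (fold_word w a) = fold_on w ` Kc a"
proof -
  have len: "length w = n" using w by (simp add: words_def)
  note v = words_take[OF a] and u = words_drop[OF a]
  have "fold_on w ` Kc (take n a @ drop n a) = fold_on w ` W (take n a) ` Kc (drop n a)"
    by (simp only: cell_append)
  also have "\<dots> = rel_sym w (take n a) ` Kc (drop n a)"
    using fold_on_W[OF w v] cell_K[OF u] K_square by (auto simp: image_image intro!: image_cong)
  also have "\<dots> = Kc (sym_word (rel_sym w (take n a)) (drop n a))"
    using cell_sym_word[OF rel_sym_in[OF w v] u] by simp
  finally show ?thesis by (simp add: fold_word_def len)
qed

text \<open>Over each square of generation \<open>n\<close> the fold merely permutes the subcells;
  this is why weights pulled back through it have computable mass.\<close>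

lemma fold_word_bij:
  assumes "w \<in> T n" "v \<in> T n" shows "bij_betw (\<lambda>u. fold_word w (v @ u)) (T m) (T m)"
  using sym_word_bij[OF rel_sym_in[OF assms]] by (simp add: fold_word_append[OF assms])

end

section \<open>Connected sets of cells and crossings\<close>

lemma rtrancl_path_abs_diff:
  assumes "rtrancl_path r x ys y" and "\<And>u v. r u v \<Longrightarrow> \<bar>h u - h v\<bar> \<le> \<rho> u" and "0 \<le> \<rho> y"
  shows "\<bar>h x - h y\<bar> \<le> (sum_list (map \<rho> (x # ys)) :: real)"
  using assms
proof induction
  case (step x y ys z)
  have "\<bar>h x - h z\<bar> \<le> \<bar>h x - h y\<bar> + \<bar>h y - h z\<bar>" by simp
  also have "\<dots> \<le> \<rho> x + sum_list (map \<rho> (y # ys))" using step by (intro add_mono) auto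
  finally show ?case by simp
qed auto

lemma card_int_box:
  fixes z :: "2 \<Rightarrow> int"
  assumes "0 \<le> r"
  shows "finite {z'. \<forall>i. \<bar>z' i - z i\<bar> \<le> r}" "card {z'. \<forall>i. \<bar>z' i - z i\<bar> \<le> r} = nat (2 * r + 1) ^ 2"
proof -
  have eq: "{z'. \<forall>i. \<bar>z' i - z i\<bar> \<le> r} = (\<Pi>\<^sub>E i\<in>UNIV. {z i - r..z i + r})"
  proof (intro equalityI subsetI)
    fix x assume "x \<in> {z'. \<forall>i. \<bar>z' i - z i\<bar> \<le> r}"
    then have "\<bar>x i - z i\<bar> \<le> r" for i by blast
    then have "z i - r \<le> x i \<and> x i \<le> z i + r" for i by (smt (verit))
    then show "x \<in> (\<Pi>\<^sub>E i\<in>UNIV. {z i - r..z i + r})" by (simp add: PiE_def Pi_def)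
  next
    fix x assume "x \<in> (\<Pi>\<^sub>E i\<in>UNIV. {z i - r..z i + r})"
    then have "z i - r \<le> x i \<and> x i \<le> z i + r" for i by (simp add: PiE_def Pi_def)
    then have "\<bar>x i - z i\<bar> \<le> r" for i by (smt (verit))
    then show "x \<in> {z'. \<forall>i. \<bar>z' i - z i\<bar> \<le> r}" by blast
  qed
  show "finite {z'. \<forall>i. \<bar>z' i - z i\<bar> \<le> r}" unfolding eq by (intro finite_PiE) auto
  show "card {z'. \<forall>i. \<bar>z' i - z i\<bar> \<le> r} = nat (2 * r + 1) ^ 2"
    unfolding eq by (simp add: card_PiE algebra_simps power2_eq_square)
qed

lemma affine_quotient_diff: "(a + c + d) / r - 1 - ((b + c + d) / r - 1) = (1 / r) *\<^sub>R (a - b :: real)"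
  by (simp add: add_divide_distrib diff_divide_distrib)

context tiling
begin

abbreviation touch :: "(nat \<times> nat) list \<Rightarrow> (nat \<times> nat) list \<Rightarrow> bool" where
  "touch a b \<equiv> Kc a \<inter> Kc b \<noteq> {}"

lemma touch_refl: "touch a a" using cell_nonempty by auto

lemma touch_sym: "touch a b \<Longrightarrow> touch b a" by auto

definition conn :: "(nat \<times> nat) list set \<Rightarrow> bool" where
  "conn A \<longleftrightarrow> (\<forall>a\<in>A. \<forall>b\<in>A. (a, b) \<in> {(u, v). u \<in> A \<and> v \<in> A \<and> touch u v}\<^sup>*)"

lemma conn_induct:
  assumes "conn A" "a \<in> A" "P a" "\<And>u v. u \<in> A \<Longrightarrow> v \<in> A \<Longrightarrow> touch u v \<Longrightarrow> P u \<Longrightarrow> P v" "b \<in> A"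
  shows "P b"
proof -
  have "(a, b) \<in> {(u, v). u \<in> A \<and> v \<in> A \<and> touch u v}\<^sup>*" using assms by (auto simp: conn_def)
  then show ?thesis by induction (use assms in auto)
qed

lemma conn_from:
  assumes "\<And>b. b \<in> A \<Longrightarrow> (a, b) \<in> {(u, v). u \<in> A \<and> v \<in> A \<and> touch u v}\<^sup>*"
  shows "conn A"
proof -
  have "sym {(u, v). u \<in> A \<and> v \<in> A \<and> touch u v}" by (auto simp: sym_def)
  then have "sym ({(u, v). u \<in> A \<and> v \<in> A \<and> touch u v}\<^sup>*)" by (rule sym_rtrancl)
  then show ?thesis unfolding conn_def using assms by (meson rtrancl_trans symD)
qed

lemma conn_singleton: "conn {a}" by (simp add: conn_def)

lemma rtrancl_touch_mono:
  "(a, b) \<in> {(u, v). u \<in> A \<and> v \<in> A \<and> touch u v}\<^sup>* \<Longrightarrow> A \<subseteq> B \<Longrightarrow>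
   (a, b) \<in> {(u, v). u \<in> B \<and> v \<in> B \<and> touch u v}\<^sup>*"
  by (erule rtrancl_mono[THEN subsetD, rotated]) auto

lemma conn_Un:
  assumes "conn A" "conn B" "a \<in> A" "b \<in> B" "touch a b"
  shows "conn (A \<union> B)"
proof (rule conn_from[of _ a])
  let ?R = "{(u, v). u \<in> A \<union> B \<and> v \<in> A \<union> B \<and> touch u v}"
  fix c assume c: "c \<in> A \<union> B"
  have ab: "(a, b) \<in> ?R" using assms by auto
  show "(a, c) \<in> ?R\<^sup>*"
  proof (cases "c \<in> A")
    case True
    then have "(a, c) \<in> {(u, v). u \<in> A \<and> v \<in> A \<and> touch u v}\<^sup>*" using assms by (auto simp: conn_def)
    then show ?thesis by (rule rtrancl_touch_mono) simp
  next
    case False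
    then have "(b, c) \<in> {(u, v). u \<in> B \<and> v \<in> B \<and> touch u v}\<^sup>*" using assms c by (auto simp: conn_def)
    then have "(b, c) \<in> ?R\<^sup>*" by (rule rtrancl_touch_mono) simp
    then show ?thesis using ab by (rule converse_rtrancl_into_rtrancl[rotated])
  qed
qed

lemma conn_insert: "conn A \<Longrightarrow> a \<in> A \<Longrightarrow> touch a b \<Longrightarrow> conn (insert b A)"
  using conn_Un[of A "{b}" a b] conn_singleton by simp

lemma conn_image:
  assumes "conn A" "\<And>a b. a \<in> A \<Longrightarrow> b \<in> A \<Longrightarrow> touch a b \<Longrightarrow> touch (g a) (g b)"
  shows "conn (g ` A)"
proof (cases "A = {}")
  case True
  then show ?thesis by (simp add: conn_def)
next
  case False
  then obtain a where a: "a \<in> A" by blast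
  show ?thesis
  proof (rule conn_from[of _ "g a"])
    fix c assume "c \<in> g ` A"
    then obtain b where b: "b \<in> A" "c = g b" by blast
    have "(g a, g b) \<in> {(u, v). u \<in> g ` A \<and> v \<in> g ` A \<and> touch u v}\<^sup>*"
    proof (rule conn_induct[OF assms(1) a _ _ b(1), of "\<lambda>b. (g a, g b) \<in> {(u, v). u \<in> g ` A \<and> v \<in> g ` A \<and> touch u v}\<^sup>*"])
      fix u v assume "u \<in> A" "v \<in> A" "touch u v" and
        "(g a, g u) \<in> {(u, v). u \<in> g ` A \<and> v \<in> g ` A \<and> touch u v}\<^sup>*"
      moreover from this have "(g u, g v) \<in> {(u, v). u \<in> g ` A \<and> v \<in> g ` A \<and> touch u v}"
        using assms(2) by blast
      ultimately show "(g a, g v) \<in> {(u, v). u \<in> g ` A \<and> v \<in> g ` A \<and> touch u v}\<^sup>*"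
        by (rule_tac rtrancl_into_rtrancl)
    qed auto
    then show "(g a, c) \<in> {(u, v). u \<in> g ` A \<and> v \<in> g ` A \<and> touch u v}\<^sup>*" using b by simp
  qed
qed

lemma conn_path:
  assumes "conn A" "a \<in> A" "b \<in> A"
  obtains xs where "rtrancl_path (\<lambda>u v. u \<in> A \<and> v \<in> A \<and> touch u v) a xs b" "distinct (a # xs)" "set (a # xs) \<subseteq> A"
proof -
  have "(a, b) \<in> {(u, v). u \<in> A \<and> v \<in> A \<and> touch u v}\<^sup>*" using assms by (auto simp: conn_def)
  then have "(\<lambda>u v. u \<in> A \<and> v \<in> A \<and> touch u v)\<^sup>*\<^sup>* a b" by (simp add: rtranclp_rtrancl_eq)
  then obtain ys where "rtrancl_path (\<lambda>u v. u \<in> A \<and> v \<in> A \<and> touch u v) a ys b"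
    by (auto simp: rtranclp_eq_rtrancl_path)
  then obtain xs where xs: "rtrancl_path (\<lambda>u v. u \<in> A \<and> v \<in> A \<and> touch u v) a xs b" "distinct (a # xs)"
    by (rule rtrancl_path_distinct)
  from xs(1) have "set xs \<subseteq> A" by induction auto
  then show thesis using that xs assms by auto
qed

text \<open>A chain without repetitions charges each cell of \<open>A\<close> at most once.\<close>

lemma conn_abs_diff:
  fixes h :: "(nat \<times> nat) list \<Rightarrow> real"
  assumes "conn A" "finite A" "a \<in> A" "b \<in> A"
    and "\<And>u v. u \<in> A \<Longrightarrow> v \<in> A \<Longrightarrow> touch u v \<Longrightarrow> \<bar>h u - h v\<bar> \<le> \<rho> u" and \<rho>: "\<And>u. 0 \<le> \<rho> u"
  shows "\<bar>h a - h b\<bar> \<le> sum \<rho> A"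
proof -
  obtain xs where xs: "rtrancl_path (\<lambda>u v. u \<in> A \<and> v \<in> A \<and> touch u v) a xs b" "distinct (a # xs)" "set (a # xs) \<subseteq> A"
    using assms(1,3,4) by (rule conn_path)
  have "\<bar>h a - h b\<bar> \<le> sum_list (map \<rho> (a # xs))"
    by (rule rtrancl_path_abs_diff[OF xs(1)]) (use assms in auto)
  also have "\<dots> = sum \<rho> (set (a # xs))" using xs(2) by (rule sum_list_distinct_conv_sum_set)
  also have "\<dots> \<le> sum \<rho> A" using assms xs(3) by (intro sum_mono2) auto
  finally show ?thesis .
qed

text \<open>Proximity of squares rather than contact of cells: diagonal neighbours count, and so do
  neighbouring squares whose cells are disjoint.\<close>

definition near :: "(nat \<times> nat) list \<Rightarrow> (nat \<times> nat) list \<Rightarrow> bool" where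
  "near w v \<longleftrightarrow> (\<forall>i. \<bar>idx v i - idx w i\<bar> \<le> 1)"

lemma near_sym: "near w v \<longleftrightarrow> near v w"
  by (auto simp: near_def abs_minus_commute)

lemma near_refl: "near w w" by (simp add: near_def)

lemma squares_meet_near:
  assumes w: "w \<in> T n" and v: "v \<in> T n" and "z \<in> W w ` square" "z \<in> W v ` square" shows "near w v"
  unfolding near_def
proof
  fix i
  have "idx w i \<le> co n z i" "co n z i \<le> idx w i + 1" "idx v i \<le> co n z i" "co n z i \<le> idx v i + 1"
    using assms W_square_eq[OF w] W_square_eq[OF v] by auto
  then show "\<bar>idx v i - idx w i\<bar> \<le> 1" by linarith
qed

lemma touch_near: "w \<in> T n \<Longrightarrow> v \<in> T n \<Longrightarrow> touch w v \<Longrightarrow> near w v"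
  using squares_meet_near[of w n v] cell_square[of w n] cell_square[of v n] by blast

lemma card_near: assumes "w \<in> T n" shows "card {v \<in> T n. near w v} \<le> 9"
proof -
  have "inj_on idx {v \<in> T n. near w v}" using idx_inj by (auto simp: inj_on_def fun_eq_iff)
  moreover have "idx ` {v \<in> T n. near w v} \<subseteq> {z'. \<forall>i. \<bar>z' i - idx w i\<bar> \<le> 1}" by (auto simp: near_def)
  ultimately have "card {v \<in> T n. near w v} \<le> card {z'. \<forall>i. \<bar>z' i - idx w i\<bar> \<le> 1}"
    using card_int_box(1)[of 1 "idx w"] by (intro card_inj_on_le) auto
  then show ?thesis by (simp add: card_int_box)
qed

text \<open>Folding onto the square of \<open>v\<close> fixes the points of that square, while it
  maps \<open>Kc w\<close> into \<open>Kc v\<close>. The position of the squares is arbitrary, so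
  contact at a vertex is covered.\<close>

lemma cell_transfer:
  assumes w: "w \<in> T n" and v: "v \<in> T n" and y: "y \<in> Kc w" "y \<in> W v ` square"
  shows "y \<in> Kc v"
proof -
  obtain x where x: "x \<in> K" "y = W w x" using y(1) by (auto simp: cell_def)
  obtain x' where x': "x' \<in> square" "y = W v x'" using y(2) by blast
  have "x' = rel_sym v v x'"
    using square_symmetries_bij[OF sig_sym[OF v]] by (simp add: rel_sym_def bij_is_inj)
  also have "\<dots> = fold_on v y" using fold_on_W[OF v v x'(1)] x'(2) by simp
  also have "\<dots> = rel_sym v w x" using fold_on_W[OF v w] x K_square by auto
  also have "\<dots> \<in> K" using rel_sym_in[OF v w] x by (auto simp: cell_syms_def)
  finally show ?thesis using x'(2) by (auto simp: cell_def)
qed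

text \<open>Non-degeneracy supplies a point of \<open>Kc w\<close> on the common side, and
  \<open>cell_transfer\<close> puts it into \<open>Kc v\<close> as well.\<close>

lemma side_touch:
  assumes w: "w \<in> T n" and v: "v \<in> T n" and d: "d \<in> {1, -1}" "idx v j = idx w j + d"
    and o: "idx v (other j) = idx w (other j)"
  shows "touch w v"
proof -
  define \<delta> :: int where "\<delta> = (if d = 1 then 1 else 0)"
  have "real_of_int \<delta> \<in> {0, 1}" by (simp add: \<delta>_def)
  from cell_meets_side[OF w this, of j] obtain y where y: "y \<in> Kc w" "co n y j = idx w j + \<delta>" by auto
  have "y \<in> W w ` square" using y cell_square[OF w] by blast
  then have "y \<in> W v ` square"
    using y(2) d o unfolding W_square_eq[OF w] W_square_eq[OF v] mem_Collect_eq all2_other[of _ j]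
    by (auto simp: \<delta>_def)
  then show ?thesis using cell_transfer[OF w v y(1)] y(1) by blast
qed

lemma side_edge_touch: "(w, v) \<in> side_edges S f n \<Longrightarrow> touch w v"
proof -
  assume wv: "(w, v) \<in> side_edges S f n"
  then have "w \<in> T n" "v \<in> T n" by (auto simp: side_edges_def)
  then show ?thesis using side_touch side_edge_idx[OF wv] by metis
qed

lemma conn_T: "conn (T n)"
proof (cases "n = 0")
  case True
  then show ?thesis by (simp add: conn_singleton)
next
  case False
  show ?thesis unfolding conn_def
  proof (intro ballI)
    fix a b assume "a \<in> T n" "b \<in> T n"
    then have "(a, b) \<in> (side_edges S f n \<union> (side_edges S f n)\<inverse>)\<^sup>*"
      using strong_conn False by (auto simp: strongly_connected_def graph_connected_def)
    then show "(a, b) \<in> {(u, v). u \<in> T n \<and> v \<in> T n \<and> touch u v}\<^sup>*"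
    proof (rule rtrancl_mono[THEN subsetD, rotated], intro subrelI)
      fix u v assume "(u, v) \<in> side_edges S f n \<union> (side_edges S f n)\<inverse>"
      then have e: "(u, v) \<in> side_edges S f n \<or> (v, u) \<in> side_edges S f n" by blast
      then have "touch u v" using side_edge_touch touch_sym by blast
      moreover have "u \<in> T n" "v \<in> T n" using e by (auto simp: side_edges_def)
      ultimately show "(u, v) \<in> {(u, v). u \<in> T n \<and> v \<in> T n \<and> touch u v}" by blast
    qed
  qed
qed

section \<open>Crossings and planarity\<close>

definition cross :: "2 \<Rightarrow> nat \<Rightarrow> (nat \<times> nat) list set \<Rightarrow> bool" where
  "cross i m A \<longleftrightarrow> A \<subseteq> T m \<and> conn A \<and> (\<exists>a\<in>A. \<exists>x\<in>Kc a. x $ i = -1) \<and> (\<exists>a\<in>A. \<exists>x\<in>Kc a. x $ i = 1)"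

lemma cross_T: "cross i m (T m)"
proof -
  have "\<exists>x\<in>K. x $ i = c" if "c \<in> {1, -1}" for c
    using nondeg that unfolding non_degenerate_def square_side_def by blast
  then have "\<exists>a\<in>T m. \<exists>x\<in>Kc a. x $ i = c" if "c \<in> {1, -1}" for c
    using that K_eq_cells[of m] by blast
  then show ?thesis unfolding cross_def using conn_T by blast
qed

text \<open>Chords of the cells are joined at contact points. The arc may leave \<open>K\<close>,
  but it stays in the convex squares, which is enough for planarity.\<close>

lemma conn_arc:
  assumes "conn A" "a \<in> A" "x \<in> Kc a" "b \<in> A" "y \<in> Kc b"
  shows "\<exists>g. path g \<and> pathstart g = x \<and> pathfinish g = y \<and>
    path_image g \<subseteq> {z. \<exists>c\<in>A. \<exists>x'\<in>Kc c. \<exists>y'\<in>Kc c. z \<in> closed_segment x' y'}"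
    (is "\<exists>g. ?P g y")
proof -
  have "\<forall>y\<in>Kc b. \<exists>g. ?P g y"
  proof (rule conn_induct[OF assms(1,2) _ _ assms(4), of "\<lambda>b. \<forall>y\<in>Kc b. \<exists>g. ?P g y"])
    show "\<forall>y\<in>Kc a. \<exists>g. ?P g y"
    proof
      fix y assume "y \<in> Kc a"
      then show "\<exists>g. ?P g y" using assms by (intro exI[of _ "linepath x y"]) auto
    qed
    fix u v assume uv: "u \<in> A" "v \<in> A" "touch u v" "\<forall>y\<in>Kc u. \<exists>g. ?P g y"
    then obtain z where z: "z \<in> Kc u" "z \<in> Kc v" by blast
    then obtain g where g: "?P g z" using uv by blast
    show "\<forall>y\<in>Kc v. \<exists>g. ?P g y"
    proof
      fix y assume y: "y \<in> Kc v"
      have "?P (g +++ linepath z y) y" using g z y uv(2) by (auto simp: path_image_join)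
      then show "\<exists>g. ?P g y" by blast
    qed
  qed
  then show ?thesis using assms by blast
qed

lemma convex_W_square: "w \<in> T n \<Longrightarrow> convex (W w ` square)"
proof -
  assume w: "w \<in> T n"
  have "W w ` square = {y. \<forall>i. 2 * idx w i / real N ^ n - 1 \<le> y $ i \<and> y $ i \<le> 2 * (idx w i + 1) / real N ^ n - 1}"
    using Npow_pos[of n] unfolding W_square_eq[OF w] by (simp add: grid_coord_def field_simps)
  also have "\<dots> = cbox (\<chi> i. 2 * idx w i / real N ^ n - 1) (\<chi> i. 2 * (idx w i + 1) / real N ^ n - 1)"
    by (auto simp: mem_box_cart)
  finally show ?thesis by (simp add: convex_box)
qed

text \<open>Two squares sharing only a vertex: a chord of one of them through that vertex ends there,
  so the vertex belongs to the attractor.\<close>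

lemma segments_meet_touch:
  assumes a: "a \<in> T n" and b: "b \<in> T n" and x: "x1 \<in> Kc a" "y1 \<in> Kc a" "x2 \<in> Kc b" "y2 \<in> Kc b"
    and z: "z \<in> closed_segment x1 y1" "z \<in> closed_segment x2 y2"
  shows "touch a b"
proof -
  have za: "z \<in> W a ` square"
    using closed_segment_subset[OF _ _ convex_W_square[OF a], of x1 y1] x z cell_square[OF a] by blast
  have zb: "z \<in> W b ` square"
    using closed_segment_subset[OF _ _ convex_W_square[OF b], of x2 y2] x z cell_square[OF b] by blast
  have nr: "\<bar>idx b i - idx a i\<bar> \<le> 1" for i using squares_meet_near[OF a b za zb] by (simp add: near_def)
  show ?thesis
  \<comment> \<open>A shared index means equal or side-adjacent squares, which touch wherever the
    chords meet. Only the diagonal position makes use of \<open>z\<close>.\<close>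
  proof (cases "\<exists>j. idx b (other j) = idx a (other j)")
    case True
    then obtain j where j: "idx b (other j) = idx a (other j)" by blast
    show ?thesis
    proof (cases "idx b j = idx a j")
      case True
      then have "\<forall>i. idx b i = idx a i" using j all2_other[of "\<lambda>i. idx b i = idx a i" j] by simp
      then have "a = b" using idx_inj[OF a b] by simp
      then show ?thesis using touch_refl by simp
    next
      case False
      then have "idx b j - idx a j \<in> {1, -1}" using nr[of j] by auto
      then show ?thesis using side_touch[OF a b _ _ j] by simp
    qed
  next
    case False
    have ne: "idx b i \<noteq> idx a i" for i
      using False by (metis other_other)
    have rng: "idx a i \<le> co n y i \<and> co n y i \<le> idx a i + 1" if "y \<in> Kc a" for y i
      using that cell_square[OF a] W_square_eq[OF a] by auto
    obtain t where t: "0 \<le> t" "t \<le> 1" "z = (1 - t) *\<^sub>R x1 + t *\<^sub>R y1" using z(1) by (auto simp: closed_segment_def)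
    have coz: "co n z i = (1 - t) * co n x1 i + t * co n y1 i" for i
      by (simp add: t grid_coord_def field_simps)
    have ext: "co n z i = idx a i \<or> co n z i = idx a i + 1" for i
    proof -
      have "idx a i \<le> co n z i" "co n z i \<le> idx a i + 1" "idx b i \<le> co n z i" "co n z i \<le> idx b i + 1"
        using za zb W_square_eq[OF a] W_square_eq[OF b] by auto
      moreover have "idx b i = idx a i + 1 \<or> idx b i = idx a i - 1" using nr[of i] ne[of i] by linarith
      ultimately show ?thesis by auto
    qed
    have "z \<in> Kc a"
    proof (cases "t = 1")
      case True
      then show ?thesis using t x by simp
    next
      case False
      then have t1: "0 < 1 - t" using t by simp
      \<comment> \<open>Each coordinate of \<open>z\<close> is extreme over the square, so a convex
        combination attains it only if every end point of positive weight does.\<close>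
      have "co n x1 i = co n z i" for i
      proof -
        let ?A = "co n x1 i - co n z i" and ?B = "co n y1 i - co n z i"
        have "(1 - t) * ?A + t * ?B = 0" using coz[of i] by (simp add: algebra_simps)
        moreover have "(0 \<le> ?A \<and> 0 \<le> ?B) \<or> (?A \<le> 0 \<and> ?B \<le> 0)"
          using ext[of i] rng[OF x(1), of i] rng[OF x(2), of i] by auto
        then have "(0 \<le> (1 - t) * ?A \<and> 0 \<le> t * ?B) \<or> ((1 - t) * ?A \<le> 0 \<and> t * ?B \<le> 0)"
          using t t1 by (auto simp: mult_nonneg_nonpos mult_le_0_iff)
        ultimately have "(1 - t) * ?A = 0" by linarith
        then show ?thesis using t1 by simp
      qed
      then have "x1 = z" using co_eq_iff by metis
      then show ?thesis using x by simp
    qed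
    then show ?thesis using cell_transfer[OF a b _ zb] by blast
  qed
qed

text \<open>By \<open>fashoda\<close> the two broken lines meet. The meeting point lies on a chord
  of a cell of either set, and \<open>segments_meet_touch\<close> turns this into contact of the
  cells.\<close>

lemma crossings_touch_aux:
  assumes "cross 1 m A" "cross 2 m B"
  shows "\<exists>a\<in>A. \<exists>b\<in>B. touch a b"
proof -
  have AB: "A \<subseteq> T m" "B \<subseteq> T m" using assms by (auto simp: cross_def)
  have sq: "{z. \<exists>c\<in>C. \<exists>x'\<in>Kc c. \<exists>y'\<in>Kc c. z \<in> closed_segment x' y'} \<subseteq> square" if "C \<subseteq> T m" for C
  proof clarify
    fix z c x' y' assume c: "c \<in> C" "x' \<in> Kc c" "y' \<in> Kc c" "z \<in> closed_segment x' y'"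
    then have "z \<in> W c ` square"
      using closed_segment_subset[OF _ _ convex_W_square, of x' c y' m] that cell_square by blast
    then show "z \<in> square" using W_square that c by blast
  qed
  obtain a x a' x' where x: "a \<in> A" "x \<in> Kc a" "x $ 1 = -1" "a' \<in> A" "x' \<in> Kc a'" "x' $ 1 = 1"
    using assms(1) unfolding cross_def by blast
  obtain b y b' y' where y: "b \<in> B" "y \<in> Kc b" "y $ 2 = -1" "b' \<in> B" "y' \<in> Kc b'" "y' $ 2 = 1"
    using assms(2) unfolding cross_def by blast
  obtain g where g: "path g" "pathstart g = x" "pathfinish g = x'"
    "path_image g \<subseteq> {z. \<exists>c\<in>A. \<exists>x'\<in>Kc c. \<exists>y'\<in>Kc c. z \<in> closed_segment x' y'}"
    using conn_arc[of A a x a' x'] assms(1) x unfolding cross_def by blast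
  obtain h where h: "path h" "pathstart h = y" "pathfinish h = y'"
    "path_image h \<subseteq> {z. \<exists>c\<in>B. \<exists>x'\<in>Kc c. \<exists>y'\<in>Kc c. z \<in> closed_segment x' y'}"
    using conn_arc[of B b y b' y'] assms(2) y unfolding cross_def by blast
  obtain z where z: "z \<in> path_image g" "z \<in> path_image h"
  proof (rule fashoda[OF g(1) h(1), of "\<chi> i. -1" "\<chi> i. 1"])
    show "path_image g \<subseteq> cbox (\<chi> i. -1) (\<chi> i. 1)" "path_image h \<subseteq> cbox (\<chi> i. -1) (\<chi> i. 1)"
      using g(4) h(4) sq[OF AB(1)] sq[OF AB(2)] unfolding square_def by blast+
  qed (use g h x y in auto)
  from z(1) g(4) obtain c x1 y1 where 1: "c \<in> A" "x1 \<in> Kc c" "y1 \<in> Kc c" "z \<in> closed_segment x1 y1" by blast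
  from z(2) h(4) obtain d x2 y2 where 2: "d \<in> B" "x2 \<in> Kc d" "y2 \<in> Kc d" "z \<in> closed_segment x2 y2" by blast
  have "touch c d" using segments_meet_touch[of c m d x1 y1 x2 y2 z] 1 2 AB by blast
  then show ?thesis using 1 2 by blast
qed

lemma crossings_touch:
  assumes "cross i m A" "cross (other i) m B"
  shows "\<exists>a\<in>A. \<exists>b\<in>B. touch a b"
proof (cases "i = 1")
  case True
  then show ?thesis using crossings_touch_aux assms by (simp add: other_def)
next
  case False
  then have "i = 2" using exhaust_2 by blast
  then have "\<exists>b\<in>B. \<exists>a\<in>A. touch b a" using crossings_touch_aux assms by (simp add: other_def)
  then show ?thesis using touch_sym by blast
qed

section \<open>Folding long connected sets to crossings\<close>

lemma co_add: "co (k + j) y i = real N ^ j * co k y i"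
  by (simp add: grid_coord_def power_add)

text \<open>A square of the finer generation lies on one side of a coarse grid line, possibly
  reaching it. If no cell had a point on the line, the strict side would be inherited through
  contact along the whole set. The argument rests on alignment with the grid, not on connectedness
  of the cells.\<close>

lemma conn_meets_line:
  assumes A: "A \<subseteq> T (k + j)" "conn A"
    and a: "a \<in> A" "x \<in> Kc a" "co k x i \<le> real_of_int t" and b: "b \<in> A" "y \<in> Kc b" "real_of_int t \<le> co k y i"
  shows "\<exists>c\<in>A. \<exists>z\<in>Kc c. co k z i = t"
proof (rule ccontr)
  define n where "n = k + j"
  define t' where "t' = t * int N ^ j"
  have conv: "co n z i < t' \<longleftrightarrow> co k z i < t" "co n z i = t' \<longleftrightarrow> co k z i = t" for z
    using Npow_pos[of j] by (auto simp: n_def co_add t'_def mult.commute)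
  assume neg: "\<not> ?thesis"
  have rng: "idx c i \<le> co n z i" "co n z i \<le> idx c i + 1" if "c \<in> A" "z \<in> Kc c" for c z
  proof -
    have "c \<in> T n" using that A by (auto simp: n_def)
    then show "idx c i \<le> co n z i" "co n z i \<le> idx c i + 1"
      using that cell_square[of c n] W_square_eq[of c n] by auto
  qed
  have dich: "\<forall>z\<in>Kc c. co n z i < t'" if c: "c \<in> A" "z0 \<in> Kc c" "co n z0 i < t'" for c z0
  proof
    fix z assume z: "z \<in> Kc c"
    have "idx c i < t'" using rng(1)[OF c(1,2)] c(3) by linarith
    then have "co n z i \<le> t'" using rng(2)[OF c(1) z] by linarith
    moreover have "co n z i \<noteq> t'" using neg c(1) z conv by blast
    ultimately show "co n z i < t'" by simp
  qed
  have "co k x i \<noteq> t" using neg a by blast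
  then have "co n x i < t'" using a conv by simp
  then have "\<forall>z\<in>Kc a. co n z i < t'" using dich a by blast
  then have "\<forall>z\<in>Kc b. co n z i < t'"
  proof (rule conn_induct[OF A(2) a(1) _ _ b(1), of "\<lambda>c. \<forall>z\<in>Kc c. co n z i < t'"])
    fix u v assume "u \<in> A" "v \<in> A" "touch u v" "\<forall>z\<in>Kc u. co n z i < t'"
    then show "\<forall>z\<in>Kc v. co n z i < t'" using dich by blast
  qed
  then have "co k y i < t" using b conv by blast
  then show False using b by simp
qed

lemma fold_conn:
  assumes w: "w \<in> T k" and A: "A \<subseteq> T (k + j)" "conn A"
  shows "fold_word w ` A \<subseteq> T j" "conn (fold_word w ` A)"
proof -
  show "fold_word w ` A \<subseteq> T j" using fold_word_T[OF w] A by blast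
  show "conn (fold_word w ` A)"
  proof (rule conn_image[OF A(2)])
    fix a b assume "a \<in> A" "b \<in> A" "touch a b"
    then show "touch (fold_word w a) (fold_word w b)"
      using cell_fold_word[OF w, of a j] cell_fold_word[OF w, of b j] A by auto
  qed
qed

lemma triangle_wave_int: "triangle_wave (real_of_int t) = (if even t then -1 else 1)"
  using triangle_wave_shift[of 0 t] by simp

text \<open>Consecutive grid lines have opposite parity, so the triangle wave sends them to opposite
  sides of the square. The index \<open>l\<close> is the axis to which \<open>inv (sig w)\<close>
  carries axis \<open>i\<close>.\<close>

lemma fold_cross_aux:
  assumes w: "w \<in> T k" and A: "A \<subseteq> T (k + j)" "conn A"
    and a: "a \<in> A" "x \<in> Kc a" "co k x i \<le> real_of_int t" and b: "b \<in> A" "y \<in> Kc b" "real_of_int t + 1 \<le> co k y i"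
    and e: "e \<in> {1, -1}" "\<And>x. inv (sig w) x $ l = e * x $ i"
  shows "cross l j (fold_word w ` A)"
proof -
  obtain c z where c: "c \<in> A" "z \<in> Kc c" "co k z i = t"
    using conn_meets_line[OF A a b(1,2)] b(3) by fastforce
  obtain d z' where d: "d \<in> A" "z' \<in> Kc d" "co k z' i = real_of_int (t + 1)"
    using conn_meets_line[OF A a(1,2) _ b(1,2), of i "t + 1"] a(3) b(3) by fastforce
  have len: "length w = k" using w by (simp add: words_def)
  have 1: "fold_on w z $ l = e * (if even t then -1 else 1)"
    by (simp add: fold_on_def e fold_square_def len c(3) triangle_wave_int)
  have 2: "fold_on w z' $ l = e * (if even t then 1 else -1)"
    unfolding fold_on_def e fold_square_def len by (simp add: d(3) triangle_wave_int[of "t + 1", simplified])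
  have m: "fold_on w z \<in> Kc (fold_word w c)" "fold_on w z' \<in> Kc (fold_word w d)"
    using cell_fold_word[OF w, of c j] cell_fold_word[OF w, of d j] A(1) c d by auto
  have "\<exists>a\<in>fold_word w ` A. \<exists>x\<in>Kc a. x $ l = s" if "s \<in> {1, -1}" for s
  proof (cases "fold_on w z $ l = s")
    case True
    then show ?thesis using m(1) c by blast
  next
    case False
    then have "fold_on w z' $ l = s" using that e(1) 1 2 by (auto split: if_splits)
    then show ?thesis using m(2) d by blast
  qed
  then show ?thesis using fold_conn[OF w A] unfolding cross_def by blast
qed

text \<open>The axis \<open>l\<close> is left open because the linear part of \<open>w\<close> may
  interchange the coordinates.\<close>

lemma fold_cross:
  assumes w: "w \<in> T k" and A: "A \<subseteq> T (k + j)" "conn A"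
    and a: "a \<in> A" "x \<in> Kc a" "co k x i \<le> real_of_int t" and b: "b \<in> A" "y \<in> Kc b" "real_of_int t + 1 \<le> co k y i"
  shows "\<exists>l. cross l j (fold_word w ` A)"
proof -
  have "inv (sig w) \<in> square_symmetries" using square_symmetries_inv sig_sym w by blast
  from square_symmetry_signed_permutation[OF this]
  obtain \<pi> :: "2 \<Rightarrow> 2" and e :: "2 \<Rightarrow> real" where bij: "bij \<pi>" and e: "\<And>i. e i \<in> {1, -1}"
    and g: "\<And>x i. inv (sig w) x $ i = e i * x $ \<pi> i" by metis
  obtain l where "\<pi> l = i" using bij by (metis bij_pointE)
  then show ?thesis using fold_cross_aux[OF assms, of "e l" l] e g by blast
qed

text \<open>Repeating a letter cancels a possible interchange of the coordinate axes.\<close>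

lemma fold_cross_twice:
  assumes s: "s \<in> S" and A: "A \<subseteq> T (2 + j)" "conn A"
    and a: "a \<in> A" "x \<in> Kc a" "co 2 x i \<le> real_of_int t" and b: "b \<in> A" "y \<in> Kc b" "real_of_int t + 1 \<le> co 2 y i"
  shows "cross i j (fold_word [s, s] ` A)"
proof -
  have w: "[s, s] \<in> T 2" using s by (simp add: words_def)
  obtain \<pi> :: "2 \<Rightarrow> 2" and e :: "2 \<Rightarrow> real" where bij: "bij \<pi>" and e: "\<And>i. e i \<in> {1, -1}"
    and g: "\<And>x i. lin [s] x $ i = e i * x $ \<pi> i"
    using square_symmetry_signed_permutation[OF lin_sym[OF word_singleton[OF s]]] by metis
  have W1: "W [s] x $ i = (lin [s] x $ i + 2 * idx [s] i + 1) / real N - 1" for x i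
    using W_nth[OF word_singleton[OF s]] by simp
  have "lin [s, s] x = lin [s] (lin [s] x)" for x
  proof -
    have 0: "lin [s] 0 = 0" using square_symmetries_linear[OF lin_sym[OF word_singleton[OF s]]] linear_0 by blast
    have "W [s] (W [s] x) - W [s] (W [s] 0) = (1 / real N) *\<^sub>R (lin [s] (W [s] x) - lin [s] (W [s] 0))"
      unfolding vec_eq_iff vector_minus_component vector_scaleR_component W1
      by (simp only: affine_quotient_diff simp_thms)
    also have "lin [s] (W [s] x) - lin [s] (W [s] 0) = lin [s] (W [s] x - W [s] 0)"
      using square_symmetries_linear[OF lin_sym[OF word_singleton[OF s]]] by (simp add: linear_diff)
    also have "W [s] x - W [s] 0 = (1 / real N) *\<^sub>R lin [s] x"
      unfolding vec_eq_iff vector_minus_component vector_scaleR_component W1 by (simp only: affine_quotient_diff) (simp add: 0)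
    also have "lin [s] ((1 / real N) *\<^sub>R lin [s] x) = (1 / real N) *\<^sub>R lin [s] (lin [s] x)"
      using square_symmetries_linear[OF lin_sym[OF word_singleton[OF s]]] by (simp add: linear_scale)
    finally show ?thesis using N_pos by (simp add: lin_def[of "[s, s]"] power2_eq_square)
  qed
  moreover have "\<pi> (\<pi> k) = k" for k
  proof (cases "\<pi> k = k")
    case False
    then have k: "\<pi> k = other k" using other_cases[of "\<pi> k" k] by blast
    have "\<pi> (other k) \<noteq> \<pi> k" using bij by (simp add: bij_def inj_eq other_neq)
    then show ?thesis using k other_cases[of "\<pi> (other k)" k] by auto
  qed simp
  ultimately have l2: "lin [s, s] x $ i = (e i * e (\<pi> i)) * x $ i" for x i by (simp add: g)
  define c where "c = (if even (idx [s, s] i) then 1 else -1) * (e i * e (\<pi> i))"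
  have c: "c \<in> {1, -1}" using e[of i] e[of "\<pi> i"] by (auto simp: c_def)
  have sg: "sig [s, s] x $ i = c * x $ i" for x by (simp add: sig_def l2 c_def)
  have "inv (sig [s, s]) x $ i = c * x $ i" for x
  proof -
    have "sig [s, s] (inv (sig [s, s]) x) = x"
      using square_symmetries_bij[OF sig_sym[OF w]] by (simp add: bij_is_surj surj_f_inv_f)
    then have "x $ i = c * inv (sig [s, s]) x $ i" using sg by metis
    then show ?thesis using c by auto
  qed
  then show ?thesis using fold_cross_aux[OF w A a b c] by blast
qed

end

section \<open>Moduli of crossings\<close>

text \<open>Bounding every term by the largest one works for all \<open>p > 0\<close>; a Hoelder
  constant would require \<open>1 \<le> p\<close>.\<close>

lemma sum_powr_le:
  fixes g :: "'b \<Rightarrow> real"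
  assumes "finite X" "\<And>x. x \<in> X \<Longrightarrow> 0 \<le> g x" "0 < p"
  shows "(\<Sum>x\<in>X. g x) powr p \<le> real (card X) powr p * (\<Sum>x\<in>X. g x powr p)"
proof (cases "X = {}")
  case False
  define M where "M = Max (g ` X)"
  have M: "M \<in> g ` X" using False assms(1) by (simp add: M_def)
  then obtain x0 where x0: "x0 \<in> X" "M = g x0" by blast
  have "(\<Sum>x\<in>X. g x) \<le> (\<Sum>x\<in>X. M)" using assms(1) by (intro sum_mono) (simp add: M_def)
  then have "(\<Sum>x\<in>X. g x) powr p \<le> (real (card X) * M) powr p"
    using assms by (intro powr_mono2 sum_nonneg) auto
  also have "\<dots> = real (card X) powr p * (g x0 powr p)" using x0 assms by (simp add: powr_mult)
  also have "\<dots> \<le> real (card X) powr p * (\<Sum>x\<in>X. g x powr p)"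
    using x0 assms(1) by (intro mult_left_mono member_le_sum) auto
  finally show ?thesis .
qed simp

lemma sum_image_le_real:
  fixes \<rho> :: "'b \<Rightarrow> real"
  assumes "finite A" "\<And>x. 0 \<le> \<rho> x"
  shows "sum \<rho> (F ` A) \<le> (\<Sum>a\<in>A. \<rho> (F a))"
  using sum_image_le[of A \<rho> F] assms by (simp add: comp_def)

definition gaps :: "nat \<Rightarrow> (nat \<times> nat) set \<Rightarrow> bool" where
  "gaps N S \<longleftrightarrow> (\<forall>i\<in>{1..N}. \<forall>j\<in>{1..N}. \<exists>i\<^sub>1\<in>{1..N-1}. \<exists>j\<^sub>1\<in>{1..N-1}.
     {(i\<^sub>1, j), (i\<^sub>1 + 1, j), (i, j\<^sub>1), (i, j\<^sub>1 + 1)} \<inter> S = {})"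

locale tiling_p = tiling +
  fixes p :: real
  assumes p_pos: "0 < p"
    and rotation_or_gaps: "rotation (pi / 2) \<in> cell_homeos K S f \<or> gaps N S"
begin

definition mass :: "nat \<Rightarrow> ((nat \<times> nat) list \<Rightarrow> real) \<Rightarrow> real" where
  "mass m \<rho> = (\<Sum>a\<in>T m. \<rho> a powr p)"

definition admissible :: "2 \<Rightarrow> nat \<Rightarrow> ((nat \<times> nat) list \<Rightarrow> real) \<Rightarrow> bool" where
  "admissible i m \<rho> \<longleftrightarrow> (\<forall>a. 0 \<le> \<rho> a) \<and> (\<forall>A. cross i m A \<longrightarrow> 1 \<le> sum \<rho> A)"

text \<open>The discrete \<open>p\<close>-modulus of the family of crossings, with weights on
  vertices instead of edges.\<close>

definition modulus :: "2 \<Rightarrow> nat \<Rightarrow> real" where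
  "modulus i m = Inf (mass m ` {\<rho>. admissible i m \<rho>})"

definition max_modulus :: "nat \<Rightarrow> real" where
  "max_modulus m = max (modulus 1 m) (modulus 2 m)"

lemma mass_nonneg: "0 \<le> mass m \<rho>" by (simp add: mass_def sum_nonneg)

lemma cross_finite: "cross i m A \<Longrightarrow> finite A"
  using finite_T finite_subset by (auto simp: cross_def)

lemma admissible_one: "admissible i m (\<lambda>a. 1)"
proof -
  have "1 \<le> card A" if "cross i m A" for A
    using that cross_finite[OF that] card_gt_0_iff[of A] by (auto simp: cross_def)
  then show ?thesis by (auto simp: admissible_def)
qed

lemma modulus_le_mass: "admissible i m \<rho> \<Longrightarrow> modulus i m \<le> mass m \<rho>"
  unfolding modulus_def by (rule cInf_lower) (auto intro!: bdd_belowI[of _ 0] simp: mass_nonneg)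

text \<open>The set of all cells is a crossing, so an admissible weight is somewhere at least the
  reciprocal of their number.\<close>

lemma modulus_pos: "0 < modulus i m"
proof -
  define c where "c = (1 / real (card (T m))) powr p"
  have cT: "0 < real (card (T m))" using finite_T T_nonempty by (simp add: card_gt_0_iff)
  have "c \<le> mass m \<rho>" if "admissible i m \<rho>" for \<rho>
  proof -
    have nn: "0 \<le> \<rho> a" for a using that by (simp add: admissible_def)
    have "1 \<le> sum \<rho> (T m)" using that cross_T by (simp add: admissible_def)
    have "\<exists>a\<in>T m. 1 / real (card (T m)) \<le> \<rho> a"
    proof (rule ccontr)
      assume "\<not> ?thesis"
      then have "sum \<rho> (T m) < (\<Sum>a\<in>T m. 1 / real (card (T m)))"
        using finite_T T_nonempty by (intro sum_strict_mono) auto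
      then show False using cT \<open>1 \<le> sum \<rho> (T m)\<close> by simp
    qed
    then obtain a where a: "a \<in> T m" "1 / real (card (T m)) \<le> \<rho> a" by blast
    have "c \<le> \<rho> a powr p" unfolding c_def using a(2) p_pos by (intro powr_mono2) auto
    also have "\<dots> \<le> mass m \<rho>" unfolding mass_def using a(1) finite_T by (intro member_le_sum) auto
    finally show ?thesis .
  qed
  then have "c \<le> modulus i m" unfolding modulus_def
    using admissible_one by (intro cInf_greatest) auto
  moreover have "0 < c" using cT by (simp add: c_def)
  ultimately show ?thesis by simp
qed

lemma modulus_max: "modulus i m \<le> max_modulus m"
  using exhaust_2[of i] by (auto simp: max_modulus_def)

lemma max_modulus_le: "(\<And>i. modulus i m \<le> c) \<Longrightarrow> max_modulus m \<le> c"
  by (simp add: max_modulus_def)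

lemma max_modulus_pos: "0 < max_modulus m"
  using modulus_pos[of 1 m] modulus_max[of 1 m] by simp

lemma near_optimal:
  obtains \<rho> where "admissible i m \<rho>" "mass m \<rho> \<le> 2 * modulus i m"
proof -
  have "modulus i m < 2 * modulus i m" using modulus_pos by simp
  then obtain x where "x \<in> mass m ` {\<rho>. admissible i m \<rho>}" "x < 2 * modulus i m"
    unfolding modulus_def using admissible_one
    by (metis (mono_tags, lifting) cInf_lessD empty_iff image_is_empty mem_Collect_eq)
  then show thesis using that by auto
qed

text \<open>The dual reading of the modulus: dividing \<rho> by the length of its shortest crossing
  makes it admissible, so the modulus bounds that length from above.\<close>

lemma short_crossing:
  assumes "\<And>a. 0 \<le> \<rho> a"
  obtains A where "cross i m A" "sum \<rho> A powr p * modulus i m \<le> mass m \<rho>"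
proof -
  have fin: "finite (sum \<rho> ` {A. cross i m A})"
    by (rule finite_imageI, rule finite_subset[of _ "Pow (T m)"]) (auto simp: cross_def finite_T)
  define l where "l = Min (sum \<rho> ` {A. cross i m A})"
  have "l \<in> sum \<rho> ` {A. cross i m A}" unfolding l_def by (rule Min_in[OF fin]) (use cross_T in auto)
  then obtain A where A: "cross i m A" "sum \<rho> A = l" by blast
  have low: "l \<le> sum \<rho> B" if "cross i m B" for B unfolding l_def using that fin by (intro Min_le) auto
  have l0: "0 \<le> l" using A assms sum_nonneg by metis
  have "l powr p * modulus i m \<le> mass m \<rho>"
  proof (cases "l = 0")
    case False
    then have l: "0 < l" using l0 by simp
    have "admissible i m (\<lambda>a. \<rho> a / l)"
      using low l assms by (auto simp: admissible_def sum_divide_distrib[symmetric])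
    then have "modulus i m \<le> mass m (\<lambda>a. \<rho> a / l)" by (rule modulus_le_mass)
    also have "\<dots> = mass m \<rho> / l powr p"
      using l assms by (simp add: mass_def powr_divide sum_divide_distrib)
    finally show ?thesis using l by (simp add: field_simps)
  qed (use mass_nonneg in simp)
  then show thesis using that A by simp
qed

lemma sum_words_append: "(\<Sum>a\<in>T (k + j). g a) = (\<Sum>v\<in>T k. \<Sum>u\<in>T j. g (v @ u))"
proof -
  have "(\<Sum>v\<in>T k. \<Sum>u\<in>T j. g (v @ u)) = (\<Sum>(v, u)\<in>T k \<times> T j. g (v @ u))"
    by (simp add: sum.cartesian_product)
  also have "\<dots> = (\<Sum>a\<in>T (k + j). g a)"
  proof (rule sum.reindex_bij_witness[of _ "\<lambda>a. (take k a, drop k a)" "\<lambda>(v, u). v @ u"])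
  qed (auto dest: in_set_takeD in_set_dropD simp: words_def)
  finally show ?thesis by simp
qed

text \<open>For each \<open>v\<close> in \<open>P\<close> the sum over the subcells is a
  rearrangement of the mass of \<rho>, so only the number of squares counts.\<close>

lemma mass_fold:
  assumes w: "w \<in> T k" and P: "P \<subseteq> T k"
  shows "(\<Sum>a\<in>T (k + j). if take k a \<in> P then \<rho> (fold_word w a) powr p else 0) = real (card P) * mass j \<rho>"
proof -
  have "(\<Sum>a\<in>T (k + j). if take k a \<in> P then \<rho> (fold_word w a) powr p else 0)
    = (\<Sum>v\<in>T k. \<Sum>u\<in>T j. if v \<in> P then \<rho> (fold_word w (v @ u)) powr p else 0)"
    unfolding sum_words_append by (intro sum.cong) (auto simp: words_def)
  also have "\<dots> = (\<Sum>v\<in>T k. if v \<in> P then mass j \<rho> else 0)"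
  proof (rule sum.cong[OF refl])
    fix v assume v: "v \<in> T k"
    have "(\<Sum>u\<in>T j. \<rho> (fold_word w (v @ u)) powr p) = mass j \<rho>"
      unfolding mass_def using fold_word_bij[OF w v, of j] by (rule sum.reindex_bij_betw)
    then show "(\<Sum>u\<in>T j. if v \<in> P then \<rho> (fold_word w (v @ u)) powr p else 0) = (if v \<in> P then mass j \<rho> else 0)"
      by simp
  qed
  also have "\<dots> = (\<Sum>v\<in>P. mass j \<rho>)" using P finite_T by (simp add: sum.If_cases Int_absorb1)
  finally show ?thesis by simp
qed

lemma mass_fold_all:
  assumes w: "w \<in> T k" shows "mass (k + j) (\<lambda>a. \<rho> (fold_word w a)) = real (card S) ^ k * mass j \<rho>"
  using mass_fold[OF w order_refl, where j = j and \<rho> = \<rho>]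
  by (simp add: mass_def words_take card_words finite_S cong: sum.cong)

text \<open>The 4 comes from adding two weights of mass at most twice a modulus each, and
  \<open>2 powr p\<close> from raising their sum to the power \<open>p\<close>.\<close>

definition Cb :: real where "Cb = 4 * 2 powr p"

lemma Cb_pos: "Cb > 0" by (simp add: Cb_def)

text \<open>Folding forgets the direction of a crossing, so one weight must serve both directions;
  the sum of two nearly optimal weights does.\<close>

lemma near_optimal_both:
  obtains \<rho> where "\<And>a. 0 \<le> \<rho> a" "\<And>i A. cross i m A \<Longrightarrow> 1 \<le> sum \<rho> A" "mass m \<rho> \<le> Cb * max_modulus m"
proof -
  obtain \<rho>1 where 1: "admissible 1 m \<rho>1" "mass m \<rho>1 \<le> 2 * modulus 1 m" by (rule near_optimal)
  obtain \<rho>2 where 2: "admissible 2 m \<rho>2" "mass m \<rho>2 \<le> 2 * modulus 2 m" by (rule near_optimal)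
  have nn: "0 \<le> \<rho>1 a" "0 \<le> \<rho>2 a" for a using 1 2 by (auto simp: admissible_def)
  show thesis
  proof (rule that[of "\<lambda>a. \<rho>1 a + \<rho>2 a"])
    fix i A assume c: "cross i m A"
    have "0 \<le> sum \<rho>1 A" "0 \<le> sum \<rho>2 A" using nn by (auto intro: sum_nonneg)
    moreover have "1 \<le> sum \<rho>1 A \<or> 1 \<le> sum \<rho>2 A"
      using 1 2 c exhaust_2[of i] by (auto simp: admissible_def)
    ultimately show "1 \<le> (\<Sum>a\<in>A. \<rho>1 a + \<rho>2 a)" by (auto simp: sum.distrib)
  next
    have "(\<rho>1 a + \<rho>2 a) powr p \<le> 2 powr p * (\<rho>1 a powr p + \<rho>2 a powr p)" for a
      using sum_powr_le[of "{True, False}" "\<lambda>b. if b then \<rho>1 a else \<rho>2 a" p] nn p_pos by simp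
    then have "mass m (\<lambda>a. \<rho>1 a + \<rho>2 a) \<le> 2 powr p * (mass m \<rho>1 + mass m \<rho>2)"
      by (simp add: mass_def sum_mono sum.distrib[symmetric] sum_distrib_left)
    also have "\<dots> \<le> 2 powr p * (2 * max_modulus m + 2 * max_modulus m)"
      using 1(2) 2(2) modulus_max[of 1 m] modulus_max[of 2 m] by (intro mult_left_mono add_mono) auto
    finally show "mass m (\<lambda>a. \<rho>1 a + \<rho>2 a) \<le> Cb * max_modulus m" by (simp add: Cb_def)
  qed (use nn in auto)
qed

lemma co_sides: "x $ i = -1 \<longleftrightarrow> co n x i = 0" "x $ i = 1 \<longleftrightarrow> co n x i = real N ^ n"
  using co_bounds_iff[of n x i] by linarith+

lemma max_modulus_Suc: "max_modulus (Suc m) \<le> Cb * real (card S) * max_modulus m"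
proof (rule max_modulus_le)
  fix i
  obtain w where w: "w \<in> T 1" using T_nonempty[of 1] by blast
  obtain \<rho> where \<rho>: "\<And>a. 0 \<le> \<rho> a" "\<And>i A. cross i m A \<Longrightarrow> 1 \<le> sum \<rho> A" "mass m \<rho> \<le> Cb * max_modulus m"
    using near_optimal_both[of m] by blast
  have "admissible i (1 + m) (\<lambda>a. \<rho> (fold_word w a))"
    unfolding admissible_def
  proof (intro conjI allI impI)
    fix A assume c: "cross i (1 + m) A"
    then obtain a x b y where A: "A \<subseteq> T (1 + m)" "conn A" and
      x: "a \<in> A" "x \<in> Kc a" "x $ i = -1" and y: "b \<in> A" "y \<in> Kc b" "y $ i = 1"
      unfolding cross_def by blast
    have "co 1 x i \<le> real_of_int 0" "real_of_int 0 + 1 \<le> co 1 y i"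
      using x(3) y(3) N2 by (auto simp: co_sides[of _ _ 1])
    from fold_cross[OF w A x(1,2) this(1) y(1,2) this(2)]
    obtain l where "cross l m (fold_word w ` A)" by blast
    then have "1 \<le> sum \<rho> (fold_word w ` A)" using \<rho>(2) by blast
    also have "\<dots> \<le> (\<Sum>a\<in>A. \<rho> (fold_word w a))"
      using cross_finite[OF c] \<rho>(1) by (rule sum_image_le_real)
    finally show "1 \<le> (\<Sum>a\<in>A. \<rho> (fold_word w a))" .
  qed (use \<rho> in auto)
  then have "modulus i (1 + m) \<le> mass (1 + m) (\<lambda>a. \<rho> (fold_word w a))" by (rule modulus_le_mass)
  also have "\<dots> = real (card S) * mass m \<rho>" using mass_fold_all[OF w] by simp
  also have "\<dots> \<le> real (card S) * (Cb * max_modulus m)" using \<rho>(3) by (intro mult_left_mono) auto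
  finally show "modulus i (Suc m) \<le> Cb * real (card S) * max_modulus m" by (simp add: algebra_simps)
qed

section \<open>Gaps and the comparison of the two directions\<close>

lemma idx_two:
  assumes s: "s \<in> S" "s' \<in> S" and e: "\<And>i. e i \<in> {1, -1::real}" "\<And>x i. lin [s] x $ i = e i * x $ \<pi> i"
  shows "idx [s, s'] k = int N * idx [s] k + (if e k = 1 then idx [s'] (\<pi> k) else int N - 1 - idx [s'] (\<pi> k))"
proof -
  define y where "y = W [s'] 0"
  have 0: "lin [s'] 0 $ i = 0" for i
    using square_symmetries_linear[OF lin_sym[OF word_singleton[OF s(2)]]] linear_0 by fastforce
  have y: "(y $ i + 1) * real N / 2 = idx [s'] i + 1 / 2" for i
    using co_W[OF word_singleton[OF s(2)], of 0 i] 0 by (simp add: y_def grid_coord_def)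
  have "co 2 (W [s, s'] 0) k = real N * co 1 (W [s] y) k"
    by (simp add: grid_coord_def y_def power2_eq_square)
  also have "\<dots> = real N * (idx [s] k + (e k * y $ \<pi> k + 1) / 2)"
    using co_W[OF word_singleton[OF s(1)], of y k] e(2) by simp
  \<comment> \<open>The first letter turns axis \<open>\<pi> k\<close> of the inner square into axis
    \<open>k\<close> and reverses the count when \<open>e k = -1\<close>.\<close>
  also have "\<dots> = real_of_int (int N * idx [s] k + (if e k = 1 then idx [s'] (\<pi> k) else int N - 1 - idx [s'] (\<pi> k))) + 1 / 2"
    using e(1)[of k] y[of "\<pi> k"] by (auto simp: field_simps)
  finally have E: "co 2 (W [s, s'] 0) k = \<dots>" .
  have len: "length [s, s'] = 2" by simp
  show ?thesis unfolding idx_def[of "[s, s']"] len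
    by (rule floor_unique) (unfold E, linarith+)
qed

text \<open>The instance \<open>i = j = c\<close> of the gap condition yields an empty position with
  first coordinate \<open>c\<close> and one with second coordinate \<open>c\<close>; the axis
  \<open>i\<close> decides which of them serves. Letters count from 1 and indices from 0.\<close>

lemma gap_row:
  assumes gaps: "gaps N S"
    and q: "0 \<le> q" "q < int N"
  shows "\<exists>r. 0 \<le> r \<and> r < int N \<and> (\<forall>s\<in>S. \<not> (idx [s] i = q \<and> idx [s] (other i) = r))"
proof -
  define c where "c = nat q + 1"
  have c: "c \<in> {1..N}" "int c - 1 = q" using q by (auto simp: c_def)
  from gaps[unfolded gaps_def, THEN bspec, OF c(1), THEN bspec, OF c(1)] obtain i1 j1 where
    ij: "i1 \<in> {1..N-1}" "j1 \<in> {1..N-1}" "(i1, c) \<notin> S" "(c, j1) \<notin> S"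
    by (elim bexE) blast
  show ?thesis
  proof (cases "i = 1")
    case True
    have "\<not> (idx [s] i = q \<and> idx [s] (other i) = int j1 - 1)" if "s \<in> S" for s
    proof
      assume as: "idx [s] i = q \<and> idx [s] (other i) = int j1 - 1"
      have "idx [s] i = int (fst s) - 1" "idx [s] (other i) = int (snd s) - 1"
        using idx_singleton[OF that] True by (simp_all add: other_def)
      then have "fst s = c" "snd s = j1" using as c(2) by linarith+
      then have "s = (c, j1)" by (simp add: prod_eq_iff)
      then show False using that ij(4) by simp
    qed
    then show ?thesis using ij(2) by (intro exI[of _ "int j1 - 1"]) auto
  next
    case False
    have "\<not> (idx [s] i = q \<and> idx [s] (other i) = int i1 - 1)" if "s \<in> S" for s
    proof
      assume as: "idx [s] i = q \<and> idx [s] (other i) = int i1 - 1"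
      have "idx [s] i = int (snd s) - 1" "idx [s] (other i) = int (fst s) - 1"
        using idx_singleton[OF that] False by (simp_all add: other_def)
      then have "snd s = c" "fst s = i1" using as c(2) by linarith+
      then have "s = (i1, c)" by (simp add: prod_eq_iff)
      then show False using that ij(3) by simp
    qed
    then show ?thesis using ij(1) by (intro exI[of _ "int i1 - 1"]) auto
  qed
qed

text \<open>Two consecutive columns of generation two share an empty row. If both lie in one column
  of the first generation, that column has a gap. Otherwise take the gap of the left column and,
  inside the square to the right of it, the gap of its first subcolumn.\<close>

lemma gap_row_two:
  assumes gaps: "gaps N S"
    and c: "0 \<le> c" "c < int N ^ 2"
  shows "\<exists>r. 0 \<le> r \<and> r < int N ^ 2 \<and> (\<forall>b\<in>T 2. \<not> (idx b i \<in> {c, c + 1} \<and> idx b (other i) = r))"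
proof -
  have Np: "0 < int N" using N2 by simp
  define q where "q = c div int N"
  have qc: "int N * q \<le> c" "c < int N * q + int N"
    using Np pos_mod_bound[of "int N" c] pos_mod_sign[of "int N" c] mult_div_mod_eq[of "int N" c]
    unfolding q_def by linarith+
  have q: "0 \<le> q" "q < int N"
  proof -
    show "0 \<le> q" using c(1) Np by (simp add: q_def pos_imp_zdiv_nonneg_iff)
    have "int N * q < int N * int N" using qc(1) c(2) by (simp add: power2_eq_square)
    then show "q < int N" using Np by simp
  qed
  obtain r0 where r0: "0 \<le> r0" "r0 < int N" "\<And>s. s \<in> S \<Longrightarrow> \<not> (idx [s] i = q \<and> idx [s] (other i) = r0)"
    using gap_row[OF gaps q] by blast
  have dec: "\<exists>s s'. b = [s, s'] \<and> s \<in> S \<and> s' \<in> S \<and> (\<forall>k. idx [s] k = idx b k div int N)" if b: "b \<in> T 2" for b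
  proof -
    obtain s s' where s: "b = [s, s']" "s \<in> S" "s' \<in> S"
      using b by (auto simp: words_def length_Suc_conv numeral_2_eq_2)
    obtain \<pi> :: "2 \<Rightarrow> 2" and e :: "2 \<Rightarrow> real" where "bij \<pi>" and e: "\<And>i. e i \<in> {1, -1}"
      and g: "\<And>x i. lin [s] x $ i = e i * x $ \<pi> i"
      using square_symmetry_signed_permutation[OF lin_sym[OF word_singleton[OF s(2)]]] by metis
    have "idx b k div int N = idx [s] k" for k
    proof (rule int_div_pos_eq)
      define u where "u = (if e k = 1 then idx [s'] (\<pi> k) else int N - 1 - idx [s'] (\<pi> k))"
      show "idx b k = int N * idx [s] k + u"
        using idx_two[OF s(2,3) e g, of k] by (simp add: s(1) u_def)
      show "0 \<le> u" "u < int N" using idx_range[OF word_singleton[OF s(3)], of "\<pi> k"] by (auto simp: u_def)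
    qed
    then show ?thesis using s by metis
  qed
  have dq: "x div int N \<in> {q, q + 1}" if "x \<in> {c, c + 1}" for x
  proof -
    have "c div int N \<le> x div int N" using that Np by (intro zdiv_mono1) auto
    moreover have "x div int N \<le> (int N * (q + 1)) div int N"
      using that Np qc by (intro zdiv_mono1) (auto simp: algebra_simps)
    ultimately show ?thesis using Np unfolding q_def by auto
  qed
  show ?thesis
  proof (cases "\<exists>s0\<in>S. idx [s0] i = q + 1 \<and> idx [s0] (other i) = r0")
    case False
    have "\<not> (idx b i \<in> {c, c + 1} \<and> idx b (other i) = int N * r0)" if b: "b \<in> T 2" for b
    proof
      assume as: "idx b i \<in> {c, c + 1} \<and> idx b (other i) = int N * r0"
      obtain s s' where s: "b = [s, s']" "s \<in> S" "\<And>k. idx [s] k = idx b k div int N" using dec[OF b] by blast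
      have "idx [s] (other i) = r0" using s(3) as Np by simp
      moreover have "idx [s] i \<in> {q, q + 1}" using s(3) dq as by simp
      ultimately show False using r0(3)[OF s(2)] False s(2) by auto
    qed
    moreover have "0 \<le> int N * r0" using r0 by simp
    moreover have "int N * r0 < int N ^ 2" using r0(2) Np by (simp add: power2_eq_square)
    ultimately show ?thesis by blast
  next
    case True
    then obtain s0 where s0: "s0 \<in> S" "idx [s0] i = q + 1" "idx [s0] (other i) = r0" by blast
    obtain \<pi> :: "2 \<Rightarrow> 2" and e :: "2 \<Rightarrow> real" where bij: "bij \<pi>" and e: "\<And>i. e i \<in> {1, -1}"
      and g: "\<And>x i. lin [s0] x $ i = e i * x $ \<pi> i"
      using square_symmetry_signed_permutation[OF lin_sym[OF word_singleton[OF s0(1)]]] by metis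
    have "\<pi> (other i) \<noteq> \<pi> i" using bij by (simp add: bij_def inj_eq other_neq)
    then have po: "\<pi> (other i) = other (\<pi> i)" using other_cases[of "\<pi> (other i)" "\<pi> i"] by blast
    \<comment> \<open>The subcolumn of the right square next to the common boundary, in the frame of
      \<open>s0\<close>: a reversed axis puts it at the far end.\<close>
    define q' where "q' = (if e i = 1 then 0 else int N - 1)"
    have q': "0 \<le> q'" "q' < int N" using Np by (auto simp: q'_def)
    obtain r2 where r2: "0 \<le> r2" "r2 < int N" "\<And>s. s \<in> S \<Longrightarrow> \<not> (idx [s] (\<pi> i) = q' \<and> idx [s] (other (\<pi> i)) = r2)"
      using gap_row[OF gaps q'] by blast
    define r' where "r' = (if e (other i) = 1 then r2 else int N - 1 - r2)"
    have r': "0 \<le> r'" "r' < int N" using r2 by (auto simp: r'_def)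
    have "\<not> (idx b i \<in> {c, c + 1} \<and> idx b (other i) = int N * r0 + r')" if b: "b \<in> T 2" for b
    proof
      assume as: "idx b i \<in> {c, c + 1} \<and> idx b (other i) = int N * r0 + r'"
      obtain s s' where s: "b = [s, s']" "s \<in> S" "s' \<in> S" "\<And>k. idx [s] k = idx b k div int N" using dec[OF b] by blast
      have o: "idx [s] (other i) = r0" using s(4) as r' by (simp add: int_div_pos_eq)
      moreover have "idx [s] i \<in> {q, q + 1}" using s(4) dq as by simp
      ultimately have i: "idx [s] i = q + 1" using r0(3)[OF s(2)] by auto
      have "\<forall>k. idx [s] k = idx [s0] k" unfolding all2_other[of _ i] using o i s0 by simp
      then have "[s] = [s0]" using idx_inj[OF word_singleton[OF s(2)] word_singleton[OF s0(1)]] by blast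
      then have ss: "s = s0" by simp
      note two = idx_two[OF s0(1) s(3) e g]
      have u: "0 \<le> idx [s'] (\<pi> i)" "idx [s'] (\<pi> i) < int N" using idx_range[OF word_singleton[OF s(3)], of "\<pi> i"] by auto
      have "idx b i = int N * (q + 1) + (if e i = 1 then idx [s'] (\<pi> i) else int N - 1 - idx [s'] (\<pi> i))"
        using two[of i] s0(2) by (simp add: s(1) ss)
      \<comment> \<open>Since \<open>c < int N * (q + 1)\<close>, a square of columns
        \<open>c\<close> or \<open>c + 1\<close> that lies in the generation-one column
        \<open>q + 1\<close> must lie in its first subcolumn.\<close>
      moreover have "idx b i \<le> int N * q + int N" using as qc by auto
      ultimately have 1: "idx [s'] (\<pi> i) = q'" using u by (auto simp: q'_def algebra_simps split: if_splits)
      have "idx b (other i) = int N * r0 + (if e (other i) = 1 then idx [s'] (other (\<pi> i)) else int N - 1 - idx [s'] (other (\<pi> i)))"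
        using two[of "other i"] s0(3) by (simp add: s(1) ss po)
      then have 2: "idx [s'] (other (\<pi> i)) = r2" using as by (auto simp: r'_def split: if_splits)
      show False using r2(3)[OF s(3)] 1 2 by blast
    qed
    moreover have "0 \<le> int N * r0 + r'" using r0 r' by simp
    moreover have "int N * r0 + r' < int N ^ 2"
    proof -
      have "int N * r0 \<le> int N * (int N - 1)" using r0(2) Np by (intro mult_left_mono) auto
      then show ?thesis using r'(2) by (simp add: power2_eq_square algebra_simps)
    qed
    ultimately show ?thesis by blast
  qed
qed

lemma cell_prefix_bounds:
  assumes "a \<in> T (k + j)" "x \<in> Kc a"
  shows "idx (take k a) i \<le> co k x i" "co k x i \<le> idx (take k a) i + 1"
proof -
  have "take k a \<in> T k" using words_take assms by blast
  moreover have "x \<in> W (take k a) ` square"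
    using cell_sub_take[OF assms(1)] assms(2) cell_square[OF \<open>take k a \<in> T k\<close>] by blast
  ultimately show "idx (take k a) i \<le> co k x i" "co k x i \<le> idx (take k a) i + 1"
    using W_square_eq by auto
qed

lemma touch_take_near:
  assumes "a \<in> T (k + j)" "b \<in> T (k + j)" "touch a b" shows "near (take k a) (take k b)"
proof -
  have "touch (take k a) (take k b)" using assms cell_sub_take[of a k j] cell_sub_take[of b k j] by blast
  then show ?thesis using touch_near[of "take k a" k "take k b"] words_take assms by blast
qed

text \<open>Otherwise the set lives in two adjacent columns of generation two, which share an empty
  row by \<open>gap_row_two\<close>. Its row index changes by at most one at each contact, so it
  cannot get past that row. Two columns that are further apart enclose a full strip, which gives
  \<open>t\<close>.\<close>

lemma gaps_transverse:
  assumes gaps: "gaps N S"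
    and cr: "cross i (2 + m) A"
  shows "\<exists>t. \<exists>a\<in>A. \<exists>b\<in>A. \<exists>x\<in>Kc a. \<exists>y\<in>Kc b. co 2 x (other i) \<le> real_of_int t \<and> real_of_int t + 1 \<le> co 2 y (other i)"
proof (rule ccontr)
  assume neg: "\<not> ?thesis"
  have A: "A \<subseteq> T (2 + m)" "conn A" using cr by (auto simp: cross_def)
  define col where "col a = idx (take 2 a) (other i)" for a
  define row where "row a = idx (take 2 a) i" for a
  have T2: "take 2 a \<in> T 2" if "a \<in> A" for a using that A words_take by blast
  have close: "col b \<le> col a + 1" if a: "a \<in> A" and b: "b \<in> A" for a b
  proof (rule ccontr)
    assume "\<not> ?thesis"
    then have far: "col a + 2 \<le> col b" by simp
    obtain x y where x: "x \<in> Kc a" and y: "y \<in> Kc b" using cell_nonempty by blast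
    have "co 2 x (other i) \<le> real_of_int (col a + 1)"
      using cell_prefix_bounds(2)[of a 2 m x "other i"] a A x by (auto simp: col_def)
    moreover have "real_of_int (col a + 1) + 1 \<le> co 2 y (other i)"
      using cell_prefix_bounds(1)[of b 2 m y "other i"] b A y far by (auto simp: col_def)
    ultimately show False using neg a b x y by blast
  qed
  obtain a1 x1 a2 x2 where a1: "a1 \<in> A" "x1 \<in> Kc a1" "x1 $ i = -1" and a2: "a2 \<in> A" "x2 \<in> Kc a2" "x2 $ i = 1"
    using cr unfolding cross_def by blast
  have fin: "finite (col ` A)" "col ` A \<noteq> {}" using cross_finite[OF cr] a1 by auto
  define c where "c = Min (col ` A)"
  have "c \<in> col ` A" unfolding c_def using fin by (rule Min_in)
  then obtain a0 where a0: "a0 \<in> A" "c = col a0" by blast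
  have cols: "col a \<in> {c, c + 1}" if "a \<in> A" for a
  proof -
    have "c \<le> col a" unfolding c_def using fin that by (intro Min_le) auto
    then show ?thesis using close[OF a0(1) that] a0(2) by auto
  qed
  have c: "0 \<le> c" "c < int N ^ 2" using idx_range[OF T2[OF a0(1)], of "other i"] a0(2) by (auto simp: col_def)
  obtain r where r: "0 \<le> r" "r < int N ^ 2" and
    emp: "\<And>b. b \<in> T 2 \<Longrightarrow> \<not> (idx b (other i) \<in> {c, c + 1} \<and> idx b i = r)"
    using gap_row_two[OF gaps c, of "other i"] by (auto simp del: insert_iff)
  have nr: "row a \<noteq> r" if "a \<in> A" for a
    using emp[OF T2[OF that]] cols[OF that] by (auto simp: col_def row_def)
  have "row a1 \<le> 0"
  proof -
    have "co 2 x1 i = 0" using a1(3) co_sides(1) by blast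
    then show ?thesis using cell_prefix_bounds(1)[of a1 2 m x1 i] a1 A by (auto simp: row_def)
  qed
  then have "row a1 < r" using nr[OF a1(1)] r(1) by linarith
  then have "row a2 < r"
  proof (rule conn_induct[OF A(2) a1(1) _ _ a2(1), of "\<lambda>a. row a < r"])
    fix u v assume uv: "u \<in> A" "v \<in> A" "touch u v" "row u < r"
    have "near (take 2 u) (take 2 v)" using touch_take_near[of u 2 m v] uv A by blast
    then have "\<bar>row v - row u\<bar> \<le> 1" by (simp add: near_def row_def)
    then show "row v < r" using uv nr[OF uv(2)] by linarith
  qed
  moreover have "int N ^ 2 \<le> row a2 + 1"
  proof -
    have e: "co 2 x2 i = real_of_int (int N ^ 2)" using a2(3) co_sides(2)[of x2 i 2] by simp
    have "co 2 x2 i \<le> real_of_int (row a2 + 1)"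
      using cell_prefix_bounds(2)[of a2 2 m x2 i] a2 A by (auto simp: row_def)
    then show ?thesis unfolding e by (rule of_int_le_iff[THEN iffD1])
  qed
  ultimately show False using r by linarith
qed

lemma cross_twice:
  assumes s: "s \<in> S" and cr: "cross i (2 + m) A" shows "cross i m (fold_word [s, s] ` A)"
proof -
  obtain a x b y where A: "A \<subseteq> T (2 + m)" "conn A" and
    x: "a \<in> A" "x \<in> Kc a" "x $ i = -1" and y: "b \<in> A" "y \<in> Kc b" "y $ i = 1"
    using cr unfolding cross_def by blast
  have "co 2 x i = 0" "co 2 y i = real N ^ 2" using x(3) y(3) co_sides by blast+
  moreover have "1 \<le> real N ^ 2" using N2 by (simp add: one_le_power)
  ultimately have "co 2 x i \<le> real_of_int 0" "real_of_int 0 + 1 \<le> co 2 y i" by simp_all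
  from fold_cross_twice[OF s A x(1,2) this(1) y(1,2) this(2)] show ?thesis .
qed

lemma modulus_twice:
  assumes tr: "\<And>s A. s \<in> S \<Longrightarrow> cross i (2 + m) A \<Longrightarrow> cross i' m (fold_word [s, s] ` A)"
  shows "modulus i (2 + m) \<le> 2 * real (card S) ^ 2 * modulus i' m"
proof -
  obtain s where s: "s \<in> S" using S_nonempty by blast
  have w: "[s, s] \<in> T 2" using s by (simp add: words_def)
  obtain \<rho> where \<rho>: "admissible i' m \<rho>" "mass m \<rho> \<le> 2 * modulus i' m" by (rule near_optimal)
  have nn: "0 \<le> \<rho> a" for a using \<rho> by (simp add: admissible_def)
  have "admissible i (2 + m) (\<lambda>a. \<rho> (fold_word [s, s] a))"
    unfolding admissible_def
  proof (intro conjI allI impI)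
    fix A assume c: "cross i (2 + m) A"
    have "1 \<le> sum \<rho> (fold_word [s, s] ` A)" using \<rho>(1) tr[OF s c] by (simp add: admissible_def)
    also have "\<dots> \<le> (\<Sum>a\<in>A. \<rho> (fold_word [s, s] a))"
      using cross_finite[OF c] nn by (rule sum_image_le_real)
    finally show "1 \<le> (\<Sum>a\<in>A. \<rho> (fold_word [s, s] a))" .
  qed (use nn in auto)
  then have "modulus i (2 + m) \<le> mass (2 + m) (\<lambda>a. \<rho> (fold_word [s, s] a))" by (rule modulus_le_mass)
  also have "\<dots> = real (card S) ^ 2 * mass m \<rho>" by (rule mass_fold_all[OF w])
  also have "\<dots> \<le> real (card S) ^ 2 * (2 * modulus i' m)" using \<rho>(2) by (intro mult_left_mono) auto
  finally show ?thesis by simp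
qed

lemma cross_sym_word:
  assumes g: "g \<in> cell_syms" and p: "\<And>x. g x $ i = e * x $ l" "e \<in> {1, -1}" and cr: "cross l m A"
  shows "cross i m (sym_word g ` A)"
proof -
  have A: "A \<subseteq> T m" "conn A" using cr by (auto simp: cross_def)
  have "conn (sym_word g ` A)"
  proof (rule conn_image[OF A(2)])
    fix a b assume "a \<in> A" "b \<in> A" "touch a b"
    then show "touch (sym_word g a) (sym_word g b)"
      using cell_sym_word[OF g, of a m] cell_sym_word[OF g, of b m] A by auto
  qed
  moreover have "sym_word g ` A \<subseteq> T m" using A sym_word_T[OF g] by blast
  moreover have side: "\<exists>a\<in>sym_word g ` A. \<exists>x\<in>Kc a. x $ i = c" if c: "c \<in> {1, -1}" for c
  proof -
    have "e * c = 1 \<or> e * c = -1" using p(2) c by auto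
    then have "\<exists>a\<in>A. \<exists>x\<in>Kc a. x $ l = e * c"
      using cr by (elim disjE) (simp_all add: cross_def)
    then obtain a x where ax: "a \<in> A" "x \<in> Kc a" "x $ l = e * c" by blast
    have "g x $ i = e * (e * c)" using p(1) ax(3) by simp
    also have "\<dots> = c" using p(2) by auto
    finally have "g x $ i = c" .
    moreover have "g x \<in> Kc (sym_word g a)" using cell_sym_word[OF g, of a m] ax A by auto
    ultimately show ?thesis using ax(1) by blast
  qed
  ultimately show ?thesis using side[of 1] side[of "-1"] by (simp add: cross_def)
qed

text \<open>The quarter turn is a symmetry of \<open>K\<close> interchanging the axes; it carries
  crossings of one direction to the other and preserves mass.\<close>

lemma rotation_modulus:
  assumes "rotation (pi / 2) \<in> cell_homeos K S f"
  shows "modulus i m = modulus i' m"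
proof -
  let ?g = "rotation (pi / 2)"
  have nth: "?g x $ k = (if k = 1 then -1 else 1) * x $ other k" for x k
    using exhaust_2[of k] by (auto simp: rotation_def other_def)
  have "?g \<in> square_symmetries"
  proof (rule signed_permutation_square_symmetry[where \<pi> = other and e = "\<lambda>k. if k = 1 then -1 else 1"])
    show "bij other" by (metis bij_betw_def inj_def other_other surjI)
  qed (auto simp: nth)
  moreover have "?g ` K = K" using assms by (auto simp: cell_homeos_def homeomorphism_def)
  ultimately have g: "?g \<in> cell_syms" by (simp add: cell_syms_def)
  have le: "modulus (other i) m \<le> modulus i m" for i
  proof -
    have "modulus (other i) m \<le> mass m \<rho>" if ad: "admissible i m \<rho>" for \<rho>
    proof -
      have nn: "0 \<le> \<rho> a" for a using ad by (simp add: admissible_def)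
      have "admissible (other i) m (\<lambda>a. \<rho> (sym_word ?g a))"
        unfolding admissible_def
      proof (intro conjI allI impI)
        fix A assume c: "cross (other i) m A"
        have "cross i m (sym_word ?g ` A)" by (rule cross_sym_word[OF g nth _ c]) auto
        then have "1 \<le> sum \<rho> (sym_word ?g ` A)" using ad by (simp add: admissible_def)
        also have "\<dots> \<le> (\<Sum>a\<in>A. \<rho> (sym_word ?g a))"
          using cross_finite[OF c] nn by (rule sum_image_le_real)
        finally show "1 \<le> (\<Sum>a\<in>A. \<rho> (sym_word ?g a))" .
      qed (use nn in auto)
      then have "modulus (other i) m \<le> mass m (\<lambda>a. \<rho> (sym_word ?g a))" by (rule modulus_le_mass)
      also have "\<dots> = mass m \<rho>" unfolding mass_def by (rule sum.reindex_bij_betw[OF sym_word_bij[OF g]])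
      finally show ?thesis .
    qed
    then show ?thesis unfolding modulus_def[of i]
      using admissible_one by (intro cInf_greatest) auto
  qed
  have "modulus (other i) m = modulus i m" for i using le[of i] le[of "other i"] by simp
  then show ?thesis using other_cases[of i' i] by auto
qed

text \<open>Folding through a doubled letter keeps the direction of a crossing. The rotation then
  makes the two directions equivalent, whereas gaps force every crossing to contain a transverse
  passage, which folds to a crossing of the other direction.\<close>

lemma modulus_compare: "modulus i (2 + m) \<le> 2 * real (card S) ^ 2 * modulus i' m"
proof -
  show ?thesis using rotation_or_gaps
  proof
    assume 1: "rotation (pi / 2) \<in> cell_homeos K S f"
    have "modulus i (2 + m) \<le> 2 * real (card S) ^ 2 * modulus i m"
      by (rule modulus_twice) (rule cross_twice)
    then show ?thesis using rotation_modulus[OF 1, of i m i'] by simp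
  next
    assume 2: "gaps N S"
    show ?thesis
    proof (rule modulus_twice)
      fix s A assume s: "s \<in> S" and cr: "cross i (2 + m) A"
      show "cross i' m (fold_word [s, s] ` A)"
      proof (cases "i' = i")
        case True
        then show ?thesis using cross_twice[OF s cr] by simp
      next
        case False
        then have i': "i' = other i" using other_cases by blast
        have A: "A \<subseteq> T (2 + m)" "conn A" using cr by (auto simp: cross_def)
        obtain t a b x y where "a \<in> A" "b \<in> A" "x \<in> Kc a" "y \<in> Kc b"
          "co 2 x (other i) \<le> real_of_int t" "real_of_int t + 1 \<le> co 2 y (other i)"
          using gaps_transverse[OF 2 cr] by blast
        then show ?thesis unfolding i' using fold_cross_twice[OF s A] by blast
      qed
    qed
  qed
qed

lemma max_modulus_compare: "max_modulus (2 + m) \<le> 2 * real (card S) ^ 2 * modulus i m"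
  by (rule max_modulus_le) (rule modulus_compare)

text \<open>A connected set of cells leaving the neighbourhood of \<open>u\<close> runs through a whole row or column next
  to \<open>u\<close>, and folding that part gives a crossing.\<close>

lemma escape_weight:
  assumes u: "u \<in> T k"
  obtains \<rho> where "\<And>a. 0 \<le> \<rho> a" "\<And>a. \<not> near u (take k a) \<Longrightarrow> \<rho> a = 0"
    "mass (k + j) \<rho> \<le> 9 * Cb * max_modulus j"
    "\<And>A a b. A \<subseteq> T (k + j) \<Longrightarrow> conn A \<Longrightarrow> a \<in> A \<Longrightarrow> take k a = u \<Longrightarrow> b \<in> A \<Longrightarrow> \<not> near u (take k b) \<Longrightarrow> 1 \<le> sum \<rho> A"
proof -
  obtain \<rho>b where \<rho>b: "\<And>a. 0 \<le> \<rho>b a" "\<And>i A. cross i j A \<Longrightarrow> 1 \<le> sum \<rho>b A" "mass j \<rho>b \<le> Cb * max_modulus j"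
    using near_optimal_both[of j] by blast
  define P where "P = {v \<in> T k. near u v}"
  define \<rho> where "\<rho> a = (if near u (take k a) then \<rho>b (fold_word u a) else 0)" for a
  show thesis
  proof (rule that[of \<rho>])
    show "0 \<le> \<rho> a" for a by (simp add: \<rho>_def \<rho>b)
    show "\<rho> a = 0" if "\<not> near u (take k a)" for a using that by (simp add: \<rho>_def)
    have "mass (k + j) \<rho> = (\<Sum>a\<in>T (k + j). if take k a \<in> P then \<rho>b (fold_word u a) powr p else 0)"
      unfolding mass_def by (rule sum.cong) (auto simp: \<rho>_def P_def words_take)
    also have "\<dots> = real (card P) * mass j \<rho>b" using mass_fold[OF u, of P] by (simp add: P_def)
    also have "\<dots> \<le> 9 * (Cb * max_modulus j)"
      using card_near[OF u] \<rho>b(3) mass_nonneg by (intro mult_mono) (auto simp: P_def)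
    finally show "mass (k + j) \<rho> \<le> 9 * Cb * max_modulus j" by simp
    fix A a b assume A: "A \<subseteq> T (k + j)" "conn A" and a: "a \<in> A" "take k a = u" and b: "b \<in> A" "\<not> near u (take k b)"
    define B where "B = {c \<in> A. near u (take k c)}"
    let ?R = "{(x, y). x \<in> B \<and> y \<in> B \<and> touch x y}"
    \<comment> \<open>As \<rho> vanishes outside the neighbourhood, only the part of
      \<open>A\<close> connected to \<open>a\<close> inside it is folded.\<close>
    define A' where "A' = {c. (a, c) \<in> ?R\<^sup>*}"
    have aB: "a \<in> B" using a near_refl by (simp add: B_def)
    have A'B: "A' \<subseteq> B"
    proof
      fix c assume "c \<in> A'"
      then have "(a, c) \<in> ?R\<^sup>*" by (simp add: A'_def)
      then show "c \<in> B" by induction (use aB in auto)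
    qed
    have aA': "a \<in> A'" by (simp add: A'_def)
    have connA': "conn A'"
    proof (rule conn_from[of _ a])
      fix c assume "c \<in> A'"
      then have "(a, c) \<in> ?R\<^sup>*" by (simp add: A'_def)
      then show "(a, c) \<in> {(x, y). x \<in> A' \<and> y \<in> A' \<and> touch x y}\<^sup>*"
      proof induction
        case (step y z)
        then have "(y, z) \<in> {(x, y). x \<in> A' \<and> y \<in> A' \<and> touch x y}"
          by (auto simp: A'_def intro: rtrancl_into_rtrancl)
        then show ?case using step.IH by (rule rtrancl_into_rtrancl[rotated])
      qed simp
    qed
    have "\<exists>c\<in>A'. \<exists>d\<in>A - B. touch c d"
    proof (rule ccontr)
      assume no: "\<not> ?thesis"
      have "b \<in> A'"
      proof (rule conn_induct[where P = "\<lambda>c. c \<in> A'", OF A(2) a(1) aA' _ b(1)])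
        fix x y assume xy: "x \<in> A" "y \<in> A" "touch x y" "x \<in> A'"
        then have "y \<in> B" using no by blast
        then have "(x, y) \<in> ?R" using xy A'B by auto
        then show "y \<in> A'" using xy(4) by (auto simp: A'_def intro: rtrancl_into_rtrancl)
      qed
      then show False using A'B b by (auto simp: B_def)
    qed
    then obtain c d where cd: "c \<in> A'" "d \<in> A" "d \<notin> B" "touch c d" by blast
    \<comment> \<open>The contact with the first cell outside. The point \<open>z\<close> still
      belongs to a cell of \<open>A'\<close>, yet it lies in a square at least two indices away from
      \<open>u\<close> along some axis, so a full strip separates it from \<open>u\<close>.\<close>
    then obtain z where z: "z \<in> Kc c" "z \<in> Kc d" by blast
    obtain x where x: "x \<in> Kc a" using cell_nonempty by blast
    have A'T: "A' \<subseteq> T (k + j)" using A'B A by (auto simp: B_def)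
    have "\<not> near u (take k d)" using cd by (simp add: B_def)
    then obtain i where i: "\<not> \<bar>idx (take k d) i - idx u i\<bar> \<le> 1" by (auto simp: near_def)
    have xb: "idx u i \<le> co k x i" "co k x i \<le> idx u i + 1"
      using cell_prefix_bounds[of a k j x i] a x A by auto
    have zb: "idx (take k d) i \<le> co k z i" "co k z i \<le> idx (take k d) i + 1"
      using cell_prefix_bounds[of d k j z i] cd z A by auto
    have "\<exists>l. cross l j (fold_word u ` A')"
    proof (cases "idx u i + 2 \<le> idx (take k d) i")
      case True
      have "co k x i \<le> real_of_int (idx u i + 1)" "real_of_int (idx u i + 1) + 1 \<le> co k z i"
        using xb zb True by linarith+
      from fold_cross[OF u A'T connA' aA' x this(1) cd(1) z(1) this(2)] show ?thesis .
    next
      case False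
      then have "idx (take k d) i + 2 \<le> idx u i" using i by linarith
      then have "co k z i \<le> real_of_int (idx u i - 1)" "real_of_int (idx u i - 1) + 1 \<le> co k x i"
        using xb zb by linarith+
      from fold_cross[OF u A'T connA' cd(1) z(1) this(1) aA' x this(2)] show ?thesis .
    qed
    then have "1 \<le> sum \<rho>b (fold_word u ` A')" using \<rho>b(2) by blast
    also have "\<dots> \<le> (\<Sum>c\<in>A'. \<rho>b (fold_word u c))"
      using A'T finite_T finite_subset \<rho>b(1) by (intro sum_image_le_real) blast+
    also have "\<dots> = sum \<rho> A'" using A'B by (intro sum.cong) (auto simp: \<rho>_def B_def)
    also have "\<dots> \<le> sum \<rho> A"
    proof (rule sum_mono2)
      show "finite A" using A finite_T finite_subset by blast
      show "A' \<subseteq> A" using A'B by (auto simp: B_def)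
    qed (simp add: \<rho>_def \<rho>b)
    finally show "1 \<le> sum \<rho> A" .
  qed
qed

section \<open>Submultiplicativity of the moduli\<close>

lemma card_near': assumes "w \<in> T n" shows "card {v \<in> T n. near v w} \<le> 9"
  using card_near[OF assms] near_sym[of w] by simp

text \<open>The factor \<open>9 powr p\<close> stands for the overlap of nine escape weights at a
  cell, \<open>9 * Cb\<close> for the mass of each, and 2 for the nearly optimal coarse
  weight.\<close>

definition Cm :: real where "Cm = 9 powr p * 9 * Cb * 2"

lemma Cm_pos: "Cm > 0" using Cb_pos by (simp add: Cm_def)

lemma cross_take:
  assumes "cross i (k + j) A" shows "cross i k (take k ` A)"
proof -
  have A: "A \<subseteq> T (k + j)" "conn A" using assms by (auto simp: cross_def)
  have sub: "Kc a \<subseteq> Kc (take k a)" if "a \<in> A" for a using that A cell_sub_take by blast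
  have "conn (take k ` A)"
    by (rule conn_image[OF A(2)]) (use sub in blast)
  moreover have "take k ` A \<subseteq> T k" using A words_take by blast
  moreover have "\<exists>a\<in>take k ` A. \<exists>x\<in>Kc a. x $ i = c" if "\<exists>a\<in>A. \<exists>x\<in>Kc a. x $ i = c" for c
    using that sub by blast
  ultimately show ?thesis using assms by (simp add: cross_def)
qed

text \<open>A product construction: each value of a nearly optimal coarse weight \<tau> is spread by
  an escape weight around its square. A crossing visits the squares of a coarse crossing and leaves
  the neighbourhood of each, since a neighbourhood spans only three indices while
  \<open>4 \<le> N ^ k\<close>.\<close>

lemma modulus_mult:
  assumes k: "4 \<le> N ^ k"
  shows "modulus i (k + j) \<le> Cm * modulus i k * max_modulus j"
proof -
  obtain \<tau> where \<tau>: "admissible i k \<tau>" "mass k \<tau> \<le> 2 * modulus i k" by (rule near_optimal)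
  have \<tau>0: "0 \<le> \<tau> a" for a using \<tau> by (simp add: admissible_def)
  define good where "good u \<rho> \<longleftrightarrow> (\<forall>a. 0 \<le> \<rho> a) \<and> (\<forall>a. \<not> near u (take k a) \<longrightarrow> \<rho> a = 0) \<and>
    mass (k + j) \<rho> \<le> 9 * Cb * max_modulus j \<and>
    (\<forall>A a b. A \<subseteq> T (k + j) \<longrightarrow> conn A \<longrightarrow> a \<in> A \<longrightarrow> take k a = u \<longrightarrow> b \<in> A \<longrightarrow> \<not> near u (take k b) \<longrightarrow> 1 \<le> sum \<rho> A)"
    for u and \<rho> :: "(nat \<times> nat) list \<Rightarrow> real"
  have "\<forall>u\<in>T k. \<exists>\<rho>. good u \<rho>"
  proof
    fix u assume "u \<in> T k"
    then obtain \<rho> where "\<And>a. 0 \<le> \<rho> a" "\<And>a. \<not> near u (take k a) \<Longrightarrow> \<rho> a = 0"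
      "mass (k + j) \<rho> \<le> 9 * Cb * max_modulus j"
      "\<And>A a b. A \<subseteq> T (k + j) \<Longrightarrow> conn A \<Longrightarrow> a \<in> A \<Longrightarrow> take k a = u \<Longrightarrow> b \<in> A \<Longrightarrow> \<not> near u (take k b) \<Longrightarrow> 1 \<le> sum \<rho> A"
      by (rule escape_weight[where j = j]) blast
    then have "good u \<rho>" unfolding good_def by blast
    then show "\<exists>\<rho>. good u \<rho>" by blast
  qed
  then obtain R where R: "\<And>u. u \<in> T k \<Longrightarrow> good u (R u)" by metis
  have R0: "0 \<le> R u a" if "u \<in> T k" for u a using R[OF that] by (simp add: good_def)
  define \<rho> where "\<rho> a = (\<Sum>u\<in>T k. \<tau> u * R u a)" for a
  have "admissible i (k + j) \<rho>" unfolding admissible_def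
  proof (intro conjI allI impI)
    show "0 \<le> \<rho> a" for a unfolding \<rho>_def by (intro sum_nonneg mult_nonneg_nonneg \<tau>0 R0)
    fix A assume cr: "cross i (k + j) A"
    then obtain a1 x1 a2 x2 where A: "A \<subseteq> T (k + j)" "conn A" and a1: "a1 \<in> A" "x1 \<in> Kc a1" "x1 $ i = -1"
      and a2: "a2 \<in> A" "x2 \<in> Kc a2" "x2 $ i = 1"
      unfolding cross_def by blast
    have fA: "finite A" using cross_finite[OF cr] .
    have x1: "co k x1 i = 0" using a1(3) co_sides(1) by blast
    have x2: "co k x2 i = real_of_int (int N ^ k)" using a2(3) co_sides(2)[of x2 i k] by simp
    have i1: "idx (take k a1) i \<le> 0" using cell_prefix_bounds(1)[of a1 k j x1 i] a1 A x1 by auto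
    have "co k x2 i \<le> real_of_int (idx (take k a2) i + 1)"
      using cell_prefix_bounds(2)[of a2 k j x2 i] a2 A by auto
    then have i2: "int N ^ k \<le> idx (take k a2) i + 1" unfolding x2 using of_int_le_iff by blast
    have N4: "4 \<le> int N ^ k" using k by (metis of_nat_le_iff of_nat_numeral of_nat_power)
    have exit: "\<exists>b\<in>A. \<not> near u (take k b)" for u
    proof (rule ccontr)
      assume "\<not> ?thesis"
      then have "near u (take k a1)" "near u (take k a2)" using a1 a2 by auto
      then have "\<bar>idx (take k a1) i - idx u i\<bar> \<le> 1" "\<bar>idx (take k a2) i - idx u i\<bar> \<le> 1"
        by (simp_all add: near_def)
      then show False using i1 i2 N4 by linarith
    qed
    have Tk: "take k ` A \<subseteq> T k" using A words_take by blast
    have "1 \<le> sum \<tau> (take k ` A)" using \<tau>(1) cross_take[OF cr] by (simp add: admissible_def)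
    also have "\<dots> \<le> (\<Sum>u\<in>take k ` A. \<tau> u * sum (R u) A)"
    proof (rule sum_mono)
      fix u assume u: "u \<in> take k ` A"
      then obtain a where a: "a \<in> A" "take k a = u" by blast
      obtain b where b: "b \<in> A" "\<not> near u (take k b)" using exit by blast
      have "u \<in> T k" using u Tk by blast
      then have "1 \<le> sum (R u) A" using R[of u] A a b unfolding good_def by blast
      then show "\<tau> u \<le> \<tau> u * sum (R u) A" using \<tau>0[of u] mult_left_mono[of 1 "sum (R u) A" "\<tau> u"] by simp
    qed
    also have "\<dots> \<le> (\<Sum>u\<in>T k. \<tau> u * sum (R u) A)"
      using Tk finite_T by (intro sum_mono2 mult_nonneg_nonneg sum_nonneg \<tau>0 R0) auto
    also have "\<dots> = sum \<rho> A" unfolding \<rho>_def sum_distrib_left by (rule sum.swap)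
    finally show "1 \<le> sum \<rho> A" .
  qed
  then have "modulus i (k + j) \<le> mass (k + j) \<rho>" by (rule modulus_le_mass)
  also have "\<dots> \<le> (\<Sum>a\<in>T (k + j). 9 powr p * (\<Sum>u\<in>T k. \<tau> u powr p * R u a powr p))"
    unfolding mass_def
  proof (rule sum_mono)
    fix a assume a: "a \<in> T (k + j)"
    define X where "X = {u \<in> T k. near u (take k a)}"
    have cX: "card X \<le> 9" using card_near'[OF words_take[OF a]] by (simp add: X_def)
    have fX: "finite X" "X \<subseteq> T k" using finite_T by (auto simp: X_def)
    have nn: "0 \<le> \<tau> u * R u a" if "u \<in> X" for u
      using \<tau>0 R0 that fX(2) by (intro mult_nonneg_nonneg) auto
    \<comment> \<open>Escape weights vanish away from their squares, so at most nine terms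
      contribute and no factor \<open>card (T k)\<close> arises.\<close>
    have "\<rho> a = (\<Sum>u\<in>X. \<tau> u * R u a)" unfolding \<rho>_def
      using finite_T R by (intro sum.mono_neutral_right) (auto simp: X_def good_def)
    then have "\<rho> a powr p \<le> real (card X) powr p * (\<Sum>u\<in>X. (\<tau> u * R u a) powr p)"
      using sum_powr_le[OF fX(1) nn p_pos] by simp
    also have "\<dots> \<le> 9 powr p * (\<Sum>u\<in>X. (\<tau> u * R u a) powr p)"
      using cX p_pos by (intro mult_right_mono powr_mono2 sum_nonneg) auto
    also have "(\<Sum>u\<in>X. (\<tau> u * R u a) powr p) \<le> (\<Sum>u\<in>T k. \<tau> u powr p * R u a powr p)"
      using fX finite_T \<tau>0 R0 by (subst sum.cong[OF refl powr_mult]) (auto intro!: sum_mono2)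
    finally show "\<rho> a powr p \<le> 9 powr p * (\<Sum>u\<in>T k. \<tau> u powr p * R u a powr p)" by simp
  qed
  also have "\<dots> = 9 powr p * (\<Sum>u\<in>T k. \<tau> u powr p * mass (k + j) (R u))"
    unfolding mass_def sum_distrib_left[symmetric] by (subst sum.swap) (simp add: sum_distrib_left)
  also have "\<dots> \<le> 9 powr p * (\<Sum>u\<in>T k. \<tau> u powr p * (9 * Cb * max_modulus j))"
    using R by (intro mult_left_mono sum_mono) (auto simp: good_def)
  also have "\<dots> = 9 powr p * (9 * Cb * max_modulus j) * mass k \<tau>"
    by (simp add: mass_def sum_distrib_left sum_distrib_right mult_ac)
  also have "\<dots> \<le> 9 powr p * (9 * Cb * max_modulus j) * (2 * modulus i k)"
    using \<tau>(2) Cb_pos max_modulus_pos[of j] by (intro mult_left_mono) auto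
  finally show ?thesis by (simp add: Cm_def mult_ac)
qed

lemma max_modulus_mult:
  assumes k: "4 \<le> N ^ k"
  shows "max_modulus (k + j) \<le> Cm * max_modulus k * max_modulus j"
proof (rule max_modulus_le)
  fix i
  have "modulus i (k + j) \<le> Cm * modulus i k * max_modulus j" by (rule modulus_mult[OF k])
  also have "\<dots> \<le> Cm * max_modulus k * max_modulus j"
    using Cm_pos max_modulus_pos[of j] modulus_max[of i k] by (intro mult_right_mono mult_left_mono) auto
  finally show "modulus i (k + j) \<le> Cm * max_modulus k * max_modulus j" .
qed

section \<open>Conductance\<close>

abbreviation en :: "nat \<Rightarrow> (nat \<times> nat) list set \<Rightarrow> ((nat \<times> nat) list \<Rightarrow> real) \<Rightarrow> real" where
  "en n A h \<equiv> energy K S f p n A h"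

lemma energy_nonneg: "0 \<le> en n A h"
  unfolding energy_def by (auto intro!: sum_nonneg)

text \<open>An edge is charged to its two ends and each cell has at most nine near cells; counting
  both ends is offset by the factor 1/2 in the energy.\<close>

lemma energy_le_mass:
  assumes "\<And>a b. a \<in> T n \<Longrightarrow> b \<in> T n \<Longrightarrow> touch a b \<Longrightarrow> \<bar>h a - h b\<bar> \<le> max (\<rho> a) (\<rho> b)" and \<rho>: "\<And>a. 0 \<le> \<rho> a"
  shows "en n (T n) h \<le> 9 * mass n \<rho>"
proof -
  define G where "G = (SIGMA a : T n. {b \<in> T n. near a b})"
  have fG: "finite G" unfolding G_def using finite_T by (intro finite_SigmaI) auto
  have sub: "meet_edges K S f n \<inter> T n \<times> T n \<subseteq> G"
  proof clarify
    fix a b assume "(a, b) \<in> meet_edges K S f n" "a \<in> T n" "b \<in> T n"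
    then show "(a, b) \<in> G" using touch_near[of a n b] by (simp add: G_def meet_edges_def)
  qed
  have "(\<Sum>(a, b) \<in> meet_edges K S f n \<inter> T n \<times> T n. \<bar>h a - h b\<bar> powr p)
    \<le> (\<Sum>(a, b) \<in> meet_edges K S f n \<inter> T n \<times> T n. \<rho> a powr p + \<rho> b powr p)"
  proof (intro sum_mono, clarify)
    fix a b assume "(a, b) \<in> meet_edges K S f n" "a \<in> T n" "b \<in> T n"
    then have "\<bar>h a - h b\<bar> \<le> max (\<rho> a) (\<rho> b)" using assms(1) by (simp add: meet_edges_def)
    then have "\<bar>h a - h b\<bar> powr p \<le> max (\<rho> a) (\<rho> b) powr p" using p_pos by (intro powr_mono2) auto
    also have "\<dots> \<le> \<rho> a powr p + \<rho> b powr p" by (auto simp: max_def)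
    finally show "\<bar>h a - h b\<bar> powr p \<le> \<rho> a powr p + \<rho> b powr p" .
  qed
  also have "\<dots> \<le> (\<Sum>(a, b) \<in> G. \<rho> a powr p + \<rho> b powr p)"
    using fG sub by (intro sum_mono2) auto
  also have "\<dots> = (\<Sum>(a, b) \<in> G. \<rho> a powr p) + (\<Sum>(a, b) \<in> G. \<rho> b powr p)"
    by (simp add: sum.distrib case_prod_unfold)
  also have "(\<Sum>(a, b) \<in> G. \<rho> b powr p) = (\<Sum>(a, b) \<in> G. \<rho> a powr p)"
    by (rule sum.reindex_bij_witness[of _ prod.swap prod.swap]) (auto simp: G_def near_sym)
  finally have 1: "(\<Sum>(a, b) \<in> meet_edges K S f n \<inter> T n \<times> T n. \<bar>h a - h b\<bar> powr p)
    \<le> 2 * (\<Sum>(a, b) \<in> G. \<rho> a powr p)" by simp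
  have "(\<Sum>(a, b) \<in> G. \<rho> a powr p) = (\<Sum>a\<in>T n. \<Sum>b\<in>{b \<in> T n. near a b}. \<rho> a powr p)"
    unfolding G_def using finite_T by (subst sum.Sigma) auto
  also have "\<dots> \<le> (\<Sum>a\<in>T n. 9 * \<rho> a powr p)"
  proof (rule sum_mono)
    fix a assume "a \<in> T n"
    then have "real (card {b \<in> T n. near a b}) \<le> 9" using card_near by fastforce
    then show "(\<Sum>b\<in>{b \<in> T n. near a b}. \<rho> a powr p) \<le> 9 * \<rho> a powr p" by (simp add: mult_right_mono)
  qed
  also have "\<dots> = 9 * mass n \<rho>" by (simp add: mass_def sum_distrib_left)
  finally show ?thesis using 1 by (simp add: energy_def)
qed

text \<open>The potential of the escape weight: the least weight spent on the way from
  \<open>a\<close> out of the neighbourhood. Adding a touching cell to a set raises its weight by at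
  most the value of \<rho> there, so \<rho> acts as an upper gradient.\<close>

lemma cutoff_function:
  assumes u: "u \<in> T k"
  obtains h where "\<And>a. a \<in> T (k + j) \<Longrightarrow> take k a = u \<Longrightarrow> h a = 1"
    "\<And>a. a \<in> T (k + j) \<Longrightarrow> \<not> near u (take k a) \<Longrightarrow> h a = 0"
    "\<And>a. a \<in> T (k + j) \<Longrightarrow> 0 \<le> h a"
    "en (k + j) (T (k + j)) h \<le> 81 * Cb * max_modulus j"
proof -
  obtain \<rho> where \<rho>: "\<And>a. 0 \<le> \<rho> a" "\<And>a. \<not> near u (take k a) \<Longrightarrow> \<rho> a = 0"
    "mass (k + j) \<rho> \<le> 9 * Cb * max_modulus j"
    "\<And>A a b. A \<subseteq> T (k + j) \<Longrightarrow> conn A \<Longrightarrow> a \<in> A \<Longrightarrow> take k a = u \<Longrightarrow> b \<in> A \<Longrightarrow> \<not> near u (take k b) \<Longrightarrow> 1 \<le> sum \<rho> A"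
    by (rule escape_weight[OF u, where j = j]) blast
  define far where "far A \<longleftrightarrow> (\<exists>b\<in>A. \<not> near u (take k b))" for A
  \<comment> \<open>Sets that stay inside cost 1, so the minimum makes sense even if no set leaves
    the neighbourhood, and the cap at 1 is built in.\<close>
  define cost where "cost A = (if far A then min 1 (sum \<rho> A) else 1)" for A
  define F where "F a = {A. A \<subseteq> T (k + j) \<and> conn A \<and> a \<in> A}" for a
  define h where "h a = Min (cost ` F a)" for a
  have fin: "finite (cost ` F a)" for a
    by (rule finite_imageI, rule finite_subset[of _ "Pow (T (k + j))"]) (auto simp: F_def finite_T)
  have sing: "{a} \<in> F a" if "a \<in> T (k + j)" for a using that conn_singleton by (simp add: F_def)
  have h_le: "h a \<le> cost A" if "A \<in> F a" for a A unfolding h_def using fin that by (intro Min_le) auto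
  have h_eq: "\<exists>A\<in>F a. h a = cost A" if "a \<in> T (k + j)" for a
    using Min_in[OF fin, of a] sing[OF that] unfolding h_def by blast
  have cost0: "0 \<le> cost A" for A using \<rho>(1) by (simp add: cost_def sum_nonneg)
  have cost1: "cost A \<le> 1" for A by (simp add: cost_def)
  have step: "h b \<le> h a + \<rho> b" if a: "a \<in> T (k + j)" and b: "b \<in> T (k + j)" and t: "touch a b" for a b
  proof -
    obtain A where A: "A \<in> F a" "h a = cost A" using h_eq[OF a] by blast
    have fA: "finite A" using A(1) finite_T finite_subset by (auto simp: F_def)
    have "insert b A \<in> F b" using A(1) b conn_insert[of A a b] t by (auto simp: F_def)
    then have "h b \<le> cost (insert b A)" by (rule h_le)
    also have "\<dots> \<le> cost A + \<rho> b"
    proof (cases "far A")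
      case True
      then have "far (insert b A)" by (auto simp: far_def)
      moreover have "sum \<rho> (insert b A) \<le> sum \<rho> A + \<rho> b"
        using fA \<rho>(1) by (cases "b \<in> A") (auto simp: insert_absorb)
      ultimately show ?thesis using True \<rho>(1)[of b] by (simp add: cost_def min_def)
    next
      case False
      then have "cost A = 1" by (simp add: cost_def)
      then show ?thesis using cost1[of "insert b A"] \<rho>(1)[of b] by simp
    qed
    finally show ?thesis using A(2) by simp
  qed
  show thesis
  proof (rule that[of h])
    fix a assume a: "a \<in> T (k + j)"
    show "0 \<le> h a" using h_eq[OF a] cost0 by auto
    show "h a = 1" if ta: "take k a = u"
    proof -
      obtain A where A: "A \<in> F a" "h a = cost A" using h_eq[OF a] by blast
      have "cost A = 1"
      proof (cases "far A")
        case True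
        then obtain b where "b \<in> A" "\<not> near u (take k b)" by (auto simp: far_def)
        then have "1 \<le> sum \<rho> A" using \<rho>(4)[of A a b] A(1) ta by (simp add: F_def)
        then show ?thesis by (simp add: cost_def)
      qed (simp add: cost_def)
      then show ?thesis using A(2) by simp
    qed
    show "h a = 0" if na: "\<not> near u (take k a)"
    proof -
      have "h a \<le> cost {a}" by (rule h_le[OF sing[OF a]])
      also have "\<dots> = 0" using \<rho>(2)[OF na] na by (simp add: cost_def far_def)
      finally show ?thesis using h_eq[OF a] cost0 by (metis order_antisym)
    qed
  next
    have "en (k + j) (T (k + j)) h \<le> 9 * mass (k + j) \<rho>"
    proof (rule energy_le_mass)
      fix a b assume ab: "a \<in> T (k + j)" "b \<in> T (k + j)" "touch a b"
      have "h b \<le> h a + \<rho> b" "h a \<le> h b + \<rho> a" using step ab touch_sym[OF ab(3)] by blast+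
      then show "\<bar>h a - h b\<bar> \<le> max (\<rho> a) (\<rho> b)" by linarith
    qed (rule \<rho>(1))
    then show "en (k + j) (T (k + j)) h \<le> 81 * Cb * max_modulus j" using \<rho>(3) by simp
  qed
qed

lemma energy_min_sum:
  assumes X: "finite X"
  shows "en n (T n) (\<lambda>a. min 1 (\<Sum>x\<in>X. h x a)) \<le> real (card X) powr p * (\<Sum>x\<in>X. en n (T n) (h x))"
proof -
  let ?E = "meet_edges K S f n \<inter> T n \<times> T n"
  have "(\<Sum>(a, b)\<in>?E. \<bar>min 1 (\<Sum>x\<in>X. h x a) - min 1 (\<Sum>x\<in>X. h x b)\<bar> powr p)
    \<le> (\<Sum>(a, b)\<in>?E. real (card X) powr p * (\<Sum>x\<in>X. \<bar>h x a - h x b\<bar> powr p))"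
  proof (intro sum_mono, clarify)
    fix a b
    have "\<bar>min 1 (\<Sum>x\<in>X. h x a) - min 1 (\<Sum>x\<in>X. h x b)\<bar> \<le> \<bar>(\<Sum>x\<in>X. h x a) - (\<Sum>x\<in>X. h x b)\<bar>" by linarith
    also have "\<dots> \<le> (\<Sum>x\<in>X. \<bar>h x a - h x b\<bar>)" by (simp add: sum_subtractf[symmetric])
    finally have "\<bar>min 1 (\<Sum>x\<in>X. h x a) - min 1 (\<Sum>x\<in>X. h x b)\<bar> powr p \<le> (\<Sum>x\<in>X. \<bar>h x a - h x b\<bar>) powr p"
      using p_pos by (intro powr_mono2) auto
    also have "\<dots> \<le> real (card X) powr p * (\<Sum>x\<in>X. \<bar>h x a - h x b\<bar> powr p)"
      using X p_pos by (intro sum_powr_le) auto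
    finally show "\<bar>min 1 (\<Sum>x\<in>X. h x a) - min 1 (\<Sum>x\<in>X. h x b)\<bar> powr p \<le> real (card X) powr p * (\<Sum>x\<in>X. \<bar>h x a - h x b\<bar> powr p)" .
  qed
  also have "\<dots> = real (card X) powr p * (\<Sum>x\<in>X. \<Sum>(a, b)\<in>?E. \<bar>h x a - h x b\<bar> powr p)"
    unfolding case_prod_unfold sum_distrib_left[symmetric] by (subst sum.swap) simp
  finally show ?thesis
    by (simp add: energy_def sum_divide_distrib[symmetric])
qed

section \<open>From near squares to touching cells\<close>

lemma separated_finite:
  assumes "finite F" "\<And>J. J \<in> F \<Longrightarrow> \<exists>d>0. \<forall>d'. d' \<le> d \<longrightarrow> P J (d' :: real)"
  shows "\<exists>d>0. \<forall>J\<in>F. P J d"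
proof -
  have "\<exists>d>0. \<forall>d'\<le>d. \<forall>J\<in>F. P J d'"
    using assms
  proof (induction F)
    case empty
    show ?case by (intro exI[of _ 1]) simp
  next
    case (insert J F)
    obtain d1 where "d1 > 0" "\<forall>d'\<le>d1. \<forall>J\<in>F. P J d'" using insert.IH insert.prems by auto
    moreover obtain d2 where "d2 > 0" "\<forall>d'. d' \<le> d2 \<longrightarrow> P J d'" using insert.prems by auto
    ultimately show ?case by (intro exI[of _ "min d1 d2"]) auto
  qed
  then show ?thesis by blast
qed

text \<open>Up to scaling there are finitely many configurations of two neighbouring squares.\<close>

lemma untouched_separation:
  "\<exists>\<delta>>0. \<forall>n. \<forall>w\<in>T n. \<forall>v\<in>T n. near w v \<longrightarrow> \<not> touch w v \<longrightarrow>
     (\<forall>x\<in>Kc w. \<forall>y\<in>Kc v. \<delta> \<le> real N ^ n * dist x y)"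
proof -
  \<comment> \<open>Rescaled by \<open>N ^ n\<close>, the squares have side 2, so the offset of a
    neighbour is twice an integer vector.\<close>
  define Z where "Z = (\<lambda>z. (\<chi> i. 2 * of_int (z i)) :: real^2) ` {z :: 2 \<Rightarrow> int. \<forall>i. \<bar>z i\<bar> \<le> 1}"
  define F where "F = square_symmetries \<times> square_symmetries \<times> Z"
  have "finite Z" using card_int_box(1)[of 1 "\<lambda>_. 0"] by (simp add: Z_def)
  then have "finite F" using finite_square_symmetries by (simp add: F_def)
  define P where "P = (\<lambda>(\<Phi> :: real^2 \<Rightarrow> real^2, \<Psi> :: real^2 \<Rightarrow> real^2, \<zeta> :: real^2) (d :: real). \<Phi> ` K \<inter> (\<lambda>y. \<Psi> y + \<zeta>) ` K = {} \<longrightarrow> (\<forall>x\<in>K. \<forall>y\<in>K. d \<le> dist (\<Phi> x) (\<Psi> y + \<zeta>)))"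
  have "\<exists>\<delta>>0. \<forall>J\<in>F. P J \<delta>"
  proof (rule separated_finite[OF \<open>finite F\<close>])
    fix J assume "J \<in> F"
    then obtain \<Phi> \<Psi> \<zeta> where J: "J = (\<Phi>, \<Psi>, \<zeta>)" "\<Phi> \<in> square_symmetries" "\<Psi> \<in> square_symmetries"
      by (auto simp: F_def)
    show "\<exists>d>0. \<forall>d'. d' \<le> d \<longrightarrow> P J d'"
    proof (cases "\<Phi> ` K \<inter> (\<lambda>y. \<Psi> y + \<zeta>) ` K = {}")
      case True
      have "compact (\<Phi> ` K)" "compact ((\<lambda>y. \<Psi> y + \<zeta>) ` K)"
        by (rule compact_continuous_image[OF square_symmetries_continuous[OF J(2)] K_compact],
            rule compact_continuous_image[OF continuous_on_add[OF square_symmetries_continuous[OF J(3)] continuous_on_const] K_compact])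
      then obtain d where "d > 0" "\<forall>x\<in>\<Phi> ` K. \<forall>y\<in>(\<lambda>y. \<Psi> y + \<zeta>) ` K. d \<le> dist x y"
        using separate_compact_closed[of "\<Phi> ` K" "(\<lambda>y. \<Psi> y + \<zeta>) ` K"] True compact_imp_closed by blast
      then show ?thesis by (intro exI[of _ d]) (force simp: J P_def)
    next
      case False
      then show ?thesis by (intro exI[of _ 1]) (auto simp: J P_def)
    qed
  qed
  then obtain \<delta> where \<delta>: "\<delta> > 0" "\<And>J. J \<in> F \<Longrightarrow> P J \<delta>" by blast
  show ?thesis
  proof (intro exI[of _ \<delta>] conjI allI ballI impI)
    fix n w v x y assume w: "w \<in> T n" and v: "v \<in> T n" and nr: "near w v" and nt: "\<not> touch w v"
      and x: "x \<in> Kc w" and y: "y \<in> Kc v"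
    define z where "z i = idx v i - idx w i" for i
    define \<zeta> :: "real^2" where "\<zeta> = (\<chi> i. 2 * of_int (z i))"
    have "z \<in> {z. \<forall>i. \<bar>z i\<bar> \<le> 1}" using nr by (simp add: near_def z_def)
    then have "\<zeta> \<in> Z" unfolding Z_def \<zeta>_def by (intro image_eqI[of _ _ z] refl)
    then have J: "(lin w, lin v, \<zeta>) \<in> F" using lin_sym w v by (auto simp: F_def)
    have diff: "W w a - W v b = (1 / real N ^ n) *\<^sub>R (lin w a - (lin v b + \<zeta>))" for a b
      using Npow_pos[of n] by (simp add: vec_eq_iff W_nth[OF w] W_nth[OF v] \<zeta>_def z_def field_simps)
    have dst: "dist (W w a) (W v b) = dist (lin w a) (lin v b + \<zeta>) / real N ^ n" for a b
      using Npow_pos[of n] by (simp add: dist_norm diff)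
    have "lin w ` K \<inter> (\<lambda>y. lin v y + \<zeta>) ` K = {}"
    proof (rule ccontr)
      assume "\<not> ?thesis"
      then obtain a b where ab: "a \<in> K" "b \<in> K" "lin w a = lin v b + \<zeta>" by auto
      then have "W w a = W v b" using dst[of a b] by simp
      then show False using nt ab by (auto simp: cell_def)
    qed
    moreover obtain a b where "a \<in> K" "b \<in> K" "x = W w a" "y = W v b" using x y by (auto simp: cell_def)
    ultimately show "\<delta> \<le> real N ^ n * dist x y"
      using \<delta>(2)[OF J] Npow_pos[of n] by (auto simp: P_def dst)
  qed (rule \<delta>(1))
qed

text \<open>Cutoff functions are supported on near squares, whereas the conductance asks for
  functions vanishing off the touching cells. Disjoint cells in near squares have a distance bounded
  below at their own scale, so their subcells cease to be near after \<open>k\<close> further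
  generations.\<close>

lemma untouched_not_near:
  "\<exists>k. \<forall>n. \<forall>w\<in>T n. \<forall>v\<in>T n. \<not> touch w v \<longrightarrow> (\<forall>u\<in>T k. \<forall>u'\<in>T k. \<not> near (w @ u) (v @ u'))"
proof -
  obtain \<delta> where \<delta>: "\<delta> > 0" and sep: "\<And>n w v x y. w \<in> T n \<Longrightarrow> v \<in> T n \<Longrightarrow> near w v \<Longrightarrow> \<not> touch w v \<Longrightarrow>
     x \<in> Kc w \<Longrightarrow> y \<in> Kc v \<Longrightarrow> \<delta> \<le> real N ^ n * dist x y"
    using untouched_separation by blast
  have "1 < real N" using N2 by simp
  \<comment> \<open>The 3 takes care of squares that are not near to begin with, the other term of
    near squares whose cells are separated by \<delta>.\<close>
  then obtain k where "max 3 (8 / \<delta> + 1) < real N ^ k" using real_arch_pow by blast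
  then have k: "max 3 (8 / \<delta> + 1) \<le> real N ^ k" by simp
  have k3: "3 \<le> real N ^ k" and k8: "8 / \<delta> + 1 \<le> real N ^ k" using k by auto
  show ?thesis
  proof (intro exI[of _ k] allI ballI impI notI)
    fix n w v u u' assume w: "w \<in> T n" and v: "v \<in> T n" and nt: "\<not> touch w v"
      and u: "u \<in> T k" and u': "u' \<in> T k" and nr: "near (w @ u) (v @ u')"
    have wu: "w @ u \<in> T (n + k)" and vu: "v @ u' \<in> T (n + k)" using w v u u' words_append_iff by blast+
    have tk: "take n (w @ u) = w" "take n (v @ u') = v" using w v by (auto simp: words_def)
    obtain x y where x: "x \<in> Kc (w @ u)" and y: "y \<in> Kc (v @ u')" using cell_nonempty by blast
    have xw: "x \<in> Kc w" and yv: "y \<in> Kc v" using x y cell_sub_take[OF wu] cell_sub_take[OF vu] tk by auto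
    have close: "\<bar>co (n + k) x i - co (n + k) y i\<bar> \<le> 2" for i
    proof -
      have "idx (w @ u) i \<le> co (n + k) x i" "co (n + k) x i \<le> idx (w @ u) i + 1"
        "idx (v @ u') i \<le> co (n + k) y i" "co (n + k) y i \<le> idx (v @ u') i + 1"
        using cell_prefix_bounds[of "w @ u" "n + k" 0 x i] cell_prefix_bounds[of "v @ u'" "n + k" 0 y i] wu vu x y
        by (auto simp: words_def)
      moreover have "\<bar>idx (v @ u') i - idx (w @ u) i\<bar> \<le> 1" using nr by (simp add: near_def)
      ultimately show ?thesis by linarith
    qed
    show False
    proof (cases "near w v")
      case True
      have cl: "\<bar>(x - y) $ i\<bar> \<le> 4 / real N ^ (n + k)" for i
      proof -
        have "co (n + k) x i - co (n + k) y i = (x - y) $ i * (real N ^ (n + k) / 2)"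
          by (simp add: grid_coord_def field_simps)
        then have "\<bar>(x - y) $ i\<bar> * (real N ^ (n + k) / 2) \<le> 2"
          using close[of i] Npow_pos[of "n + k"] by (simp add: abs_mult)
        then show ?thesis using Npow_pos[of "n + k"] by (simp add: field_simps)
      qed
      have "dist x y \<le> \<bar>(x - y) $ 1\<bar> + \<bar>(x - y) $ 2\<bar>"
        using norm_le_l1_cart[of "x - y"] by (simp add: sum_2 dist_norm)
      also have "\<dots> \<le> 8 / real N ^ (n + k)" using cl[of 1] cl[of 2] by simp
      finally have "real N ^ n * dist x y \<le> real N ^ n * (8 / real N ^ (n + k))"
        using Npow_pos[of n] by (intro mult_left_mono) auto
      also have "\<dots> = 8 / real N ^ k" using N_pos by (simp add: power_add)
      finally have "\<delta> \<le> 8 / real N ^ k" using sep[OF w v True nt xw yv] by linarith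
      then have "\<delta> * real N ^ k \<le> 8" using Npow_pos[of k] by (simp add: field_simps)
      moreover have "\<delta> * (8 / \<delta> + 1) \<le> \<delta> * real N ^ k" using k8 \<delta> by (intro mult_left_mono) auto
      moreover have "\<delta> * (8 / \<delta> + 1) = 8 + \<delta>" using \<delta> by (simp add: field_simps)
      ultimately show False using \<delta> by linarith
    next
      case False
      then obtain i where i: "\<not> \<bar>idx v i - idx w i\<bar> \<le> 1" by (auto simp: near_def)
      have "idx w i \<le> co n x i" "co n x i \<le> idx w i + 1" "idx v i \<le> co n y i" "co n y i \<le> idx v i + 1"
        using cell_prefix_bounds[of "w @ u" n k x i] cell_prefix_bounds[of "v @ u'" n k y i] wu vu x y tk by auto
      then have "1 \<le> \<bar>co n x i - co n y i\<bar>" using i by linarith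
      moreover have "\<bar>co (n + k) x i - co (n + k) y i\<bar> = real N ^ k * \<bar>co n x i - co n y i\<bar>"
        using Npow_pos[of k] by (simp add: co_add abs_mult flip: right_diff_distrib)
      ultimately have "real N ^ k * 1 \<le> 2"
        using close[of i] Npow_pos[of k] mult_left_mono[of 1 "\<bar>co n x i - co n y i\<bar>" "real N ^ k"] by linarith
      then show False using k3 by simp
    qed
  qed
qed

text \<open>The cutoffs of all subcells of \<open>w\<close> of relative generation \<open>k\<close>,
  summed and capped at 1, form a competitor; their number enters only the constant. The shift by
  \<open>k\<close> pays for \<open>untouched_not_near\<close>.\<close>

lemma conductance_bound:
  obtains k C where "0 \<le> C" "\<And>j. conductance K S f p (k + j) \<le> ennreal (C * max_modulus j)"
proof -
  obtain k where k: "\<And>n w v u u'. w \<in> T n \<Longrightarrow> v \<in> T n \<Longrightarrow> \<not> touch w v \<Longrightarrow> u \<in> T k \<Longrightarrow> u' \<in> T k \<Longrightarrow> \<not> near (w @ u) (v @ u')"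
    using untouched_not_near by blast
  define c where "c = real (card (T k))"
  define C where "C = c powr p * (c * (81 * Cb))"
  show thesis
  proof (rule that[of C k])
    show "0 \<le> C" using Cb_pos by (simp add: C_def c_def)
    fix j
    show "conductance K S f p (k + j) \<le> ennreal (C * max_modulus j)"
      unfolding conductance_def
    proof (rule SUP_least)
      fix w assume "w \<in> {w \<in> lists S. 1 \<le> length w}"
      define n where "n = length w"
      have w: "w \<in> T n" using \<open>w \<in> _\<close> by (simp add: words_def n_def)
      have "\<forall>u\<in>T k. \<exists>h. (\<forall>a\<in>T (n + k + j). (take (n + k) a = w @ u \<longrightarrow> h a = 1) \<and> (\<not> near (w @ u) (take (n + k) a) \<longrightarrow> h a = (0::real)) \<and> 0 \<le> h a)
        \<and> en (n + k + j) (T (n + k + j)) h \<le> 81 * Cb * max_modulus j"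
      proof
        fix u assume "u \<in> T k"
        then have "w @ u \<in> T (n + k)" using w words_append_iff by blast
        from cutoff_function[OF this, of j] obtain h where
          "\<And>a. a \<in> T (n + k + j) \<Longrightarrow> take (n + k) a = w @ u \<Longrightarrow> h a = 1"
          "\<And>a. a \<in> T (n + k + j) \<Longrightarrow> \<not> near (w @ u) (take (n + k) a) \<Longrightarrow> h a = 0"
          "\<And>a. a \<in> T (n + k + j) \<Longrightarrow> 0 \<le> h a"
          "en (n + k + j) (T (n + k + j)) h \<le> 81 * Cb * max_modulus j" by blast
        then show "\<exists>h. (\<forall>a\<in>T (n + k + j). (take (n + k) a = w @ u \<longrightarrow> h a = 1) \<and> (\<not> near (w @ u) (take (n + k) a) \<longrightarrow> h a = (0::real)) \<and> 0 \<le> h a)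
          \<and> en (n + k + j) (T (n + k + j)) h \<le> 81 * Cb * max_modulus j" by blast
      qed
      from bchoice[OF this] obtain H where H: "\<forall>u\<in>T k. (\<forall>a\<in>T (n + k + j). (take (n + k) a = w @ u \<longrightarrow> H u a = 1) \<and> (\<not> near (w @ u) (take (n + k) a) \<longrightarrow> H u a = (0::real)) \<and> 0 \<le> H u a)
        \<and> en (n + k + j) (T (n + k + j)) (H u) \<le> 81 * Cb * max_modulus j" by blast
      have H1: "H u a = 1" if "u \<in> T k" "a \<in> T (n + k + j)" "take (n + k) a = w @ u" for u a
        using H that by simp
      have H0: "H u a = 0" if "u \<in> T k" "a \<in> T (n + k + j)" "\<not> near (w @ u) (take (n + k) a)" for u a
        using H that by simp
      have Hn: "0 \<le> H u a" if "u \<in> T k" "a \<in> T (n + k + j)" for u a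
        using H that by simp
      have He: "en (n + k + j) (T (n + k + j)) (H u) \<le> 81 * Cb * max_modulus j" if "u \<in> T k" for u
        using H that by simp
      define h where "h a = min 1 (\<Sum>u\<in>T k. H u a)" for a
      have desc: "a \<in> T (n + k + j) \<and> (\<exists>u\<in>T k. take (n + k) a = v @ u)"
        if v: "v \<in> T n" and a: "a \<in> descendants S (k + j) v" for v a
      proof -
        obtain b where b: "b \<in> T (k + j)" "a = v @ b" using a descendants_eq[OF v] by auto
        have "a \<in> T (n + (k + j))" using b v words_append_iff by blast
        moreover have "take (n + k) a = v @ take k b" using v b by (simp add: words_def)
        ultimately show ?thesis using words_take[OF b(1)] by (auto simp: add.assoc)
      qed
      have one: "h a = 1" if a: "a \<in> descendants S (k + j) w" for a
      proof -
        obtain u where u: "a \<in> T (n + k + j)" "u \<in> T k" "take (n + k) a = w @ u" using desc[OF w a] by blast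
        have "H u a \<le> (\<Sum>u\<in>T k. H u a)" using u Hn finite_T by (intro member_le_sum) auto
        then show ?thesis using H1[OF u(2,1,3)] by (simp add: h_def)
      qed
      have zero: "h a = 0" if v: "v \<in> T n - neighbours K S f w" and a: "a \<in> descendants S (k + j) v" for v a
      proof -
        have v': "v \<in> T n" "\<not> touch w v" using v w by (auto simp: neighbours_def words_def)
        obtain u' where u': "a \<in> T (n + k + j)" "u' \<in> T k" "take (n + k) a = v @ u'" using desc[OF v'(1) a] by blast
        have "H u a = 0" if "u \<in> T k" for u
          using H0[OF that u'(1)] k[OF w v' that u'(2)] u'(3) by simp
        then show ?thesis by (simp add: h_def)
      qed
      have "en (n + k + j) (T (n + k + j)) h \<le> c powr p * (\<Sum>u\<in>T k. en (n + k + j) (T (n + k + j)) (H u))"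
        unfolding h_def c_def by (rule energy_min_sum[OF finite_T])
      also have "\<dots> \<le> c powr p * (\<Sum>u\<in>T k. 81 * Cb * max_modulus j)"
        using He by (intro mult_left_mono sum_mono) auto
      also have "\<dots> = C * max_modulus j" by (simp add: C_def c_def)
      finally have fin: "en (length w + (k + j)) (T (length w + (k + j))) h \<le> C * max_modulus j"
        by (simp add: n_def add.assoc)
      show "(INF h \<in> {h. (\<forall>u \<in> descendants S (k + j) w. h u = 1) \<and>
                 (\<forall>v \<in> T (length w) - neighbours K S f w. \<forall>u \<in> descendants S (k + j) v. h u = 0)}.
       ennreal (en (length w + (k + j)) (T (length w + (k + j))) h)) \<le> ennreal (C * max_modulus j)"
      proof (rule INF_lower2[of h])
        show "h \<in> {h. (\<forall>u \<in> descendants S (k + j) w. h u = 1) \<and>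
                 (\<forall>v \<in> T (length w) - neighbours K S f w. \<forall>u \<in> descendants S (k + j) v. h u = 0)}"
          using one zero by (auto simp: n_def)
        show "ennreal (en (length w + (k + j)) (T (length w + (k + j))) h) \<le> ennreal (C * max_modulus j)"
          using fin by (rule ennreal_leI)
      qed
    qed
  qed
qed

text \<open>The indicator of the descendants is a competitor. This serves the finitely many
  generations out of reach of \<open>conductance_bound\<close>.\<close>

lemma conductance_finite: "conductance K S f p m \<le> ennreal (9 * real (card S) ^ m)"
  unfolding conductance_def
proof (rule SUP_least)
  fix w assume "w \<in> {w \<in> lists S. 1 \<le> length w}"
  define n where "n = length w"
  have w: "w \<in> T n" using \<open>w \<in> _\<close> by (simp add: words_def n_def)
  define h where "h a = (if a \<in> descendants S m w then 1 else 0 :: real)" for a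
  have sub: "descendants S m w \<subseteq> T (n + m)" by (auto simp: descendants_def n_def)
  have "mass (n + m) h = (\<Sum>a\<in>T (n + m). if a \<in> descendants S m w then 1 else 0)"
    unfolding mass_def h_def by (intro sum.cong) auto
  also have "\<dots> = real (card (descendants S m w))"
    using sub finite_T by (simp add: sum.If_cases Int_absorb1)
  also have "card (descendants S m w) = card S ^ m"
    by (simp add: descendants_eq[OF w] card_image inj_on_def card_words finite_S)
  finally have ms: "mass (n + m) h = real (card S) ^ m" by simp
  have "en (n + m) (T (n + m)) h \<le> 9 * mass (n + m) h"
    by (rule energy_le_mass) (auto simp: h_def)
  then have fin: "en (length w + m) (T (length w + m)) h \<le> 9 * real (card S) ^ m"
    by (simp only: ms n_def[symmetric])
  show "(INF h \<in> {h. (\<forall>u \<in> descendants S m w. h u = 1) \<and>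
                 (\<forall>v \<in> T (length w) - neighbours K S f w. \<forall>u \<in> descendants S m v. h u = 0)}.
       ennreal (en (length w + m) (T (length w + m)) h)) \<le> ennreal (9 * real (card S) ^ m)"
  proof (rule INF_lower2[of h])
    have "u \<notin> descendants S m w" if v: "v \<in> T n - neighbours K S f w" and u: "u \<in> descendants S m v" for u v
    proof
      assume "u \<in> descendants S m w"
      then have "w = v" using u v w by (auto simp: descendants_def words_def prefix_def)
      then show False using v w touch_refl[of w] by (auto simp: neighbours_def words_def)
    qed
    then show "h \<in> {h. (\<forall>u \<in> descendants S m w. h u = 1) \<and>
                 (\<forall>v \<in> T (length w) - neighbours K S f w. \<forall>u \<in> descendants S m v. h u = 0)}"
      by (auto simp: h_def n_def)
    show "ennreal (en (length w + m) (T (length w + m)) h) \<le> ennreal (9 * real (card S) ^ m)"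
      using fin by (rule ennreal_leI)
  qed
qed

end

section \<open>Weights from Ahlfors regular metrics\<close>

text \<open>If \<open>\<eta> 0\<close> were positive, the intermediate value theorem between a zero
  of \<eta> and a point with value \<open>\<eta> 0 + 1\<close> would repeat the value
  \<open>\<eta> 0\<close>, against injectivity.\<close>

lemma homeomorphism_half_line_zero:
  fixes \<eta> :: "real \<Rightarrow> real"
  assumes "homeomorphism {0..} {0..} \<eta> \<eta>'"
  shows "\<eta> 0 = 0"
proof (rule ccontr)
  assume c: "\<eta> 0 \<noteq> 0"
  have cont: "continuous_on {0..} \<eta>" and im: "\<eta> ` {0..} = {0..}" and inv: "\<And>x. 0 \<le> x \<Longrightarrow> \<eta>' (\<eta> x) = x"
    using assms by (auto simp: homeomorphism_def)
  have "\<eta> 0 \<in> \<eta> ` {0..}" by (rule imageI) simp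
  then have c0: "0 < \<eta> 0" using c unfolding im by simp
  obtain t where t: "0 \<le> t" "\<eta> t = 0" using im by (metis atLeast_iff imageE order_refl)
  have "\<eta> 0 + 1 \<in> \<eta> ` {0..}" using im c0 by simp
  then obtain s where s: "0 \<le> s" "\<eta> s = \<eta> 0 + 1" by auto
  have pos: "0 < t" "0 < s" using t s c0 by (auto simp: less_le)
  have "\<exists>r>0. \<eta> r = \<eta> 0"
  proof (cases "t \<le> s")
    case True
    have "\<exists>x\<ge>t. x \<le> s \<and> \<eta> x = \<eta> 0"
      by (rule IVT') (use t s c0 True pos cont in \<open>auto intro: continuous_on_subset\<close>)
    then obtain x where "t \<le> x" "\<eta> x = \<eta> 0" by blast
    then show ?thesis using pos by (intro exI[of _ x]) auto
  next
    case False
    have "\<exists>x\<ge>s. x \<le> t \<and> \<eta> x = \<eta> 0"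
      by (rule IVT2') (use t s c0 False pos cont in \<open>auto intro: continuous_on_subset\<close>)
    then obtain x where "s \<le> x" "\<eta> x = \<eta> 0" by blast
    then show ?thesis using pos by (intro exI[of _ x]) auto
  qed
  then obtain r where r: "0 < r" "\<eta> r = \<eta> 0" by blast
  then have "r = 0" using inv[of r] inv[of 0] by simp
  then show False using r by simp
qed

text \<open>The constant \<open>B\<close> is used only for distance ratios up to 2, as a cell has
  diameter at most 4 and width at least 2 at its own scale. Smallness near 0 makes the cells
  shrink.\<close>

lemma homeomorphism_half_line_bounds:
  fixes \<eta> :: "real \<Rightarrow> real"
  assumes "homeomorphism {0..} {0..} \<eta> \<eta>'"
  obtains B where "1 \<le> B" "\<And>t. 0 \<le> t \<Longrightarrow> t \<le> 2 \<Longrightarrow> \<eta> t \<le> B"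
    "\<And>\<epsilon>. 0 < \<epsilon> \<Longrightarrow> \<exists>s>0. \<forall>t. 0 \<le> t \<and> t \<le> s \<longrightarrow> \<eta> t \<le> \<epsilon>"
proof -
  have cont: "continuous_on {0..} \<eta>" using assms by (auto simp: homeomorphism_def)
  have "bounded (\<eta> ` {0..2})"
    by (intro compact_imp_bounded compact_continuous_image continuous_on_subset[OF cont]) auto
  then obtain B0 where B0: "\<forall>t\<in>{0..2}. \<bar>\<eta> t\<bar> \<le> B0" unfolding bounded_iff by auto
  show thesis
  proof (rule that[of "max 1 B0"])
    show "\<eta> t \<le> max 1 B0" if "0 \<le> t" "t \<le> 2" for t using B0 that by (force simp: abs_le_iff)
    fix \<epsilon> :: real assume \<epsilon>: "0 < \<epsilon>"
    have "(0 :: real) \<in> {0..}" by simp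
    then have "\<exists>d>0. \<forall>x'\<in>{0..}. dist x' 0 < d \<longrightarrow> dist (\<eta> x') (\<eta> 0) < \<epsilon>"
      using cont \<epsilon> unfolding continuous_on_iff by blast
    then obtain d where d: "d > 0" "\<And>x'. 0 \<le> x' \<Longrightarrow> x' < d \<Longrightarrow> \<bar>\<eta> x'\<bar> < \<epsilon>"
      using homeomorphism_half_line_zero[OF assms] by (auto simp: dist_real_def)
    show "\<exists>s>0. \<forall>t. 0 \<le> t \<and> t \<le> s \<longrightarrow> \<eta> t \<le> \<epsilon>"
      using d by (intro exI[of _ "d / 2"]) (force dest: d(2))
  qed simp
qed

lemma rtrancl_path_end:
  "rtrancl_path r a ys b \<Longrightarrow> a \<in> A \<Longrightarrow> (\<And>u v. r u v \<Longrightarrow> v \<in> A) \<Longrightarrow> b \<in> A"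
  by (induction rule: rtrancl_path.induct) auto

context tiling
begin

lemma rtrancl_path_metric:
  assumes "Metric_space K \<rho>"
    and "rtrancl_path (\<lambda>u v. u \<in> A \<and> v \<in> A \<and> touch u v) a ys b" "a \<in> A"
    and "A \<subseteq> T k"
    and "\<And>c z z'. c \<in> A \<Longrightarrow> z \<in> Kc c \<Longrightarrow> z' \<in> Kc c \<Longrightarrow> \<rho> z z' \<le> \<tau> c"
    and "x \<in> Kc a" "y \<in> Kc b"
  shows "\<rho> x y \<le> sum_list (map \<tau> (a # ys))"
  using assms(2,3,6,7)
proof (induction arbitrary: x)
  case (step a c ys b)
  then obtain z where z: "z \<in> Kc a" "z \<in> Kc c" by blast
  have inK: "x \<in> K" "z \<in> K" "y \<in> K"
  proof -
    have "b \<in> A" by (rule rtrancl_path_end[OF step.hyps(2)]) (use step.hyps(1) in auto)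
    then show "x \<in> K" "z \<in> K" "y \<in> K" using step.prems z assms(4) cell_K by blast+
  qed
  have "\<rho> x y \<le> \<rho> x z + \<rho> z y" using Metric_space.triangle[OF assms(1) inK] .
  also have "\<dots> \<le> \<tau> a + sum_list (map \<tau> (c # ys))"
    using step.IH[of z] step.hyps step.prems z assms(5) by (intro add_mono) auto
  finally show ?case by simp
qed (use assms(5) in auto)

lemma conn_metric:
  assumes "Metric_space K \<rho>" "conn A" "A \<subseteq> T k" "a \<in> A" "b \<in> A"
    and d: "\<And>c z z'. c \<in> A \<Longrightarrow> z \<in> Kc c \<Longrightarrow> z' \<in> Kc c \<Longrightarrow> \<rho> z z' \<le> \<tau> c"
    and "x \<in> Kc a" "y \<in> Kc b" and \<tau>: "\<And>c. 0 \<le> \<tau> c"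
  shows "\<rho> x y \<le> sum \<tau> A"
proof -
  obtain xs where xs: "rtrancl_path (\<lambda>u v. u \<in> A \<and> v \<in> A \<and> touch u v) a xs b" "distinct (a # xs)" "set (a # xs) \<subseteq> A"
    using assms(2,4,5) by (rule conn_path)
  have "\<rho> x y \<le> sum_list (map \<tau> (a # xs))"
    by (rule rtrancl_path_metric[OF assms(1) xs(1) assms(4,3) d assms(7,8)])
  also have "\<dots> = sum \<tau> (set (a # xs))" using xs(2) by (rule sum_list_distinct_conv_sum_set)
  also have "\<dots> \<le> sum \<tau> A" using assms xs(3) finite_T finite_subset by (intro sum_mono2) blast+
  finally show ?thesis .
qed

lemma cell_wide:
  assumes "w \<in> T k"
  shows "\<exists>x\<in>Kc w. \<exists>y\<in>Kc w. 2 / real N ^ k \<le> dist x y"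
proof -
  obtain x where x: "x \<in> Kc w" "co k x 1 = idx w 1" using cell_meets_side[OF assms, of 0 1] by auto
  obtain y where y: "y \<in> Kc w" "co k y 1 = idx w 1 + 1" using cell_meets_side[OF assms, of 1 1] by auto
  have "(y - x) $ 1 * (real N ^ k / 2) = co k y 1 - co k x 1" by (simp add: grid_coord_def field_simps)
  also have "\<dots> = 1" using x y by simp
  finally have "(y - x) $ 1 = 2 / real N ^ k" using Npow_pos[of k] by (simp add: field_simps)
  then have "2 / real N ^ k \<le> dist x y"
    using component_le_norm_cart[of "y - x" 1] by (simp add: dist_norm norm_minus_commute)
  then show ?thesis using x y by blast
qed

lemma cell_diameter:
  assumes "w \<in> T k" "x \<in> Kc w" "y \<in> Kc w" shows "dist x y \<le> 4 / real N ^ k"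
proof -
  obtain a b where ab: "a \<in> K" "b \<in> K" "x = W w a" "y = W w b" using assms by (auto simp: cell_def)
  have "dist a b \<le> 4" using ab K_square by (intro dist_square_le) auto
  then show ?thesis unfolding ab dist_W[OF assms(1)] by (intro divide_right_mono) auto
qed

lemma K_diameter: "x \<in> K \<Longrightarrow> y \<in> K \<Longrightarrow> dist x y \<le> 4"
  using dist_square_le K_square by blast

text \<open>The given distance is two grid units, so indices differ by at most three in each
  coordinate, and 49 is the square of 7.\<close>

lemma card_close_cells:
  assumes x: "\<And>w. w \<in> T k \<Longrightarrow> x w \<in> Kc w" and z: "z \<in> K"
  shows "card {w \<in> T k. dist (x w) z < 4 / real N ^ k} \<le> 49"
proof -
  obtain v where v: "v \<in> T k" "z \<in> Kc v" using z K_eq_cells[of k] by blast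
  let ?X = "{w \<in> T k. dist (x w) z < 4 / real N ^ k}"
  have "inj_on idx ?X" using idx_inj by (auto simp: inj_on_def fun_eq_iff)
  moreover have "idx ` ?X \<subseteq> {z'. \<forall>i. \<bar>z' i - idx v i\<bar> \<le> 3}"
  proof clarify
    fix w i assume w: "w \<in> T k" and d: "dist (x w) z < 4 / real N ^ k"
    have "\<bar>(x w - z) $ i\<bar> < 4 / real N ^ k"
      using component_le_norm_cart[of "x w - z" i] d by (simp add: dist_norm)
    then have "\<bar>(x w - z) $ i\<bar> * (real N ^ k / 2) < 4 / real N ^ k * (real N ^ k / 2)"
      using Npow_pos[of k] by (intro mult_strict_right_mono) auto
    also have "\<dots> = 2" using N_pos by simp
    also have "\<bar>(x w - z) $ i\<bar> * (real N ^ k / 2) = \<bar>co k (x w) i - co k z i\<bar>"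
    proof -
      have "co k (x w) i - co k z i = (x w - z) $ i * (real N ^ k / 2)" by (simp add: grid_coord_def field_simps)
      then have "\<bar>co k (x w) i - co k z i\<bar> = \<bar>(x w - z) $ i\<bar> * \<bar>real N ^ k / 2\<bar>"
        by (simp only: abs_mult)
      then show ?thesis using Npow_pos[of k] by simp
    qed
    finally have "\<bar>co k (x w) i - co k z i\<bar> < 2" .
    moreover have "idx w i \<le> co k (x w) i" "co k (x w) i \<le> idx w i + 1"
      "idx v i \<le> co k z i" "co k z i \<le> idx v i + 1"
      using x[OF w] cell_square[OF w] W_square_eq[OF w] v cell_square[OF v(1)] W_square_eq[OF v(1)] by auto
    ultimately show "\<bar>idx w i - idx v i\<bar> \<le> 3" by linarith
  qed
  ultimately have "card ?X \<le> card {z'. \<forall>i. \<bar>z' i - idx v i\<bar> \<le> 3}"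
    using card_int_box(1)[of 3 "idx v"] by (intro card_inj_on_le) auto
  then show ?thesis by (simp add: card_int_box)
qed

lemma sum_emeasure_overlap:
  assumes "finite X" "\<And>w. w \<in> X \<Longrightarrow> B w \<in> sets M" "\<And>z. z \<in> space M \<Longrightarrow> card {w \<in> X. z \<in> B w} \<le> m"
  shows "(\<Sum>w\<in>X. emeasure M (B w)) \<le> of_nat m * emeasure M (space M)"
proof -
  have "(\<Sum>w\<in>X. emeasure M (B w)) = (\<Sum>w\<in>X. \<integral>\<^sup>+z. indicator (B w) z \<partial>M)"
    using assms(2) by (intro sum.cong) auto
  also have "\<dots> = (\<integral>\<^sup>+z. (\<Sum>w\<in>X. indicator (B w) z) \<partial>M)"
    using assms(2) by (intro nn_integral_sum[symmetric]) auto
  also have "\<dots> \<le> (\<integral>\<^sup>+z. of_nat m \<partial>M)"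
  proof (rule nn_integral_mono)
    fix z assume z: "z \<in> space M"
    have "(\<Sum>w\<in>X. indicator (B w) z) = (of_nat (card {w \<in> X. z \<in> B w}) :: ennreal)"
      using assms(1) by (simp add: indicator_def sum.If_cases Int_def)
    also have "\<dots> \<le> of_nat m" using assms(3)[OF z] by simp
    finally show "(\<Sum>w\<in>X. indicator (B w) z) \<le> (of_nat m :: ennreal)" .
  qed
  also have "\<dots> = of_nat m * emeasure M (space M)" by simp
  finally show ?thesis .
qed

text \<open>The weight is an upper bound for the \<rho>-diameter of the cell, divided by a lower
  bound \<delta> for the \<rho>-distance of opposite sides, so crossings have weight at least 1.
  Balls of comparable radius centred in the cells of one generation overlap boundedly, so regularity
  bounds the \<alpha>-mass by a multiple of the measure of \<open>K\<close>.\<close>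

lemma ahlfors_weights:
  assumes ms: "Metric_space K \<rho>" and qs: "quasisymmetric_metrics K dist \<rho>"
    and br: "borel_regular_measure (Metric_space.mtopology K \<rho>) M"
    and ar: "ahlfors_regular K \<rho> \<alpha> M" and \<alpha>: "0 < \<alpha>"
  obtains \<tau> Q where "\<And>w. 0 \<le> \<tau> w" "\<And>i k A. cross i k A \<Longrightarrow> 1 \<le> sum \<tau> A"
    "\<And>k. (\<Sum>w\<in>T k. \<tau> w powr \<alpha>) \<le> (Q :: real)"
    "\<And>\<epsilon>. 0 < \<epsilon> \<Longrightarrow> \<exists>k0. \<forall>k\<ge>k0. \<forall>w\<in>T k. \<tau> w \<le> \<epsilon>"
proof -
  interpret Metric_space K \<rho> by (rule ms)
  obtain \<eta> \<eta>' where hom: "homeomorphism {0..} {0..} \<eta> \<eta>'"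
    and q: "\<And>x y z. x \<in> K \<Longrightarrow> y \<in> K \<Longrightarrow> z \<in> K \<Longrightarrow> x \<noteq> z \<Longrightarrow> \<rho> x y / \<rho> x z \<le> \<eta> (dist x y / dist x z)"
    using qs unfolding quasisymmetric_metrics_def by blast
  obtain B where B1: "1 \<le> B" and B: "\<And>t. 0 \<le> t \<Longrightarrow> t \<le> 2 \<Longrightarrow> \<eta> t \<le> B"
    and small: "\<And>\<epsilon>. 0 < \<epsilon> \<Longrightarrow> \<exists>s>0. \<forall>t. 0 \<le> t \<and> t \<le> s \<longrightarrow> \<eta> t \<le> \<epsilon>"
    using homeomorphism_half_line_bounds[OF hom] by metis
  have \<rho>pos: "0 < \<rho> x z" if "x \<in> K" "z \<in> K" "x \<noteq> z" for x z using that mdist_pos_less by blast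
  have qB: "\<rho> x y \<le> B * \<rho> x z" if "x \<in> K" "y \<in> K" "z \<in> K" "dist x y \<le> 2 * dist x z" "x \<noteq> z" for x y z
  proof -
    have "0 < dist x z" using that by simp
    then have "\<eta> (dist x y / dist x z) \<le> B" using that by (intro B) (auto simp: field_simps)
    then have "\<rho> x y / \<rho> x z \<le> B" using q[of x y z] that by linarith
    then show ?thesis using \<rho>pos[of x z] that by (simp add: field_simps)
  qed
  \<comment> \<open>A reference pair at no less than half the bound 4 for Euclidean distances in
    \<open>K\<close>, so that \<open>qB\<close> compares it with every other pair.\<close>
  obtain p0 p1 where p: "p0 \<in> K" "p1 \<in> K" "2 \<le> dist p0 p1"
    using cell_wide[of "[]" 0] by (auto simp: cell_def)
  then have pne: "p0 \<noteq> p1" by auto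
  define R where "R = \<rho> p0 p1"
  have R: "0 < R" using \<rho>pos p pne by (simp add: R_def)
  have bd: "\<rho> x y \<le> 2 * B * R" if "x \<in> K" "y \<in> K" for x y
  proof -
    have "\<rho> p0 x \<le> B * R" "\<rho> p0 y \<le> B * R"
      unfolding R_def using that p pne K_diameter[of p0 x] K_diameter[of p0 y] by (auto intro!: qB)
    then show ?thesis using triangle[of x p0 y] that p(1) by (simp add: commute)
  qed
  obtain X Y where XY: "\<And>w. w \<in> T (length w) \<Longrightarrow> X w \<in> Kc w \<and> Y w \<in> Kc w \<and> 2 / real N ^ length w \<le> dist (X w) (Y w)"
  proof -
    have "\<forall>w. \<exists>x y. w \<in> T (length w) \<longrightarrow> x \<in> Kc w \<and> y \<in> Kc w \<and> 2 / real N ^ length w \<le> dist x y"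
      using cell_wide by blast
    then show thesis using that by metis
  qed
  have XYk: "X w \<in> Kc w" "Y w \<in> Kc w" "2 / real N ^ k \<le> dist (X w) (Y w)" "X w \<in> K" "Y w \<in> K" "X w \<noteq> Y w"
    if w: "w \<in> T k" for w k
  proof -
    have l: "length w = k" using w by (simp add: words_def)
    show 1: "X w \<in> Kc w" "Y w \<in> Kc w" "2 / real N ^ k \<le> dist (X w) (Y w)" using XY[of w] w l by auto
    show "X w \<in> K" "Y w \<in> K" using 1 cell_K[OF w] by auto
    have "0 < 2 / real N ^ k" using Npow_pos[of k] by simp
    then show "X w \<noteq> Y w" using 1(3) by (metis dist_self not_le)
  qed
  \<comment> \<open>Division by \<open>B\<close> keeps the \<rho>-ball of this radius inside a
    Euclidean ball of the size of the cell; see \<open>inb\<close>.\<close>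
  define r where "r w = \<rho> (X w) (Y w) / B" for w
  have rpos: "0 < r w" if "w \<in> T k" for w k using XYk[OF that] \<rho>pos B1 by (simp add: r_def)
  \<comment> \<open>Any two points of the cell are joined through \<open>X w\<close> by two legs of
    \<rho>-length at most \<open>B * \<rho> (X w) (Y w)\<close> each.\<close>
  define \<tau>0 where "\<tau>0 w = 2 * B * \<rho> (X w) (Y w)" for w
  have \<tau>0nn: "0 \<le> \<tau>0 w" for w using B1 by (simp add: \<tau>0_def)
  have XB: "\<rho> (X w) z \<le> B * \<rho> (X w) (Y w)" if w: "w \<in> T k" and z: "z \<in> Kc w" for w k z
  proof (rule qB)
    have "dist (X w) z \<le> 2 * (2 / real N ^ k)" using cell_diameter[OF w XYk(1)[OF w] z] by simp
    then show "dist (X w) z \<le> 2 * dist (X w) (Y w)" using XYk(3)[OF w] by linarith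
  qed (use XYk[OF w] z cell_K[OF w] in auto)
  have diam: "\<rho> z z' \<le> \<tau>0 w" if w: "w \<in> T k" and z: "z \<in> Kc w" "z' \<in> Kc w" for w k z z'
  proof -
    have "z \<in> K" "z' \<in> K" using z cell_K[OF w] by auto
    then have "\<rho> z z' \<le> \<rho> z (X w) + \<rho> (X w) z'" using XYk(4)[OF w] by (intro triangle)
    then show ?thesis using XB[OF w z(1)] XB[OF w z(2)] commute[of z "X w"] unfolding \<tau>0_def by linarith
  qed
  \<comment> \<open>Opposite sides are at Euclidean distance at least 2, so \<open>qB\<close>
    compares their \<rho>-distance with that of the reference pair.\<close>
  define \<delta> where "\<delta> = R / (2 * B)"
  have \<delta>: "0 < \<delta>" using R B1 by (simp add: \<delta>_def)
  have sep: "\<delta> \<le> \<rho> x y" if xy: "x \<in> K" "y \<in> K" "x $ i = -1" "y $ i = 1" for x y i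
  proof -
    have "\<bar>(y - x) $ i\<bar> \<le> dist x y" using component_le_norm_cart[of "y - x" i] by (simp add: dist_norm norm_minus_commute)
    then have d2: "2 \<le> dist x y" using xy by simp
    then have ne: "x \<noteq> y" by auto
    have "\<rho> x p0 \<le> B * \<rho> x y" "\<rho> x p1 \<le> B * \<rho> x y"
      using d2 ne xy p K_diameter[of x p0] K_diameter[of x p1] by (auto intro!: qB)
    then have "R \<le> 2 * B * \<rho> x y" unfolding R_def using triangle[of p0 x p1] xy p by (simp add: commute)
    then show ?thesis using B1 by (simp add: \<delta>_def field_simps)
  qed
  obtain c C where c: "0 < c" and C: "0 < C" and reg: "\<And>x s. x \<in> K \<Longrightarrow> 0 < s \<Longrightarrow> ereal s \<le> (SUP (y, z) \<in> K \<times> K. ereal (\<rho> y z)) \<Longrightarrow>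
        ennreal (c * s powr \<alpha>) \<le> emeasure M (mball x s) \<and> emeasure M (mball x s) \<le> ennreal (C * s powr \<alpha>)"
    using ar unfolding ahlfors_regular_def by blast
  have sup: "ereal s \<le> (SUP (y, z) \<in> K \<times> K. ereal (\<rho> y z))" if "s \<le> \<rho> y z" "y \<in> K" "z \<in> K" for s y z
    by (rule SUP_upper2[of "(y, z)"]) (use that in auto)
  have spM: "space M = K" using br by (simp add: borel_regular_measure_def topspace_mtopology)
  have meas: "mball x s \<in> sets M" for x s
  proof -
    have "mball x s \<in> borel_sets_of mtopology"
      unfolding borel_sets_of_def by (rule sigma_sets.Basic) (simp add: openin_mball)
    then show ?thesis using br by (auto simp: borel_regular_measure_def)
  qed
  have shrink: "\<exists>k0. \<forall>k\<ge>k0. \<forall>w\<in>T k. \<tau>0 w \<le> \<epsilon>" if \<epsilon>: "0 < \<epsilon>" for \<epsilon>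
  proof -
    define \<epsilon>' where "\<epsilon>' = \<epsilon> / (2 * B * (2 * B * R))"
    have "0 < \<epsilon>'" using \<epsilon> B1 R by (simp add: \<epsilon>'_def)
    then obtain s where s: "0 < s" "\<And>t. 0 \<le> t \<Longrightarrow> t \<le> s \<Longrightarrow> \<eta> t \<le> \<epsilon>'" using small by blast
    have "1 < real N" using N2 by simp
    then obtain k0 where k0: "4 / s < real N ^ k0" using real_arch_pow by blast
    show ?thesis
    proof (intro exI[of _ k0] allI impI ballI)
      fix k w assume k: "k0 \<le> k" and w: "w \<in> T k"
      note XYw = XYk[OF w]
      have "real N ^ k0 \<le> real N ^ k" using k N2 by (intro power_increasing) auto
      then have "4 / s \<le> real N ^ k" using k0 by linarith
      then have ks: "4 / real N ^ k \<le> s" using s(1) Npow_pos[of k] by (simp add: field_simps)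
      \<comment> \<open>One of the reference points is at distance at least 1 from
        \<open>X w\<close>, so the ratio below is at most the Euclidean diameter of the
        cell.\<close>
      obtain z where z: "z \<in> K" "1 \<le> dist (X w) z"
      proof (cases "1 \<le> dist (X w) p0")
        case False
        then have "1 \<le> dist (X w) p1" using p(3) dist_triangle[of p0 p1 "X w"] by (simp add: dist_commute)
        then show ?thesis using that p by blast
      qed (use that p in blast)
      have ne: "X w \<noteq> z" using z by auto
      have "dist (X w) (Y w) / dist (X w) z \<le> dist (X w) (Y w) / 1" using z by (intro divide_left_mono) auto
      also have "\<dots> \<le> 4 / real N ^ k" using cell_diameter[OF w XYw(1,2)] by simp
      finally have "\<eta> (dist (X w) (Y w) / dist (X w) z) \<le> \<epsilon>'" using ks by (intro s(2)) auto
      then have "\<rho> (X w) (Y w) / \<rho> (X w) z \<le> \<epsilon>'" using q[OF XYw(4,5) z(1) ne] by linarith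
      then have "\<rho> (X w) (Y w) \<le> \<epsilon>' * \<rho> (X w) z" using \<rho>pos[OF XYw(4) z(1) ne] by (simp add: field_simps)
      also have "\<dots> \<le> \<epsilon>' * (2 * B * R)" using bd[OF XYw(4) z(1)] \<open>0 < \<epsilon>'\<close> by (intro mult_left_mono) auto
      finally have "\<tau>0 w \<le> 2 * B * (\<epsilon>' * (2 * B * R))" unfolding \<tau>0_def using B1 by (intro mult_left_mono) auto
      also have "\<dots> = \<epsilon>" using B1 R by (simp add: \<epsilon>'_def)
      finally show "\<tau>0 w \<le> \<epsilon>" .
    qed
  qed
  \<comment> \<open>Regularity speaks only of radii up to the \<rho>-diameter, so finiteness comes
    from a finite cover by balls of the permitted radius \<open>R\<close>.\<close>
  have finK: "emeasure M K < \<infinity>"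
  proof -
    have "0 < R / 2" using R by simp
    from shrink[OF this] obtain k0 where k0: "\<And>w. w \<in> T k0 \<Longrightarrow> \<tau>0 w \<le> R / 2" by blast
    have "K \<subseteq> (\<Union>w\<in>T k0. mball (X w) R)"
    proof
      fix z assume z: "z \<in> K"
      then obtain w where w: "w \<in> T k0" "z \<in> Kc w" using K_eq_cells[of k0] by blast
      have "\<rho> (X w) z \<le> R / 2" using diam[OF w(1) XYk(1)[OF w(1)] w(2)] k0[OF w(1)] by linarith
      then have "z \<in> mball (X w) R" using R z XYk(4)[OF w(1)] by simp
      then show "z \<in> (\<Union>w\<in>T k0. mball (X w) R)" using w by blast
    qed
    then have "emeasure M K \<le> emeasure M (\<Union>w\<in>T k0. mball (X w) R)"
      using meas finite_T by (intro emeasure_mono sets.finite_UN) auto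
    also have "\<dots> \<le> (\<Sum>w\<in>T k0. emeasure M (mball (X w) R))"
      using meas finite_T by (intro emeasure_subadditive_finite) auto
    also have "\<dots> \<le> (\<Sum>w\<in>T k0. ennreal (C * R powr \<alpha>))"
      using reg sup[of R p0 p1] XYk(4) p R by (intro sum_mono) (auto simp: R_def)
    also have "\<dots> < \<infinity>" using finite_T by (simp add: ennreal_mult_less_top of_nat_less_top)
    finally show ?thesis .
  qed
  define V where "V = enn2real (emeasure M K)"
  have V: "emeasure M K = ennreal V" using finK by (simp add: V_def)
  have V0: "0 \<le> V" by (simp add: V_def)
  have sumr: "(\<Sum>w\<in>T k. r w powr \<alpha>) \<le> 49 * V / c" for k
  proof -
    have inb: "dist (X w) z < 4 / real N ^ k" if w: "w \<in> T k" and z: "z \<in> mball (X w) (r w)" for w z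
    proof (rule ccontr)
      assume "\<not> ?thesis"
      then have far: "4 / real N ^ k \<le> dist (X w) z" by simp
      have zK: "z \<in> K" "\<rho> (X w) z < r w" using z by auto
      have le: "dist (X w) (Y w) \<le> dist (X w) z" using far cell_diameter[OF w XYk(1,2)[OF w]] by linarith
      then have ne: "X w \<noteq> z" using XYk(6)[OF w] by auto
      have "dist (X w) (Y w) \<le> 2 * dist (X w) z" using le zero_le_dist[of "X w" z] by linarith
      then have "\<rho> (X w) (Y w) \<le> B * \<rho> (X w) z" using XYk(4,5)[OF w] zK(1) ne by (intro qB)
      then show False using zK(2) B1 by (simp add: r_def field_simps)
    qed
    have "(\<Sum>w\<in>T k. ennreal (c * r w powr \<alpha>)) \<le> (\<Sum>w\<in>T k. emeasure M (mball (X w) (r w)))"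
    proof (rule sum_mono)
      fix w assume w: "w \<in> T k"
      have "\<rho> (X w) (Y w) / B \<le> \<rho> (X w) (Y w) / 1" using B1 by (intro divide_left_mono) auto
      then have "r w \<le> \<rho> (X w) (Y w)" by (simp add: r_def)
      then show "ennreal (c * r w powr \<alpha>) \<le> emeasure M (mball (X w) (r w))"
        using reg[OF XYk(4)[OF w] rpos[OF w]] sup XYk(4,5)[OF w] by blast
    qed
    also have "\<dots> \<le> of_nat 49 * emeasure M (space M)"
    proof (rule sum_emeasure_overlap[OF finite_T meas])
      fix z assume "z \<in> space M"
      then have z: "z \<in> K" using spM by simp
      have "card {w \<in> T k. z \<in> mball (X w) (r w)} \<le> card {w \<in> T k. dist (X w) z < 4 / real N ^ k}"
        using finite_T inb by (intro card_mono) auto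
      also have "\<dots> \<le> 49" using card_close_cells[of k X z] XYk(1) z by blast
      finally show "card {w \<in> T k. z \<in> mball (X w) (r w)} \<le> 49" .
    qed
    also have "\<dots> = ennreal (49 * V)" using V0 by (simp add: spM V ennreal_mult flip: ennreal_numeral)
    also have "(\<Sum>w\<in>T k. ennreal (c * r w powr \<alpha>)) = ennreal (\<Sum>w\<in>T k. c * r w powr \<alpha>)"
      using c by (intro sum_ennreal) auto
    finally have "(\<Sum>w\<in>T k. c * r w powr \<alpha>) \<le> 49 * V" using V0 by (simp add: ennreal_le_iff)
    then show ?thesis using c by (simp add: sum_distrib_left[symmetric] field_simps)
  qed
  define \<tau> where "\<tau> w = \<tau>0 w / \<delta>" for w
  have \<tau>r: "\<tau> w = (2 * B * B / \<delta>) * r w" for w using B1 by (simp add: \<tau>_def \<tau>0_def r_def)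
  show thesis
  proof (rule that[of \<tau> "(2 * B * B / \<delta>) powr \<alpha> * (49 * V / c)"])
    show "0 \<le> \<tau> w" for w using \<tau>0nn \<delta> by (simp add: \<tau>_def)
    show "1 \<le> sum \<tau> A" if cr: "cross i k A" for i k A
    proof -
      obtain a x b y where A: "A \<subseteq> T k" "conn A" and x: "a \<in> A" "x \<in> Kc a" "x $ i = -1"
        and y: "b \<in> A" "y \<in> Kc b" "y $ i = 1" using cr unfolding cross_def by blast
      have "\<rho> x y \<le> sum \<tau>0 A"
        by (rule conn_metric[OF ms A(2,1) x(1) y(1) _ x(2) y(2) \<tau>0nn]) (use diam A in blast)
      moreover have "\<delta> \<le> \<rho> x y" using sep x y A cell_K by blast
      ultimately have "\<delta> \<le> sum \<tau>0 A" by simp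
      then show ?thesis using \<delta> by (simp add: \<tau>_def sum_divide_distrib[symmetric])
    qed
    show "(\<Sum>w\<in>T k. \<tau> w powr \<alpha>) \<le> (2 * B * B / \<delta>) powr \<alpha> * (49 * V / c)" for k
    proof -
      have "(\<Sum>w\<in>T k. \<tau> w powr \<alpha>) = (2 * B * B / \<delta>) powr \<alpha> * (\<Sum>w\<in>T k. r w powr \<alpha>)"
        unfolding sum_distrib_left \<tau>r using B1 \<delta> rpos by (intro sum.cong refl powr_mult)
      moreover have "(2 * B * B / \<delta>) powr \<alpha> * (\<Sum>w\<in>T k. r w powr \<alpha>) \<le> (2 * B * B / \<delta>) powr \<alpha> * (49 * V / c)"
        by (rule mult_left_mono[OF sumr]) simp
      ultimately show ?thesis by (rule ord_eq_le_trans)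
    qed
    show "\<exists>k0. \<forall>k\<ge>k0. \<forall>w\<in>T k. \<tau> w \<le> \<epsilon>" if "0 < \<epsilon>" for \<epsilon>
    proof -
      have "0 < \<epsilon> * \<delta>" using that \<delta> by simp
      from shrink[OF this] show ?thesis using \<delta> by (simp add: \<tau>_def field_simps)
    qed
  qed
qed

end

section \<open>Small moduli above the conformal dimension\<close>

context tiling_p
begin

text \<open>Some \<alpha> below \<open>p\<close> is realised by a regular metric. Raising its
  weights to the power \<open>p\<close> leaves the surplus factor
  \<open>\<tau> w powr (p - \<alpha>)\<close>, which tends to 0 uniformly while the \<alpha>-mass
  stays bounded.\<close>

lemma max_modulus_small:
  assumes dim: "ereal p > dim_AR K dist" and \<epsilon>: "0 < \<epsilon>"
  shows "\<exists>k\<ge>k1. max_modulus k \<le> \<epsilon>"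
proof -
  from dim obtain \<alpha> \<rho> M where \<alpha>: "0 < \<alpha>" "\<alpha> < p" and ms: "Metric_space K \<rho>"
    and "quasisymmetric_metrics K dist \<rho>" "borel_regular_measure (Metric_space.mtopology K \<rho>) M" "ahlfors_regular K \<rho> \<alpha> M"
    unfolding dim_AR_def Inf_less_iff by auto
  then obtain \<tau> Q where \<tau>: "\<And>w. 0 \<le> \<tau> w" "\<And>i k A. cross i k A \<Longrightarrow> 1 \<le> sum \<tau> A"
    and Q: "\<And>k. (\<Sum>w\<in>T k. \<tau> w powr \<alpha>) \<le> (Q :: real)"
    and sm: "\<And>\<epsilon>. 0 < \<epsilon> \<Longrightarrow> \<exists>k0. \<forall>k\<ge>k0. \<forall>w\<in>T k. \<tau> w \<le> \<epsilon>"
    using ahlfors_weights by metis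
  have "0 \<le> (\<Sum>w\<in>T 0. \<tau> w powr \<alpha>)" by (intro sum_nonneg) simp
  then have Q0: "0 \<le> Q" using Q[of 0] by linarith
  \<comment> \<open>Chosen so that
    \<open>\<epsilon>' powr (p - \<alpha>) = \<epsilon> / (Q + 1)\<close>; the added 1 keeps the
    denominator positive.\<close>
  define \<epsilon>' where "\<epsilon>' = (\<epsilon> / (Q + 1)) powr (1 / (p - \<alpha>))"
  have "0 < \<epsilon>'" using \<epsilon> Q0 by (simp add: \<epsilon>'_def)
  then obtain k0 where k0: "\<And>k w. k0 \<le> k \<Longrightarrow> w \<in> T k \<Longrightarrow> \<tau> w \<le> \<epsilon>'" using sm by blast
  define k where "k = max k0 k1"
  have "max_modulus k \<le> mass k \<tau>"
    by (rule max_modulus_le, rule modulus_le_mass) (use \<tau> in \<open>auto simp: admissible_def\<close>)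
  also have "\<dots> \<le> (\<Sum>w\<in>T k. \<epsilon> / (Q + 1) * \<tau> w powr \<alpha>)"
    unfolding mass_def
  proof (rule sum_mono)
    fix w assume w: "w \<in> T k"
    have "\<tau> w powr p = \<tau> w powr (p - \<alpha>) * \<tau> w powr \<alpha>" by (simp add: powr_add[symmetric])
    also have "\<tau> w powr (p - \<alpha>) \<le> \<epsilon>' powr (p - \<alpha>)"
      using k0[OF _ w] \<tau>(1) \<alpha> by (intro powr_mono2) (auto simp: k_def)
    also have "\<epsilon>' powr (p - \<alpha>) = \<epsilon> / (Q + 1)" using \<alpha> \<epsilon> Q0 by (simp add: \<epsilon>'_def powr_powr)
    finally show "\<tau> w powr p \<le> \<epsilon> / (Q + 1) * \<tau> w powr \<alpha>" by (simp add: mult_right_mono)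
  qed
  also have "\<dots> = \<epsilon> / (Q + 1) * (\<Sum>w\<in>T k. \<tau> w powr \<alpha>)" by (simp add: sum_distrib_left)
  also have "\<dots> \<le> \<epsilon> / (Q + 1) * (Q + 1)" using Q[of k] \<epsilon> Q0 by (intro mult_left_mono) auto
  also have "\<dots> = \<epsilon>" using Q0 by simp
  finally show ?thesis by (intro exI[of _ k]) (auto simp: k_def)
qed

end

context tiling
begin

section \<open>Nets and oscillation\<close>

text \<open>One connected set crossing in both directions. It has no preferred axis, so symmetries
  of \<open>K\<close> that interchange the axes preserve the property.\<close>

definition full :: "nat \<Rightarrow> (nat \<times> nat) list set \<Rightarrow> bool" where
  "full m A \<longleftrightarrow> (\<forall>i. cross i m A)"

lemma full_side:
  assumes "full m A" "c \<in> {1, -1}" shows "\<exists>a\<in>A. \<exists>x\<in>Kc a. x $ i = c"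
proof -
  have "cross i m A" using assms(1) by (simp add: full_def)
  moreover have "c = 1 \<or> c = -1" using assms(2) by simp
  ultimately show ?thesis by (elim disjE) (simp_all add: cross_def)
qed

lemma fullI:
  assumes "A \<subseteq> T m" "conn A" "\<And>i c. c \<in> {1, -1} \<Longrightarrow> \<exists>a\<in>A. \<exists>x\<in>Kc a. x $ i = c"
  shows "full m A"
  unfolding full_def cross_def using assms(1,2) assms(3)[of 1] assms(3)[of "-1"] by simp

lemma full_lin:
  assumes D: "full m D" and g: "g \<in> square_symmetries" and c: "c \<in> {1, -1}"
  shows "\<exists>u\<in>D. \<exists>x\<in>Kc u. g x $ i = c"
proof -
  obtain \<pi> :: "2 \<Rightarrow> 2" and e :: "2 \<Rightarrow> real" where "bij \<pi>" and e: "\<And>i. e i \<in> {1, -1}"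
    and p: "\<And>x i. g x $ i = e i * x $ \<pi> i"
    using square_symmetry_signed_permutation[OF g] by metis
  have "e i * c \<in> {1, -1}" using e[of i] c by auto
  from full_side[OF D this] obtain u x where "u \<in> D" "x \<in> Kc u" "x $ \<pi> i = e i * c" by blast
  moreover have "e i * (e i * c) = c" using e[of i] by auto
  ultimately show ?thesis using p by metis
qed

lemma sym_word_inverse:
  assumes g: "g \<in> cell_syms" and u: "u \<in> T m"
  shows "sym_word (inv g) (sym_word g u) = u" "sym_word g (sym_word (inv g) u) = u"
proof -
  have bij: "bij g" using g square_symmetries_bij by (auto simp: cell_syms_def)
  note gi = cell_syms_inv[OF g]
  have "Kc (sym_word (inv g) (sym_word g u)) = Kc u"
    using cell_sym_word[OF gi sym_word_T[OF g u]] cell_sym_word[OF g u] bij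
    by (simp add: bij_is_inj image_inv_f_f)
  then show "sym_word (inv g) (sym_word g u) = u"
    using cell_subset_imp_eq[OF sym_word_T[OF gi sym_word_T[OF g u]] u] by simp
  have "Kc (sym_word g (sym_word (inv g) u)) = Kc u"
    using cell_sym_word[OF g sym_word_T[OF gi u]] cell_sym_word[OF gi u] bij
    by (simp add: bij_is_surj image_f_inv_f)
  then show "sym_word g (sym_word (inv g) u) = u"
    using cell_subset_imp_eq[OF sym_word_T[OF g sym_word_T[OF gi u]] u] by simp
qed

lemma full_sym_image:
  assumes g: "g \<in> cell_syms" and D: "full m D" shows "full m (sym_word g ` D)"
proof (rule fullI)
  have DT: "D \<subseteq> T m" "conn D" using D by (auto simp: full_def cross_def)
  show "sym_word g ` D \<subseteq> T m" using DT sym_word_T[OF g] by blast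
  show "conn (sym_word g ` D)"
  proof (rule conn_image[OF DT(2)])
    fix a b assume "a \<in> D" "b \<in> D" "touch a b"
    then show "touch (sym_word g a) (sym_word g b)"
      using cell_sym_word[OF g, of a m] cell_sym_word[OF g, of b m] DT by auto
  qed
  fix i and c :: real assume "c \<in> {1, -1}"
  moreover have "g \<in> square_symmetries" using g by (simp add: cell_syms_def)
  ultimately obtain u x where u: "u \<in> D" "x \<in> Kc u" "g x $ i = c"
    using full_lin[OF D, of g c i] by blast
  then have "g x \<in> Kc (sym_word g u)" using cell_sym_word[OF g, of u m] DT by auto
  then show "\<exists>a\<in>sym_word g ` D. \<exists>x\<in>Kc a. x $ i = c" using u by blast
qed

lemma full_sym_vimage:
  assumes g: "g \<in> cell_syms" and D: "full m D" shows "full m {u \<in> T m. sym_word g u \<in> D}"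
proof -
  have DT: "D \<subseteq> T m" using D by (auto simp: full_def cross_def)
  have "{u \<in> T m. sym_word g u \<in> D} = sym_word (inv g) ` D"
  proof (intro equalityI subsetI)
    fix u assume "u \<in> {u \<in> T m. sym_word g u \<in> D}"
    then show "u \<in> sym_word (inv g) ` D" using sym_word_inverse(1)[OF g, of u m] by (auto intro!: image_eqI[of u _ "sym_word g u"])
  next
    fix u assume "u \<in> sym_word (inv g) ` D"
    then obtain d where d: "d \<in> D" "u = sym_word (inv g) d" by blast
    then show "u \<in> {u \<in> T m. sym_word g u \<in> D}"
      using sym_word_inverse(2)[OF g, of d m] sym_word_T[OF cell_syms_inv[OF g], of d m] DT by auto
  qed
  then show ?thesis using full_sym_image[OF cell_syms_inv[OF g] D] by simp
qed

section \<open>Preimages of nets under the fold\<close>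

lemma touch_append: "touch u u' \<Longrightarrow> touch (w @ u) (w @ u')"
  unfolding cell_append by blast

text \<open>Adjacent squares are folded alike along their common side. A point of the first preimage
  on that side thus lies in a cell of the other square with the same folded word \<open>d'\<close>,
  and that cell belongs to the second preimage.\<close>

lemma fold_vimage_link:
  assumes r: "r \<in> T n" and wv: "(w, v) \<in> side_edges S f n" and D: "full j D"
  shows "\<exists>u\<in>{u \<in> T j. fold_word r (w @ u) \<in> D}. \<exists>u'\<in>{u \<in> T j. fold_word r (v @ u) \<in> D}. touch (w @ u) (v @ u')"
proof -
  have w: "w \<in> T n" and v: "v \<in> T n" using wv by (auto simp: side_edges_def)
  obtain k d where d: "d \<in> {1, -1}" "idx v k = idx w k + d" and o: "idx v (other k) = idx w (other k)"
    using wv by (rule side_edge_idx)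
  have Dw: "full j {u \<in> T j. fold_word r (w @ u) \<in> D}"
    using full_sym_vimage[OF rel_sym_in[OF r w] D] by (simp add: fold_word_append[OF r w])
  have DT: "D \<subseteq> T j" using D by (auto simp: full_def cross_def)
  define \<delta> :: int where "\<delta> = (if d = 1 then 1 else 0)"
  have "2 * real_of_int \<delta> - 1 \<in> {1, -1}" by (simp add: \<delta>_def)
  from full_lin[OF Dw lin_sym[OF w] this, of k] obtain u x where
    u: "u \<in> T j" "fold_word r (w @ u) \<in> D" and x: "x \<in> Kc u" "lin w x $ k = 2 * real_of_int \<delta> - 1" by blast
  have xK: "x \<in> K" using cell_K[OF u(1)] x(1) by blast
  then have xs: "x \<in> square" using K_square by blast
  define y where "y = W w x"
  have yu: "y \<in> Kc (w @ u)" using x(1) by (simp add: y_def cell_append)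
  have "co n y k = idx w k + \<delta>" using x(2) by (simp add: y_def co_W[OF w])
  moreover have "y \<in> W w ` square" using xs by (simp add: y_def)
  ultimately have "y \<in> W v ` square"
    using d o unfolding W_square_eq[OF w] W_square_eq[OF v] mem_Collect_eq all2_other[of _ k]
    by (auto simp: \<delta>_def)
  then obtain x' where x': "x' \<in> square" "y = W v x'" by blast
  define g where "g = rel_sym r v"
  have g: "g \<in> cell_syms" unfolding g_def by (rule rel_sym_in[OF r v])
  have bij: "bij g" using g square_symmetries_bij by (auto simp: cell_syms_def)
  define d' where "d' = fold_word r (w @ u)"
  have d': "d' \<in> D" "d' \<in> T j" using u(2) DT by (auto simp: d'_def)
  have "g x' = fold_on r y" unfolding g_def x'(2) using fold_on_W[OF r v x'(1)] by simp
  also have "fold_on r y \<in> Kc d'"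
    unfolding d'_def using cell_fold_word[OF r, of "w @ u" j] w u(1) yu words_append_iff by blast
  finally have "g x' \<in> Kc d'" .
  then have "inv g (g x') \<in> inv g ` Kc d'" by blast
  then have x'u: "x' \<in> Kc (sym_word (inv g) d')"
    using cell_sym_word[OF cell_syms_inv[OF g] d'(2)] bij by (simp add: bij_is_inj)
  define u' where "u' = sym_word (inv g) d'"
  have "u' \<in> T j" unfolding u'_def by (rule sym_word_T[OF cell_syms_inv[OF g] d'(2)])
  moreover have "fold_word r (v @ u') = d'"
    using sym_word_inverse(2)[OF g d'(2)] by (simp add: fold_word_append[OF r v] u'_def g_def)
  moreover have "y \<in> Kc (v @ u')" using x'u x'(2) by (simp add: cell_append u'_def)
  ultimately show ?thesis using u yu d'(1) by blast
qed

text \<open>Each square carries a copy of \<open>D\<close>; copies in adjacent squares are linked,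
  and strong connectivity of generation one joins all of them. The outer sides are reached because a
  copy meets all four sides of its own square.\<close>

lemma full_fold_vimage:
  assumes r: "r \<in> T 1" and D: "full j D"
  shows "full (Suc j) {a \<in> T (Suc j). fold_word r a \<in> D}"
    and "s \<in> S \<Longrightarrow> full j {u \<in> T j. fold_word r (s # u) \<in> D}"
proof -
  define A where "A = {a \<in> T (Suc j). fold_word r a \<in> D}"
  define D' where "D' w = {u \<in> T j. fold_word r (w @ u) \<in> D}" for w
  have full': "full j (D' w)" if "w \<in> T 1" for w
    using full_sym_vimage[OF rel_sym_in[OF r that] D] by (simp add: fold_word_append[OF r that] D'_def)
  then show "s \<in> S \<Longrightarrow> full j {u \<in> T j. fold_word r (s # u) \<in> D}"
    using word_singleton[of s] by (fastforce simp: D'_def)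
  have A_eq: "A = (\<Union>w\<in>T 1. (@) w ` D' w)"
  proof (intro equalityI subsetI)
    fix a assume a: "a \<in> A"
    then have a': "a \<in> T (1 + j)" by (simp add: A_def)
    have "drop 1 a \<in> D' (take 1 a)" using a words_drop[OF a'] by (simp add: D'_def A_def)
    then have "take 1 a @ drop 1 a \<in> (@) (take 1 a) ` D' (take 1 a)" by blast
    then show "a \<in> (\<Union>w\<in>T 1. (@) w ` D' w)" using words_take[OF a'] by auto
  next
    fix a assume "a \<in> (\<Union>w\<in>T 1. (@) w ` D' w)"
    then obtain w u where w: "w \<in> T 1" "u \<in> D' w" "a = w @ u" by blast
    then have "w @ u \<in> T (1 + j)" using words_append_iff unfolding D'_def by blast
    then show "a \<in> A" using w by (simp add: A_def D'_def)
  qed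
  have connw: "conn ((@) w ` D' w)" if "w \<in> T 1" for w
    using full'[OF that] touch_append by (intro conn_image) (auto simp: full_def cross_def)
  obtain w0 where w0: "w0 \<in> T 1" using T_nonempty by blast
  obtain u0 where u0: "u0 \<in> D' w0" using full_side[OF full'[OF w0], of 1] by blast
  let ?R = "{(u, v). u \<in> A \<and> v \<in> A \<and> touch u v}"
  have symR: "sym ?R" by (auto simp: sym_def)
  have within: "(a, b) \<in> ?R\<^sup>*" if "w \<in> T 1" "a \<in> (@) w ` D' w" "b \<in> (@) w ` D' w" for w a b
  proof -
    have "(a, b) \<in> {(u, v). u \<in> (@) w ` D' w \<and> v \<in> (@) w ` D' w \<and> touch u v}\<^sup>*"
      using connw[OF that(1)] that by (auto simp: conn_def)
    then show ?thesis by (rule rtrancl_touch_mono) (use that(1) A_eq in blast)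
  qed
  have reach: "\<forall>b\<in>(@) w ` D' w. (w0 @ u0, b) \<in> ?R\<^sup>*" if w: "w \<in> T 1" for w
  proof -
    have "(w0, w) \<in> (side_edges S f 1 \<union> (side_edges S f 1)\<inverse>)\<^sup>*"
      using strong_conn w0 w by (auto simp: strongly_connected_def graph_connected_def)
    then show ?thesis
    proof induction
      case base
      then show ?case using within[OF w0, of "w0 @ u0"] u0 by blast
    next
      case (step w v)
      have wv: "w \<in> T 1" "v \<in> T 1" using step.hyps(2) by (auto simp: side_edges_def)
      have "\<exists>a\<in>(@) w ` D' w. \<exists>b\<in>(@) v ` D' v. touch a b"
      proof (cases "(w, v) \<in> side_edges S f 1")
        case True
        from fold_vimage_link[OF r True D] show ?thesis unfolding D'_def by blast
      next
        case False
        then have "(v, w) \<in> side_edges S f 1" using step.hyps(2) by blast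
        from fold_vimage_link[OF r this D] show ?thesis unfolding D'_def by blast
      qed
      then obtain a b where ab: "a \<in> (@) w ` D' w" "b \<in> (@) v ` D' v" "touch a b" by blast
      have "a \<in> A" "b \<in> A" using ab wv A_eq by blast+
      then have "(a, b) \<in> ?R" using ab(3) by blast
      moreover have "(w0 @ u0, a) \<in> ?R\<^sup>*" using step.IH ab(1) by blast
      ultimately have "(w0 @ u0, b) \<in> ?R\<^sup>*" by (rule rtrancl_into_rtrancl[rotated])
      then show ?case using within[OF wv(2) ab(2)] by (meson rtrancl_trans)
    qed
  qed
  have "full (Suc j) A"
  proof (rule fullI)
    show "A \<subseteq> T (Suc j)" by (auto simp: A_def)
    show "conn A"
    proof (rule conn_from[of _ "w0 @ u0"])
      fix b assume "b \<in> A"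
      then obtain w where "w \<in> T 1" "b \<in> (@) w ` D' w" using A_eq by blast
      then show "(w0 @ u0, b) \<in> ?R\<^sup>*" using reach by blast
    qed
    fix i and c :: real assume c: "c \<in> {1, -1}"
    then obtain x where x: "x \<in> K" "x $ i = c"
      using nondeg unfolding non_degenerate_def square_side_def by blast
    then have "x \<in> (\<Union>w\<in>T 1. Kc w)" using K_eq_cells[of 1] by blast
    then obtain w x0 where w: "w \<in> T 1" "x0 \<in> K" "x = W w x0" by (auto simp: cell_def)
    from full_lin[OF full'[OF w(1)] lin_sym[OF w(1)] c] obtain u x1 where
      u: "u \<in> D' w" "x1 \<in> Kc u" "lin w x1 $ i = c" by blast
    have rng: "0 \<le> idx w i" "idx w i + 1 \<le> int N"
      using idx_range[OF w(1), of i] by auto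
    have cb: "idx w i \<le> co 1 x i" "co 1 x i \<le> idx w i + 1"
      using co_square_bounds[OF w(1), of x0 i] w K_square by auto
    \<comment> \<open>The square of \<open>w\<close> contains the boundary point \<open>x\<close>,
      so its own side facing that way lies on the boundary of the large square.\<close>
    have "co 1 (W w x1) i = co 1 x i"
    proof (cases "c = 1")
      case True
      then have "co 1 x i = real N" using x(2) by (simp add: grid_coord_def)
      moreover have "real_of_int (idx w i + 1) \<le> real_of_int (int N)" using rng(2) by (rule of_int_le_iff[THEN iffD2])
      ultimately have "real_of_int (idx w i) + 1 = co 1 x i" using cb by simp
      then show ?thesis using True u(3) by (simp add: co_W[OF w(1)] del: One_nat_def)
    next
      case False
      then have c': "c = -1" using c by simp
      then have "co 1 x i = 0" using x(2) by (simp add: grid_coord_def)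
      then show ?thesis using cb rng c' u(3) by (simp add: co_W[OF w(1)] del: One_nat_def)
    qed
    then have "W w x1 $ i = c" using x(2) N_pos by (simp add: grid_coord_def)
    moreover have "W w x1 \<in> Kc (w @ u)" using u(2) by (simp add: cell_append)
    moreover have "w @ u \<in> A" using w(1) u(1) A_eq by blast
    ultimately show "\<exists>a\<in>A. \<exists>x\<in>Kc a. x $ i = c" by blast
  qed
  then show "full (Suc j) {a \<in> T (Suc j). fold_word r a \<in> D}" by (simp add: A_def)
qed

end

section \<open>Short nets and the descent through the generations\<close>

context tiling_p
begin

text \<open>The factor \<open>2 powr p\<close> belongs to the union of two crossings,
  \<open>2 * real (card S) ^ 2\<close> to the comparison of moduli, counted once for each crossing,
  and \<open>real (card S) powr p\<close> to the fibres of the fold.\<close>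

definition Cn :: real where "Cn = 4 * 2 powr p * real (card S) ^ 2 * real (card S) powr p"

lemma Cn_nonneg: "0 \<le> Cn" by (simp add: Cn_def)

text \<open>The weight is pushed forward by a fold of generation one; short crossings for the two
  directions are taken there, and their union, connected by planarity, is lifted back. Lifting makes
  the trace of the net in every child full, which the descent requires.\<close>

lemma short_net:
  assumes \<rho>: "\<And>a. 0 \<le> \<rho> a"
  obtains A where "full (Suc j) A" "\<forall>s\<in>S. full j {u \<in> T j. s # u \<in> A}"
    "sum \<rho> A powr p * max_modulus (2 + j) \<le> Cn * mass (Suc j) \<rho>"
proof -
  obtain r where r: "r \<in> T 1" using T_nonempty by blast
  define \<sigma> where "\<sigma> u = (\<Sum>a\<in>{a \<in> T (Suc j). fold_word r a = u}. \<rho> a)" for u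
  have \<sigma>0: "0 \<le> \<sigma> u" for u unfolding \<sigma>_def by (intro sum_nonneg \<rho>)
  have FT: "fold_word r a \<in> T j" if "a \<in> T (Suc j)" for a using fold_word_T[OF r, of a j] that by simp
  obtain D1 where D1: "cross 1 j D1" "sum \<sigma> D1 powr p * modulus 1 j \<le> mass j \<sigma>" using short_crossing \<sigma>0 by metis
  obtain D2 where D2: "cross 2 j D2" "sum \<sigma> D2 powr p * modulus 2 j \<le> mass j \<sigma>" using short_crossing \<sigma>0 by metis
  define D where "D = D1 \<union> D2"
  have "full j D" unfolding full_def
  proof
    obtain a b where ab: "a \<in> D1" "b \<in> D2" "touch a b" using crossings_touch_aux[OF D1(1) D2(1)] by blast
    have "conn D" unfolding D_def using D1(1) D2(1) ab by (intro conn_Un[of _ _ a b]) (auto simp: cross_def)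
    moreover have "D \<subseteq> T j" using D1(1) D2(1) by (auto simp: D_def cross_def)
    ultimately show "cross i j D" for i
      using exhaust_2[of i] D1(1) D2(1) unfolding cross_def D_def by (elim disjE) blast+
  qed
  have finD: "finite D1" "finite D2" using D1 D2 cross_finite by auto
  define A where "A = {a \<in> T (Suc j). fold_word r a \<in> D}"
  have "full (Suc j) A" unfolding A_def by (rule full_fold_vimage(1)[OF r \<open>full j D\<close>])
  moreover have "\<forall>s\<in>S. full j {u \<in> T j. s # u \<in> A}"
  proof
    fix s assume that: "s \<in> S"
    have "{u \<in> T j. s # u \<in> A} = {u \<in> T j. fold_word r (s # u) \<in> D}"
      using that by (auto simp: A_def words_Cons_iff)
    then show "full j {u \<in> T j. s # u \<in> A}" using full_fold_vimage(2)[OF r \<open>full j D\<close> that] by simp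
  qed
  moreover have "sum \<rho> A powr p * max_modulus (2 + j) \<le> Cn * mass (Suc j) \<rho>"
  proof -
    let ?c = "2 * real (card S) ^ 2"
    have "sum \<rho> A = (\<Sum>u\<in>D. \<Sum>a\<in>{a \<in> A. fold_word r a = u}. \<rho> a)"
      using finD finite_T by (intro sum.group[symmetric]) (auto simp: A_def D_def)
    also have "\<dots> = sum \<sigma> D" unfolding \<sigma>_def by (intro sum.cong) (auto simp: A_def)
    also have "\<dots> \<le> sum \<sigma> D1 + sum \<sigma> D2"
      unfolding D_def using finD \<sigma>0 by (simp add: sum_Un sum_nonneg)
    finally have "sum \<rho> A powr p \<le> (sum \<sigma> D1 + sum \<sigma> D2) powr p"
      using \<rho> p_pos by (intro powr_mono2 sum_nonneg) auto
    also have "\<dots> \<le> 2 powr p * (sum \<sigma> D1 powr p + sum \<sigma> D2 powr p)"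
      using sum_powr_le[of "{True, False}" "\<lambda>b. if b then sum \<sigma> D1 else sum \<sigma> D2" p] p_pos \<sigma>0
      by (simp add: sum_nonneg)
    finally have 1: "sum \<rho> A powr p * max_modulus (2 + j) \<le>
        2 powr p * (sum \<sigma> D1 powr p * max_modulus (2 + j) + sum \<sigma> D2 powr p * max_modulus (2 + j))"
      using max_modulus_pos[of "2 + j"] by (simp add: distrib_right[symmetric] mult_right_mono)
    have 2: "sum \<sigma> E powr p * max_modulus (2 + j) \<le> ?c * mass j \<sigma>"
      if "sum \<sigma> E powr p * modulus i j \<le> mass j \<sigma>" for E i
    proof -
      have "sum \<sigma> E powr p * max_modulus (2 + j) \<le> sum \<sigma> E powr p * (?c * modulus i j)"
        using max_modulus_compare by (intro mult_left_mono) auto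
      also have "\<dots> = ?c * (sum \<sigma> E powr p * modulus i j)" by simp
      also have "\<dots> \<le> ?c * mass j \<sigma>" using that by (intro mult_left_mono) auto
      finally show ?thesis .
    qed
    have "mass j \<sigma> \<le> (\<Sum>u\<in>T j. real (card S) powr p * (\<Sum>a\<in>{a \<in> T (Suc j). fold_word r a = u}. \<rho> a powr p))"
      unfolding mass_def
    proof (rule sum_mono)
      fix u assume u: "u \<in> T j"
      let ?X = "{a \<in> T (Suc j). fold_word r a = u}"
      have fX: "finite ?X" using finite_T by simp
      have "card ?X \<le> card (T 1)"
      proof (rule card_inj_on_le[of "take 1"])
        show "inj_on (take 1) ?X"
        proof (rule inj_onI)
          fix a b assume a: "a \<in> ?X" and b: "b \<in> ?X" and e: "take 1 a = take 1 b"
          have a1: "a \<in> T (1 + j)" and b1: "b \<in> T (1 + j)" using a b by auto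
          have "take 1 a @ drop 1 b = b" unfolding e by (rule append_take_drop_id)
          then have "fold_word r (take 1 a @ drop 1 a) = fold_word r (take 1 a @ drop 1 b)"
            using a b by simp
          then have "drop 1 a = drop 1 b"
            using fold_word_bij[OF r words_take[OF a1], of j] words_drop[OF a1] words_drop[OF b1]
            unfolding bij_betw_def inj_on_def by blast
          then show "a = b" using e by (metis append_take_drop_id)
        qed
        show "take 1 ` ?X \<subseteq> T 1" using words_take[of _ S 1 j] by auto
      qed (rule finite_T)
      then have cX: "card ?X \<le> card S" by (simp add: card_words finite_S)
      have "\<sigma> u powr p \<le> real (card ?X) powr p * (\<Sum>a\<in>?X. \<rho> a powr p)"
        unfolding \<sigma>_def using fX \<rho> p_pos by (intro sum_powr_le) auto
      also have "\<dots> \<le> real (card S) powr p * (\<Sum>a\<in>?X. \<rho> a powr p)"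
        using cX p_pos by (intro mult_right_mono powr_mono2 sum_nonneg) auto
      finally show "\<sigma> u powr p \<le> real (card S) powr p * (\<Sum>a\<in>?X. \<rho> a powr p)" .
    qed
    also have "\<dots> = real (card S) powr p * (\<Sum>u\<in>T j. \<Sum>a\<in>{a \<in> T (Suc j). fold_word r a = u}. \<rho> a powr p)"
      by (simp add: sum_distrib_left)
    also have "(\<Sum>u\<in>T j. \<Sum>a\<in>{a \<in> T (Suc j). fold_word r a = u}. \<rho> a powr p) = mass (Suc j) \<rho>"
      unfolding mass_def using finite_T FT by (intro sum.group) auto
    finally have 3: "mass j \<sigma> \<le> real (card S) powr p * mass (Suc j) \<rho>" .
    have "sum \<rho> A powr p * max_modulus (2 + j) \<le> 2 powr p * (?c * mass j \<sigma> + ?c * mass j \<sigma>)"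
      using 1 2[OF D1(2)] 2[OF D2(2)] by (smt (verit) mult_left_mono powr_ge_zero)
    also have "\<dots> = 2 powr p * 2 * ?c * mass j \<sigma>" by simp
    also have "\<dots> \<le> 2 powr p * 2 * ?c * (real (card S) powr p * mass (Suc j) \<rho>)"
      using 3 by (intro mult_left_mono) auto
    also have "\<dots> = Cn * mass (Suc j) \<rho>" by (simp add: Cn_def)
    finally show ?thesis .
  qed
  ultimately show thesis by (rule that)
qed

text \<open>Up to constants, the length of a short crossing under a weight of unit mass.\<close>

definition G :: "nat \<Rightarrow> real" where "G j = max_modulus j powr (- 1 / p)"

lemma G_pos: "0 < G j" using max_modulus_pos[of j] by (simp add: G_def)

lemma short_net':
  assumes \<rho>: "\<And>a. 0 \<le> \<rho> a" and m: "mass (Suc j) \<rho> \<le> E"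
  obtains A where "full (Suc j) A" "\<forall>s\<in>S. full j {u \<in> T j. s # u \<in> A}"
    "sum \<rho> A \<le> (Cn * E) powr (1 / p) * G (2 + j)"
proof -
  obtain A where A: "full (Suc j) A" "\<forall>s\<in>S. full j {u \<in> T j. s # u \<in> A}"
    "sum \<rho> A powr p * max_modulus (2 + j) \<le> Cn * mass (Suc j) \<rho>"
    by (rule short_net[where \<rho> = \<rho> and j = j, OF \<rho>])
  note M = max_modulus_pos[of "2 + j"]
  have s0: "0 \<le> sum \<rho> A" by (intro sum_nonneg \<rho>)
  have "Cn * mass (Suc j) \<rho> \<le> Cn * E" using m Cn_nonneg by (rule mult_left_mono)
  then have "sum \<rho> A powr p \<le> Cn * E / max_modulus (2 + j)" using A(3) M by (simp add: field_simps)
  then have "(sum \<rho> A powr p) powr (1 / p) \<le> (Cn * E / max_modulus (2 + j)) powr (1 / p)"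
    using p_pos by (intro powr_mono2) auto
  moreover have "(sum \<rho> A powr p) powr (1 / p) = sum \<rho> A" using p_pos s0 by (simp add: powr_powr)
  moreover have "(Cn * E / max_modulus (2 + j)) powr (1 / p) = (Cn * E) powr (1 / p) * G (2 + j)"
  proof -
    have "0 \<le> Cn * E" using m mass_nonneg[of "Suc j" \<rho>] Cn_nonneg by simp
    then show ?thesis using M by (simp add: powr_divide G_def powr_minus_divide)
  qed
  ultimately have "sum \<rho> A \<le> (Cn * E) powr (1 / p) * G (2 + j)" by simp
  then show thesis using that A by blast
qed

lemma mass_Cons:
  assumes "s \<in> S" "\<And>a. 0 \<le> \<rho> a" shows "mass j (\<lambda>u. \<rho> (s # u)) \<le> mass (Suc j) \<rho>"
proof -
  have "mass j (\<lambda>u. \<rho> (s # u)) = (\<Sum>a\<in>(#) s ` T j. \<rho> a powr p)"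
    unfolding mass_def by (subst sum.reindex) auto
  also have "\<dots> \<le> mass (Suc j) \<rho>"
    unfolding mass_def using finite_T assms by (intro sum_mono2) (auto simp: words_Cons_iff)
  finally show ?thesis .
qed

text \<open>Nets of consecutive generations meet by planarity, so the oscillation is controlled by a
  sum over the generations.\<close>

lemma descend_nets:
  assumes "\<And>a. 0 \<le> \<rho> a" "\<And>a b. a \<in> T m \<Longrightarrow> b \<in> T m \<Longrightarrow> touch a b \<Longrightarrow> \<bar>h a - h b\<bar> \<le> \<rho> a"
    "mass m \<rho> \<le> E" "full m B" "a \<in> T m"
  shows "\<exists>b\<in>B. \<bar>h a - h b\<bar> \<le> 2 * (Cn * E) powr (1 / p) * (\<Sum>j<m. G (2 + j))"
  using assms
proof (induction m arbitrary: h \<rho> a B)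
  case 0
  obtain b where b: "b \<in> B" using full_side[OF 0(4), of 1] by blast
  have "cross 1 0 B" using 0(4) by (simp add: full_def)
  then have "B \<subseteq> {[]}" by (simp add: cross_def)
  then have "a = b" using b 0(5) by auto
  then show ?case using b by auto
next
  case (Suc j)
  let ?e = "\<lambda>j. (Cn * E) powr (1 / p) * G (2 + j)"
  obtain A where A: "full (Suc j) A" "\<forall>s\<in>S. full j {u \<in> T j. s # u \<in> A}" "sum \<rho> A \<le> ?e j"
    by (rule short_net'[where \<rho> = \<rho> and j = j and E = E, OF Suc.prems(1,3)])
  have AT: "A \<subseteq> T (Suc j)" "conn A" and BT: "B \<subseteq> T (Suc j)" using A(1) Suc.prems(4) by (auto simp: full_def cross_def)
  have finA: "finite A" using AT finite_T finite_subset by blast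
  obtain s a' where a: "a = s # a'" "s \<in> S" "a' \<in> T j" using Suc.prems(5) by (rule words_SucE)
  \<comment> \<open>The induction hypothesis is applied inside the child \<open>s\<close>, with the
    trace of the net \<open>A\<close> as target; hence the target \<open>B\<close> has to be an
    arbitrary full set.\<close>
  have "\<exists>b\<in>{u \<in> T j. s # u \<in> A}. \<bar>h (s # a') - h (s # b)\<bar> \<le> 2 * (Cn * E) powr (1 / p) * (\<Sum>j<j. G (2 + j))"
  proof (rule Suc.IH[of "\<lambda>u. \<rho> (s # u)" "\<lambda>u. h (s # u)"])
    fix u v assume uv: "u \<in> T j" "v \<in> T j" "touch u v"
    have "touch ([s] @ u) ([s] @ v)" using uv(3) by (rule touch_append)
    then show "\<bar>h (s # u) - h (s # v)\<bar> \<le> \<rho> (s # u)"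
      using Suc.prems(2)[of "s # u" "s # v"] uv a(2) by (simp add: words_Cons_iff)
  next
    show "mass j (\<lambda>u. \<rho> (s # u)) \<le> E" using mass_Cons[OF a(2), of \<rho> j, OF Suc.prems(1)] Suc.prems(3) by linarith
  qed (use Suc.prems(1) A(2) a in auto)
  then obtain u where u: "s # u \<in> A" "\<bar>h a - h (s # u)\<bar> \<le> 2 * (Cn * E) powr (1 / p) * (\<Sum>j<j. G (2 + j))"
    using a by auto
  obtain c b where cb: "c \<in> A" "b \<in> B" "touch c b"
  proof -
    have "cross 1 (Suc j) A" "cross (other 1) (Suc j) B" using A(1) Suc.prems(4) by (simp_all add: full_def)
    from crossings_touch[OF this] show thesis using that by blast
  qed
  \<comment> \<open>One copy of the weight of \<open>A\<close> pays for moving along the net, a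
    second one for the step from \<open>c\<close> into \<open>B\<close>; hence the factor 2.\<close>
  have "\<bar>h (s # u) - h c\<bar> \<le> sum \<rho> A"
    by (rule conn_abs_diff[OF AT(2) finA u(1) cb(1)]) (use AT Suc.prems(1,2) in blast)+
  moreover have "\<bar>h c - h b\<bar> \<le> \<rho> c" using Suc.prems(2)[of c b] cb AT BT by blast
  moreover have "\<rho> c \<le> sum \<rho> A" using cb(1) finA Suc.prems(1) by (intro member_le_sum) auto
  ultimately have "\<bar>h a - h b\<bar> \<le> 2 * (Cn * E) powr (1 / p) * (\<Sum>j<j. G (2 + j)) + 2 * ?e j"
    using u(2) A(3) by linarith
  also have "\<dots> = 2 * (Cn * E) powr (1 / p) * (\<Sum>j<Suc j. G (2 + j))" by (simp add: algebra_simps)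
  finally show ?case using cb(2) by blast
qed

text \<open>Both points descend to one common net, at the cost of twice the sum each, and moving
  inside the net costs at most one more term; 6 rounds up the total.\<close>

lemma oscillation_bound:
  assumes \<rho>: "\<And>a. 0 \<le> \<rho> a" and h: "\<And>a b. a \<in> T m \<Longrightarrow> b \<in> T m \<Longrightarrow> touch a b \<Longrightarrow> \<bar>h a - h b\<bar> \<le> \<rho> a"
    and E: "mass m \<rho> \<le> E" and ab: "a \<in> T m" "b \<in> T m"
  shows "\<bar>h a - h b\<bar> \<le> 6 * (Cn * E) powr (1 / p) * (\<Sum>j<m. G (2 + j))"
proof (cases m)
  case 0
  then show ?thesis using ab by simp
next
  case (Suc j)
  let ?X = "(Cn * E) powr (1 / p)" and ?s = "\<Sum>j<m. G (2 + j)"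
  obtain A where A: "full (Suc j) A" "sum \<rho> A \<le> ?X * G (2 + j)"
    by (rule short_net'[where \<rho> = \<rho> and j = j and E = E, OF \<rho> E[unfolded Suc]])
  note A = A[folded Suc]
  have AT: "A \<subseteq> T m" "conn A" using A(1) by (auto simp: full_def cross_def)
  have finA: "finite A" using AT finite_T finite_subset by blast
  obtain c where c: "c \<in> A" "\<bar>h a - h c\<bar> \<le> 2 * ?X * ?s"
    using descend_nets[OF \<rho> h E A(1) ab(1)] by blast
  obtain d where d: "d \<in> A" "\<bar>h b - h d\<bar> \<le> 2 * ?X * ?s"
    using descend_nets[OF \<rho> h E A(1) ab(2)] by blast
  have "\<bar>h c - h d\<bar> \<le> sum \<rho> A" by (rule conn_abs_diff[OF AT(2) finA c(1) d(1)]) (use AT \<rho> h in blast)+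
  moreover have "?X * G (2 + j) \<le> ?X * ?s"
    using Suc G_pos less_imp_le by (intro mult_left_mono member_le_sum) auto
  moreover have "0 \<le> ?X * ?s" using G_pos less_imp_le by (intro mult_nonneg_nonneg sum_nonneg) auto
  ultimately show ?thesis using c(2) d(2) A(2) by linarith
qed

end

section \<open>Conductive homogeneity\<close>

text \<open>Growth by a fixed factor over \<open>q\<close> steps makes the earlier blocks a
  geometric series, and losing at most the factor \<open>L\<close> per step makes the last
  \<open>q\<close> terms comparable with \<open>G l\<close>. The constant \<open>C\<close> solves
  \<open>C * \<theta> + real q * L ^ q = C\<close>.\<close>

lemma geometric_sum_bound:
  fixes G :: "nat \<Rightarrow> real"
  assumes pos: "\<And>i. 0 < G i" and L: "1 \<le> L" "\<And>i. G i \<le> L * G (Suc i)"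
    and \<theta>: "0 \<le> \<theta>" "\<theta> < 1" "\<And>i. G i \<le> \<theta> * G (q + i)" and q: "1 \<le> q"
  shows "(\<Sum>i\<le>l. G i) \<le> real q * L ^ q / (1 - \<theta>) * G l"
proof (induction l rule: less_induct)
  case (less l)
  let ?C = "real q * L ^ q / (1 - \<theta>)"
  have up: "G i \<le> L ^ d * G (i + d)" for i d
  proof (induction d)
    case (Suc d)
    have "L ^ d * G (i + d) \<le> L ^ d * (L * G (Suc (i + d)))" using L by (intro mult_left_mono) auto
    then show ?case using Suc by (simp add: mult_ac)
  qed simp
  have up': "G i \<le> L ^ q * G l" if "i \<le> l" "l < i + q" for i
  proof -
    have "G i \<le> L ^ (l - i) * G l" using up[of i "l - i"] that by simp
    also have "\<dots> \<le> L ^ q * G l" using L(1) pos[of l] that by (intro mult_right_mono power_increasing) auto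
    finally show ?thesis .
  qed
  have C: "real q * L ^ q \<le> ?C"
  proof -
    have "real q * L ^ q * (1 - \<theta>) \<le> real q * L ^ q * 1" using \<theta> L(1) by (intro mult_left_mono) auto
    then show ?thesis using \<theta> by (simp add: le_divide_eq)
  qed
  show ?case
  proof (cases "l < q")
    case True
    have "(\<Sum>i\<le>l. G i) \<le> (\<Sum>i\<le>l. L ^ q * G l)" using up' True by (intro sum_mono) auto
    also have "\<dots> = real (Suc l) * (L ^ q * G l)" by simp
    also have "\<dots> \<le> real q * (L ^ q * G l)" using True L(1) pos[of l] by (intro mult_right_mono) auto
    also have "\<dots> = (real q * L ^ q) * G l" by simp
    also have "\<dots> \<le> ?C * G l" using C pos[of l] by (intro mult_right_mono) auto
    finally show ?thesis .
  next
    case False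
    have split: "{..l} = {..l - q} \<union> {l - q<..l}" by auto
    have "(\<Sum>i\<le>l. G i) = (\<Sum>i\<le>l - q. G i) + (\<Sum>i\<in>{l - q<..l}. G i)"
      unfolding split by (rule sum.union_disjoint) auto
    also have "(\<Sum>i\<le>l - q. G i) \<le> ?C * G (l - q)" using less.IH[of "l - q"] False q by simp
    also have "?C * G (l - q) \<le> ?C * (\<theta> * G l)"
      using \<theta>(3)[of "l - q"] False \<theta>(2) L(1) by (intro mult_left_mono) auto
    also have "(\<Sum>i\<in>{l - q<..l}. G i) \<le> (\<Sum>i\<in>{l - q<..l}. L ^ q * G l)"
      using up' False by (intro sum_mono) auto
    also have "\<dots> = real q * (L ^ q * G l)" using False by simp
    also have "?C * (\<theta> * G l) + real q * (L ^ q * G l) = ?C * G l"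
      using \<theta>(2) by (simp add: field_simps)
    finally show ?thesis by simp
  qed
qed

lemma mean_diff_le:
  assumes "finite A" "A \<noteq> {}" "finite B" "B \<noteq> {}" "\<And>a b. a \<in> A \<Longrightarrow> b \<in> B \<Longrightarrow> \<bar>h a - h b\<bar> \<le> c"
  shows "\<bar>mean A h - mean B h\<bar> \<le> c"
proof -
  have cA: "0 < real (card A)" and cB: "0 < real (card B)" using assms by (simp_all add: card_gt_0_iff)
  have "mean A h - mean B h = (\<Sum>a\<in>A. \<Sum>b\<in>B. h a - h b) / (real (card A) * real (card B))"
    using cA cB by (simp add: mean_def sum_subtractf sum_distrib_left[symmetric] sum_distrib_right[symmetric] field_simps)
  also have "\<bar>\<dots>\<bar> \<le> (real (card A) * real (card B) * c) / (real (card A) * real (card B))"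
  proof -
    have "\<bar>\<Sum>a\<in>A. \<Sum>b\<in>B. h a - h b\<bar> \<le> (\<Sum>a\<in>A. \<bar>\<Sum>b\<in>B. h a - h b\<bar>)" by (rule sum_abs)
    also have "\<dots> \<le> (\<Sum>a\<in>A. \<Sum>b\<in>B. \<bar>h a - h b\<bar>)" by (intro sum_mono sum_abs)
    also have "\<dots> \<le> (\<Sum>a\<in>A. \<Sum>b\<in>B. c)" using assms(5) by (intro sum_mono) auto
    finally have "\<bar>\<Sum>a\<in>A. \<Sum>b\<in>B. h a - h b\<bar> \<le> real (card A) * real (card B) * c" by simp
    then have "\<bar>\<Sum>a\<in>A. \<Sum>b\<in>B. h a - h b\<bar> / (real (card A) * real (card B))
      \<le> (real (card A) * real (card B) * c) / (real (card A) * real (card B))"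
      by (rule divide_right_mono) simp
    moreover have "\<bar>(\<Sum>a\<in>A. \<Sum>b\<in>B. h a - h b) / (real (card A) * real (card B))\<bar>
      = \<bar>\<Sum>a\<in>A. \<Sum>b\<in>B. h a - h b\<bar> / (real (card A) * real (card B))"
      by (simp only: abs_divide abs_mult abs_of_nat)
    ultimately show ?thesis by (simp only:)
  qed
  also have "\<dots> = c" using cA cB by simp
  finally show ?thesis .
qed

lemma dim_AR_nonneg: "0 \<le> dim_AR X d"
  unfolding dim_AR_def by (rule Inf_greatest) auto

section \<open>Energy, neighbour disparity and the conclusion\<close>

context tiling_p
begin

lemma energy_pullback:
  assumes x: "x \<in> T n" and A: "\<And>b. b \<in> T j \<Longrightarrow> x @ b \<in> A" and fin: "finite A"
  shows "en j (T j) (\<lambda>b. h (x @ b)) \<le> en (n + j) A h"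
proof -
  let ?F = "\<lambda>(a, b). (x @ a, x @ b)"
  have inj: "inj_on ?F (meet_edges K S f j \<inter> T j \<times> T j)" by (auto simp: inj_on_def)
  have "(\<Sum>(a, b)\<in>meet_edges K S f j \<inter> T j \<times> T j. \<bar>h (x @ a) - h (x @ b)\<bar> powr p)
    = (\<Sum>(a, b)\<in>?F ` (meet_edges K S f j \<inter> T j \<times> T j). \<bar>h a - h b\<bar> powr p)"
    by (subst sum.reindex[OF inj]) (auto intro!: sum.cong)
  also have "\<dots> \<le> (\<Sum>(a, b)\<in>meet_edges K S f (n + j) \<inter> A \<times> A. \<bar>h a - h b\<bar> powr p)"
  proof (rule sum_mono2)
    show "finite (meet_edges K S f (n + j) \<inter> A \<times> A)" using fin by simp
    show "?F ` (meet_edges K S f j \<inter> T j \<times> T j) \<subseteq> meet_edges K S f (n + j) \<inter> A \<times> A"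
    proof clarify
      fix a b assume "(a, b) \<in> meet_edges K S f j" "a \<in> T j" "b \<in> T j"
      moreover from this have "touch (x @ a) (x @ b)" by (intro touch_append) (simp add: meet_edges_def)
      ultimately show "(x @ a, x @ b) \<in> meet_edges K S f (n + j) \<inter> A \<times> A"
        using A x words_append_iff[OF x] by (simp add: meet_edges_def)
    qed
  qed auto
  finally show ?thesis by (simp add: energy_def)
qed

text \<open>A vertex weight dominating the differences across all edges at \<open>a\<close>; it
  converts edge energies into masses.\<close>

definition gradient :: "nat \<Rightarrow> ((nat \<times> nat) list \<Rightarrow> real) \<Rightarrow> (nat \<times> nat) list \<Rightarrow> real" where
  "gradient m h a = (\<Sum>b\<in>{b \<in> T m. touch a b}. \<bar>h a - h b\<bar>)"

lemma mass_gradient: "mass m (gradient m h) \<le> 2 * 9 powr p * en m (T m) h"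
proof -
  let ?N = "\<lambda>a. {b \<in> T m. touch a b}"
  have "mass m (gradient m h) \<le> (\<Sum>a\<in>T m. 9 powr p * (\<Sum>b\<in>?N a. \<bar>h a - h b\<bar> powr p))"
    unfolding mass_def
  proof (rule sum_mono)
    fix a assume a: "a \<in> T m"
    have "card (?N a) \<le> card {v \<in> T m. near a v}"
      using finite_T touch_near[OF a] by (intro card_mono) auto
    then have c: "card (?N a) \<le> 9" using card_near[OF a] by linarith
    have "gradient m h a powr p \<le> real (card (?N a)) powr p * (\<Sum>b\<in>?N a. \<bar>h a - h b\<bar> powr p)"
      unfolding gradient_def using finite_T p_pos by (intro sum_powr_le) auto
    also have "\<dots> \<le> 9 powr p * (\<Sum>b\<in>?N a. \<bar>h a - h b\<bar> powr p)"
      using c p_pos by (intro mult_right_mono powr_mono2 sum_nonneg) auto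
    finally show "gradient m h a powr p \<le> 9 powr p * (\<Sum>b\<in>?N a. \<bar>h a - h b\<bar> powr p)" .
  qed
  also have "\<dots> = 9 powr p * (\<Sum>(a, b)\<in>Sigma (T m) ?N. \<bar>h a - h b\<bar> powr p)"
    unfolding sum_distrib_left[symmetric] using finite_T by (subst sum.Sigma) auto
  also have "(\<Sum>(a, b)\<in>Sigma (T m) ?N. \<bar>h a - h b\<bar> powr p) = (\<Sum>(a, b)\<in>meet_edges K S f m \<inter> T m \<times> T m. \<bar>h a - h b\<bar> powr p)"
    using finite_T by (intro sum.mono_neutral_right finite_SigmaI) (auto simp: meet_edges_def)
  finally show ?thesis by (simp add: energy_def)
qed

lemma oscillation_energy:
  assumes "en m (T m) h \<le> E" "a \<in> T m" "b \<in> T m"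
  shows "\<bar>h a - h b\<bar> \<le> 6 * (Cn * (2 * 9 powr p * E)) powr (1 / p) * (\<Sum>j<m. G (2 + j))"
proof (rule oscillation_bound[of "gradient m h"])
  show "0 \<le> gradient m h a" for a by (simp add: gradient_def sum_nonneg)
  show "\<bar>h a - h b\<bar> \<le> gradient m h a" if "a \<in> T m" "b \<in> T m" "touch a b" for a b
    unfolding gradient_def using that finite_T by (intro member_le_sum) auto
  have "2 * 9 powr p * en m (T m) h \<le> 2 * 9 powr p * E" using assms(1) by (intro mult_left_mono) auto
  then show "mass m (gradient m h) \<le> 2 * 9 powr p * E" using mass_gradient[of m h] by linarith
qed (rule assms)+

text \<open>The 12 is twice the 6 of \<open>oscillation_energy\<close>: passing between touching
  subcells uses the oscillation in each of them.\<close>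

definition Cd :: real where "Cd = 12 * (Cn * (2 * 9 powr p)) powr (1 / p)"

lemma Cd_nonneg: "0 \<le> Cd" by (simp add: Cd_def)

text \<open>The two cells are cut into subcells of relative generation \<open>k\<close>, a connected
  family of at most \<open>2 * card S ^ k\<close> members. Inside a subcell the oscillation bound
  applies, and the passage to a touching subcell adds a single edge. The free parameter
  \<open>k\<close> allows the generations to be matched with those in the conductance.\<close>

lemma pair_oscillation:
  assumes wv: "(w, v) \<in> meet_edges K S f n"
    and E: "E = en (n + (k + j)) (descendants S (k + j) w \<union> descendants S (k + j) v) h"
    and ab: "a \<in> descendants S (k + j) w \<union> descendants S (k + j) v" "b \<in> descendants S (k + j) w \<union> descendants S (k + j) v"
  shows "\<bar>h a - h b\<bar> \<le> (2 * real (card S) ^ k + 1) * (Cd * (\<Sum>i<j. G (2 + i)) + 1) * E powr (1 / p)"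
proof -
  have w: "w \<in> T n" and v: "v \<in> T n" and t: "touch w v" using wv by (auto simp: meet_edges_def)
  define A where "A = descendants S (k + j) w \<union> descendants S (k + j) v"
  define X where "X = (@) w ` T k \<union> (@) v ` T k"
  define \<Omega> where "\<Omega> = 6 * (Cn * (2 * 9 powr p * E)) powr (1 / p) * (\<Sum>i<j. G (2 + i))"
  have E0: "0 \<le> E" unfolding E by (rule energy_nonneg)
  have AT: "A \<subseteq> T (n + (k + j))" using w v by (auto simp: A_def descendants_def words_def)
  have finA: "finite A" using AT finite_T finite_subset by blast
  have XT: "X \<subseteq> T (n + k)" using w v words_append_iff unfolding X_def by blast
  have finX: "finite X" by (simp add: X_def finite_T)
  have XA: "x @ b \<in> A" if "x \<in> X" "b \<in> T j" for x b
  proof -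
    have "u @ b \<in> T (k + j)" if "u \<in> T k" for u using words_append_iff[OF that] \<open>b \<in> T j\<close> by blast
    then show ?thesis using that unfolding X_def A_def descendants_eq[OF w] descendants_eq[OF v] by auto
  qed
  have split: "\<exists>x\<in>X. \<exists>b\<in>T j. a = x @ b" if "a \<in> A" for a
  proof -
    have "\<exists>y\<in>{w, v}. \<exists>c\<in>T (k + j). a = y @ c"
      using that unfolding A_def descendants_eq[OF w] descendants_eq[OF v] by auto
    then obtain y c where y: "y \<in> {w, v}" "c \<in> T (k + j)" "a = y @ c" by blast
    have "y @ take k c \<in> X" using y words_take[OF y(2)] by (auto simp: X_def)
    moreover have "a = (y @ take k c) @ drop k c" using y by simp
    ultimately show ?thesis using words_drop[OF y(2)] by blast
  qed
  have cell: "\<bar>h (x @ c) - h (x @ d)\<bar> \<le> \<Omega>" if x: "x \<in> X" and "c \<in> T j" "d \<in> T j" for x c d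
  proof -
    have "en j (T j) (\<lambda>b. h (x @ b)) \<le> en ((n + k) + j) A h"
      using x XT XA finA by (intro energy_pullback) auto
    then have "en j (T j) (\<lambda>b. h (x @ b)) \<le> E" by (simp add: E A_def add.assoc)
    then show ?thesis unfolding \<Omega>_def using that by (intro oscillation_energy[of _ "\<lambda>b. h (x @ b)"])
  qed
  have edge: "\<bar>h c - h d\<bar> \<le> E powr (1 / p)" if cd: "c \<in> A" "d \<in> A" "touch c d" for c d
  proof (cases "c = d")
    case False
    let ?M = "meet_edges K S f (n + (k + j)) \<inter> A \<times> A"
    have sub: "{(c, d), (d, c)} \<subseteq> ?M" using cd AT False by (auto simp: meet_edges_def)
    have "2 * \<bar>h c - h d\<bar> powr p = (\<Sum>(a, b)\<in>{(c, d), (d, c)}. \<bar>h a - h b\<bar> powr p)"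
      using False by (simp add: abs_minus_commute)
    also have "\<dots> \<le> (\<Sum>(a, b)\<in>?M. \<bar>h a - h b\<bar> powr p)" using sub finA by (intro sum_mono2) auto
    also have "\<dots> = 2 * E" by (simp add: E A_def energy_def)
    finally have "\<bar>h c - h d\<bar> powr p \<le> E" by simp
    then have "(\<bar>h c - h d\<bar> powr p) powr (1 / p) \<le> E powr (1 / p)" using p_pos by (intro powr_mono2) auto
    then show ?thesis using p_pos by (simp add: powr_powr)
  qed simp
  \<comment> \<open>A common base word in all subcells reduces the estimate to a function on
    \<open>X\<close>.\<close>
  obtain b0 where b0: "b0 \<in> T j" using T_nonempty by blast
  have link: "\<bar>h (x @ b0) - h (y @ b0)\<bar> \<le> 2 * \<Omega> + E powr (1 / p)" if x: "x \<in> X" and y: "y \<in> X" and xy: "touch x y" for x y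
  proof -
    obtain z where "z \<in> Kc x" "z \<in> Kc y" using xy by blast
    then obtain c d where cd: "c \<in> T j" "d \<in> T j" "z \<in> Kc (x @ c)" "z \<in> Kc (y @ d)"
      using cell_children[of x j] cell_children[of y j] by blast
    then have "touch (x @ c) (y @ d)" by blast
    then have "\<bar>h (x @ c) - h (y @ d)\<bar> \<le> E powr (1 / p)" using edge XA x y cd by blast
    moreover have "\<bar>h (x @ b0) - h (x @ c)\<bar> \<le> \<Omega>" "\<bar>h (y @ d) - h (y @ b0)\<bar> \<le> \<Omega>" using cell x y b0 cd by blast+
    ultimately show ?thesis by linarith
  qed
  have "conn X"
  proof -
    have cw: "conn ((@) y ` T k)" for y by (rule conn_image[OF conn_T]) (rule touch_append)
    obtain z where "z \<in> Kc w" "z \<in> Kc v" using t by blast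
    then obtain c d where "c \<in> T k" "d \<in> T k" "z \<in> Kc (w @ c)" "z \<in> Kc (v @ d)"
      using cell_children[of w k] cell_children[of v k] by blast
    then show ?thesis unfolding X_def by (intro conn_Un[OF cw cw, of "w @ c" _ "v @ d"]) auto
  qed
  have \<Omega>0: "0 \<le> \<Omega>" using G_pos less_imp_le unfolding \<Omega>_def by (intro mult_nonneg_nonneg sum_nonneg) auto
  obtain x c where x: "x \<in> X" "c \<in> T j" "a = x @ c" using split ab(1) unfolding A_def by blast
  obtain y d where y: "y \<in> X" "d \<in> T j" "b = y @ d" using split ab(2) unfolding A_def by blast
  have "\<bar>h (x @ b0) - h (y @ b0)\<bar> \<le> (\<Sum>x\<in>X. 2 * \<Omega> + E powr (1 / p))"
    by (rule conn_abs_diff[OF \<open>conn X\<close> finX x(1) y(1), of "\<lambda>x. h (x @ b0)"]) (use link \<Omega>0 in auto)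
  also have "\<dots> = real (card X) * (2 * \<Omega> + E powr (1 / p))" by simp
  also have "\<dots> \<le> 2 * real (card S) ^ k * (2 * \<Omega> + E powr (1 / p))"
  proof (rule mult_right_mono)
    have "card X \<le> card ((@) w ` T k) + card ((@) v ` T k)" unfolding X_def by (rule card_Un_le)
    also have "\<dots> \<le> card (T k) + card (T k)" using finite_T by (intro add_mono card_image_le) auto
    also have "\<dots> = 2 * card S ^ k" by (simp add: card_words finite_S)
    finally show "real (card X) \<le> 2 * real (card S) ^ k"
      by (metis of_nat_le_iff of_nat_mult of_nat_numeral of_nat_power)
  qed (use \<Omega>0 in auto)
  finally have "\<bar>h (x @ b0) - h (y @ b0)\<bar> \<le> 2 * real (card S) ^ k * (2 * \<Omega> + E powr (1 / p))" .
  moreover have "\<bar>h a - h (x @ b0)\<bar> \<le> \<Omega>" "\<bar>h (y @ b0) - h b\<bar> \<le> \<Omega>" using cell x y b0 by auto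
  moreover have "0 \<le> E powr (1 / p)" by simp
  ultimately have "\<bar>h a - h b\<bar> \<le> 2 * real (card S) ^ k * (2 * \<Omega> + E powr (1 / p)) + (2 * \<Omega> + E powr (1 / p))"
    by linarith
  also have "\<dots> = (2 * real (card S) ^ k + 1) * (2 * \<Omega> + E powr (1 / p))" by (simp add: algebra_simps)
  also have "2 * \<Omega> + E powr (1 / p) = (Cd * (\<Sum>i<j. G (2 + i)) + 1) * E powr (1 / p)"
  proof -
    have "(Cn * (2 * 9 powr p * E)) powr (1 / p) = (Cn * (2 * 9 powr p)) powr (1 / p) * E powr (1 / p)"
      using Cn_nonneg E0 by (simp add: powr_mult flip: mult.assoc)
    then show ?thesis by (simp add: \<Omega>_def Cd_def algebra_simps)
  qed
  finally show ?thesis by (simp add: mult.assoc)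
qed

lemma neighbour_disparity_bound:
  "neighbour_disparity K S f p (k + j) \<le> ennreal (((2 * real (card S) ^ k + 1) * (Cd * (\<Sum>i<j. G (2 + i)) + 1)) powr p)"
proof -
  define B where "B = (2 * real (card S) ^ k + 1) * (Cd * (\<Sum>i<j. G (2 + i)) + 1)"
  have B0: "0 \<le> B"
    unfolding B_def using Cd_nonneg G_pos less_imp_le by (intro mult_nonneg_nonneg add_nonneg_nonneg sum_nonneg) auto
  have "neighbour_disparity K S f p (k + j) \<le> ennreal (B powr p)"
    unfolding neighbour_disparity_def
  proof (intro SUP_least, clarify, intro SUP_least)
    fix n w v and h :: "(nat \<times> nat) list \<Rightarrow> real" assume wv: "(w, v) \<in> meet_edges K S f n"
      and h: "h \<in> {h. \<not> h constant_on (descendants S (k + j) w \<union> descendants S (k + j) v)}"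
    define A where "A = descendants S (k + j) w \<union> descendants S (k + j) v"
    define E where "E = en (n + (k + j)) A h"
    have w: "w \<in> T n" and v: "v \<in> T n" using wv by (auto simp: meet_edges_def)
    have osc: "\<bar>h a - h b\<bar> \<le> B * E powr (1 / p)" if "a \<in> A" "b \<in> A" for a b
      using pair_oscillation[OF wv _ that[unfolded A_def], of E] unfolding E_def A_def B_def by blast
    have E0: "0 \<le> E" unfolding E_def by (rule energy_nonneg)
    \<comment> \<open>At zero energy the oscillation bound would make \<open>h\<close> constant, so
      the denominator never vanishes.\<close>
    have "E \<noteq> 0"
    proof
      assume "E = 0"
      then have "h a = h b" if "a \<in> A" "b \<in> A" for a b using osc[OF that] by simp
      then have "h constant_on A" unfolding constant_on_def by blast
      then show False using h by (simp add: A_def)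
    qed
    then have Epos: "0 < E" using E0 by simp
    have ne: "descendants S (k + j) x \<noteq> {}" "finite (descendants S (k + j) x)" if "x \<in> T n" for x
      using T_nonempty[of "k + j"] finite_T by (simp_all add: descendants_eq[OF that])
    have "\<bar>mean (descendants S (k + j) w) h - mean (descendants S (k + j) v) h\<bar> \<le> B * E powr (1 / p)"
      using ne[OF w] ne[OF v] osc by (intro mean_diff_le) (auto simp: A_def)
    then have "\<bar>mean (descendants S (k + j) w) h - mean (descendants S (k + j) v) h\<bar> powr p \<le> (B * E powr (1 / p)) powr p"
      using p_pos by (intro powr_mono2) auto
    also have "\<dots> = B powr p * E" using B0 Epos p_pos by (simp add: powr_mult powr_powr)
    finally have le: "\<bar>mean (descendants S (k + j) w) h - mean (descendants S (k + j) v) h\<bar> powr p / E \<le> B powr p"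
      using Epos by (simp add: field_simps)
    show "ennreal (\<bar>mean (descendants S (k + j) w) h - mean (descendants S (k + j) v) h\<bar> powr p) /
       ennreal (en (n + (k + j)) (descendants S (k + j) w \<union> descendants S (k + j) v) h) \<le> ennreal (B powr p)"
      using Epos le unfolding A_def[symmetric] E_def[symmetric]
      by (subst divide_ennreal) (auto intro: ennreal_leI)
  qed
  then show ?thesis by (simp add: B_def)
qed

text \<open>Once the modulus of some generation \<open>q\<close> is at most
  \<open>1 / (2 * Cm)\<close>, submultiplicativity halves the modulus every \<open>q\<close>
  generations, so \<open>G\<close> gains the factor \<open>2 powr (1 / p)\<close>. Taking
  \<open>2 \<le> q\<close> ensures \<open>4 \<le> N ^ q\<close>.\<close>

lemma G_sum_bound:
  assumes dim: "ereal p > dim_AR K dist"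
  obtains C where "0 \<le> C" "\<And>l. (\<Sum>i\<le>l. G i) \<le> C * G l"
proof -
  obtain q where q: "2 \<le> q" "max_modulus q \<le> 1 / (2 * Cm)"
    using max_modulus_small[OF dim, of "1 / (2 * Cm)" 2] Cm_pos by auto
  have Nq: "4 \<le> N ^ q"
  proof -
    have "2 ^ 2 \<le> N ^ 2" using N2 by (intro power_mono) auto
    also have "\<dots> \<le> N ^ q" using q(1) N2 by (intro power_increasing) auto
    finally show ?thesis by simp
  qed
  have mono: "x powr (- 1 / p) \<ge> y powr (- 1 / p)" if "0 < x" "x \<le> y" for x y :: real
    using that p_pos by (intro powr_mono2') auto
  define \<theta> where "\<theta> = (1 / 2) powr (1 / p)"
  have "(1 / 2 :: real) powr (1 / p) < 1 powr (1 / p)" using p_pos by (intro powr_less_mono2) auto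
  then have \<theta>: "0 \<le> \<theta>" "\<theta> < 1" by (simp_all add: \<theta>_def)
  have Gq: "G i \<le> \<theta> * G (q + i)" for i
  proof -
    have "max_modulus (q + i) \<le> Cm * max_modulus q * max_modulus i" by (rule max_modulus_mult[OF Nq])
    also have "\<dots> \<le> Cm * (1 / (2 * Cm)) * max_modulus i"
      using q(2) Cm_pos max_modulus_pos[of i] by (intro mult_right_mono mult_left_mono) auto
    also have "\<dots> = max_modulus i / 2" using Cm_pos by simp
    finally have "2 * max_modulus (q + i) \<le> max_modulus i" by simp
    then have "G i \<le> (2 * max_modulus (q + i)) powr (- 1 / p)"
      unfolding G_def using max_modulus_pos[of "q + i"] by (intro mono) auto
    also have "\<dots> = \<theta> * G (q + i)"
      using max_modulus_pos[of "q + i"] by (simp add: powr_mult G_def \<theta>_def powr_minus_divide powr_divide)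
    finally show ?thesis .
  qed
  define D where "D = Cb * real (card S)"
  have "0 < real (card S)" using finite_S S_nonempty by (simp add: card_gt_0_iff)
  then have D: "0 < D" using Cb_pos by (simp add: D_def)
  define L where "L = max 1 (D powr (1 / p))"
  have GL: "G i \<le> L * G (Suc i)" for i
  proof -
    have "max_modulus (Suc i) / D \<le> max_modulus i"
      using max_modulus_Suc[of i] D by (simp add: D_def field_simps)
    then have "G i \<le> (max_modulus (Suc i) / D) powr (- 1 / p)"
      unfolding G_def using max_modulus_pos[of "Suc i"] D by (intro mono) auto
    also have "\<dots> = D powr (1 / p) * G (Suc i)"
      using D max_modulus_pos[of "Suc i"] by (simp add: powr_divide G_def powr_minus_divide)
    also have "\<dots> \<le> L * G (Suc i)" using G_pos[of "Suc i"] by (intro mult_right_mono) (auto simp: L_def)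
    finally show ?thesis .
  qed
  have "(\<Sum>i\<le>l. G i) \<le> real q * L ^ q / (1 - \<theta>) * G l" for l
    by (rule geometric_sum_bound[OF G_pos _ GL \<theta> Gq]) (use q in \<open>auto simp: L_def\<close>)
  moreover have "0 \<le> real q * L ^ q / (1 - \<theta>)" using \<theta> by (simp add: L_def)
  ultimately show thesis using that by blast
qed

lemma homogeneous:
  assumes dim: "ereal p > dim_AR K dist"
  shows "conductively_homogeneous K S f p"
proof -
  obtain k C1 where C1: "0 \<le> C1" "\<And>j. conductance K S f p (k + j) \<le> ennreal (C1 * max_modulus j)"
    using conductance_bound by metis
  obtain C2 where C2: "0 \<le> C2" "\<And>l. (\<Sum>i\<le>l. G i) \<le> C2 * G l" using G_sum_bound[OF dim] by metis
  define s where "s = real (card S)"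
  have s1: "1 \<le> s" using finite_S S_nonempty by (simp add: s_def Suc_leI card_gt_0_iff)
  define P where "P = 2 * s ^ Suc k + 1"
  have P0: "0 \<le> P" using s1 by (simp add: P_def)
  define Q where "Q = P * (Cd * C2 + C2 / G 0)"
  have Q0: "0 \<le> Q" using P0 Cd_nonneg C2 G_pos[of 0] by (simp add: Q_def)
  define R where "R = max (P powr p * (9 * s ^ Suc k)) (Q powr p * C1)"
  have "neighbour_disparity K S f p m * conductance K S f p m \<le> ennreal R" for m
  proof (cases "m \<le> Suc k")
    case True
    have "neighbour_disparity K S f p (m + 0) \<le> ennreal ((2 * s ^ m + 1) powr p)"
      using neighbour_disparity_bound[of m 0] by (simp add: s_def)
    also have "\<dots> \<le> ennreal (P powr p)"
    proof (intro ennreal_leI powr_mono2)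
      show "2 * s ^ m + 1 \<le> P" unfolding P_def using power_increasing[OF True s1] by simp
    qed (use p_pos s1 in auto)
    finally have 1: "neighbour_disparity K S f p m \<le> ennreal (P powr p)" by simp
    have "conductance K S f p m \<le> ennreal (9 * s ^ m)" unfolding s_def by (rule conductance_finite)
    also have "\<dots> \<le> ennreal (9 * s ^ Suc k)" using s1 True by (intro ennreal_leI mult_left_mono power_increasing) auto
    finally have "neighbour_disparity K S f p m * conductance K S f p m \<le> ennreal (P powr p) * ennreal (9 * s ^ Suc k)"
      using 1 by (intro mult_mono) auto
    also have "\<dots> = ennreal (P powr p * (9 * s ^ Suc k))" using s1 by (simp add: ennreal_mult)
    also have "\<dots> \<le> ennreal R" by (rule ennreal_leI) (simp add: R_def)
    finally show ?thesis .
  next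
    case False
    \<comment> \<open>The disparity is cut at depth \<open>Suc k\<close> and the conductance at
      depth \<open>k\<close>: the oscillation sum over \<open>i < j\<close> ends at
      \<open>G (Suc j)\<close>, so both factors then refer to the modulus of generation
      \<open>Suc j\<close>.\<close>
    define j where "j = m - Suc k"
    have m: "m = Suc k + j" "m = k + Suc j" using False by (auto simp: j_def)
    note M = max_modulus_pos[of "Suc j"]
    have "(\<Sum>i<j. G (2 + i)) = (\<Sum>i\<in>(+) 2 ` {..<j}. G i)" by (subst sum.reindex) auto
    also have "\<dots> \<le> (\<Sum>i\<le>Suc j. G i)" using G_pos less_imp_le by (intro sum_mono2) auto
    also have "\<dots> \<le> C2 * G (Suc j)" by (rule C2(2))
    finally have 1: "(\<Sum>i<j. G (2 + i)) \<le> C2 * G (Suc j)" .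
    \<comment> \<open>This absorbs the additive 1, the contribution of single edges, into a multiple
      of \<open>G (Suc j)\<close>.\<close>
    have "G 0 \<le> (\<Sum>i\<le>Suc j. G i)" using G_pos less_imp_le by (intro member_le_sum) auto
    then have "G 0 \<le> C2 * G (Suc j)" using C2(2)[of "Suc j"] by linarith
    then have 2: "1 \<le> C2 / G 0 * G (Suc j)" using G_pos[of 0] by (simp add: field_simps)
    have "Cd * (\<Sum>i<j. G (2 + i)) \<le> Cd * (C2 * G (Suc j))" using 1 Cd_nonneg by (rule mult_left_mono)
    then have "Cd * (\<Sum>i<j. G (2 + i)) + 1 \<le> (Cd * C2 + C2 / G 0) * G (Suc j)"
      using 2 by (simp add: algebra_simps)
    then have "P * (Cd * (\<Sum>i<j. G (2 + i)) + 1) \<le> Q * G (Suc j)"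
      unfolding Q_def using P0 by (simp add: mult_left_mono mult.assoc)
    moreover have "0 \<le> P * (Cd * (\<Sum>i<j. G (2 + i)) + 1)"
      using P0 Cd_nonneg G_pos less_imp_le by (intro mult_nonneg_nonneg add_nonneg_nonneg sum_nonneg) auto
    ultimately have "(P * (Cd * (\<Sum>i<j. G (2 + i)) + 1)) powr p \<le> (Q * G (Suc j)) powr p"
      using p_pos by (intro powr_mono2) auto
    also have "\<dots> = Q powr p / max_modulus (Suc j)"
    proof -
      have "G (Suc j) powr p = 1 / max_modulus (Suc j)"
        unfolding G_def powr_powr using M p_pos by (simp add: powr_minus_divide)
      then show ?thesis using Q0 G_pos[of "Suc j"] by (simp add: powr_mult)
    qed
    finally have 3: "neighbour_disparity K S f p m \<le> ennreal (Q powr p / max_modulus (Suc j))"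
      using neighbour_disparity_bound[of "Suc k" j] unfolding m(1) P_def s_def
      by (meson ennreal_leI order_trans)
    have "conductance K S f p m \<le> ennreal (C1 * max_modulus (Suc j))" unfolding m(2) by (rule C1(2))
    then have "neighbour_disparity K S f p m * conductance K S f p m \<le> ennreal (Q powr p / max_modulus (Suc j)) * ennreal (C1 * max_modulus (Suc j))"
      using 3 by (intro mult_mono) auto
    also have "\<dots> = ennreal (Q powr p / max_modulus (Suc j) * (C1 * max_modulus (Suc j)))"
      using M C1(1) by (intro ennreal_mult[symmetric]) auto
    also have "Q powr p / max_modulus (Suc j) * (C1 * max_modulus (Suc j)) = Q powr p * C1" using M by simp
    also have "ennreal (Q powr p * C1) \<le> ennreal R" by (rule ennreal_leI) (simp add: R_def)
    finally show ?thesis .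
  qed
  then have "(SUP m. neighbour_disparity K S f p m * conductance K S f p m) \<le> ennreal R"
    by (intro SUP_least)
  then show ?thesis unfolding conductively_homogeneous_def
    by (metis ennreal_less_top infinity_ennreal_def le_less_trans)
qed

end

theorem theorem11p6:
  fixes N :: nat
    and K :: "(real^2) set"
    and S :: "(nat \<times> nat) set"
    and f :: "nat \<times> nat \<Rightarrow> real^2 \<Rightarrow> real^2"
    and p :: real
  assumes "N \<ge> 2"
    and "cubic_subsystem N K S f"
    and "non_degenerate K"
    and "locally_symmetric K S f"
    and "strongly_connected S f"
    and "rotation (pi / 2) \<in> cell_homeos K S f \<or>
         (\<forall>i\<in>{1..N}. \<forall>j\<in>{1..N}. \<exists>i\<^sub>1\<in>{1..N-1}. \<exists>j\<^sub>1\<in>{1..N-1}.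
            {(i\<^sub>1, j), (i\<^sub>1 + 1, j), (i, j\<^sub>1), (i, j\<^sub>1 + 1)} \<inter> S = {})"
    and "ereal p > dim_AR K dist"
  shows "conductively_homogeneous K S f p"
proof -
  \<comment> \<open>The conformal dimension is an infimum of positive exponents, so the bound on it
    makes \<open>p\<close> positive.\<close>
  have "0 < ereal p" using dim_AR_nonneg assms(7) by (rule le_less_trans)
  then have "0 < p" by simp
  then interpret tiling_p N K S f p
    using assms by unfold_locales (simp_all add: gaps_def)
  show ?thesis using assms(7) by (rule homogeneous)
qed

end
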